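(* For every integer $n\ge0$ the rank moments $N_j(n)$ and crank moments $M_j(n)$ satisfy the following ten congruences. (1) $$(n+2)M_4(n)+(6n^2+4n+1)M_2(n)\equiv0\pmod 7.$$ (2) $$(n+5)^3M_4(n)\equiv(5n^{4}+10n^{3}+8n^{2}+8n+9)M_{2}(n)\pmod{11}.$$ (3) $$M_6(n)\equiv2(n+7)M_4(n)-(n+8)^2M_2(n)\pmod{11}.$$ (4) $$M_{8}(n)\equiv2(n+5)(n^{2}+5n+10)M_{2}(n)+6(n^{2}+n+1)M_{4}(n)\pmod{11}.$$ (5) $$\begin{aligned}M_{10}(n)&\equiv4(n+7)(n^{3}+5n^{2}+29n+32)M_{2}(n)+39(n+7)(n+14)(n+39)M_{4}(n)\\&\quad+(6n^{2}+34n+39)M_{6}(n)+35(n+13)M_{8}(n)\pmod{41}.\end{aligned}$$ (6) $$\begin{aligned}&(n+7)(n+25)(n+31)(n^{2}+28n+6)N_{2}(n)+N_{12}(n)\\ &\equiv(4n^{5}+10n^{4}+6n^{3}+30n^{2}+31n+33)M_{2}(n)+(n^{4}+4n^{3}+42n^{2}+24n+30)M_{4}(n)\\ &\quad+40(n+10)(n^{2}+32n+7)M_{6}(n)+31(n+13)(n+41)M_{8}(n)+(n+11)M_{10}(n)+22M_{12}(n)\pmod{43}.\end{aligned}$$ (7) $$\begin{aligned}M_{10}(n)&\equiv36(n+19)(n^{3}+50n^{2}+20n+36)M_2(n)+(52n^{3}+28n^{2}+26n+52)M_{4}(n)\\&\quad+(36n^{2}+11n+32)M_{6}(n)+47(n+17)M_{8}(n)\pmod{53}.\end{aligned}$$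 (8) $$M_8(n)\equiv(10n^{3}+73n^{2}+40n+82)M_{2}(n)+(72n^{2}+23n+28)M_{4}(n)+10(n+41)M_6(n)\pmod{83}.$$ (9) $$\begin{aligned}&N_{12}(n)-367(n+332)(n+487)(n+664)(n^{2}+265n+155)N_{2}(n)\\ &\equiv352(n+247)(n+734)(n^{3}+147n^{2}+597n+363)M_{2}(n)\\ &\quad+88(n+530)(n+701)(n+709)(n+740)M_{4}(n)\\ &\quad+577(n+114)(n+427)(n+682)M_{6}(n)+(295n^{2}+177n+674)M_{8}(n)\\ &\quad+271(n+336)M_{10}(n)+654M_{12}(n)\pmod{797}.\end{aligned}$$ (10) $$\begin{aligned}M_{14}(n)&\equiv\bigl(44976165\,n^{6}+23584476\,n^{5}+19728425\,n^{4}+8711555\,n^{3}+36781660\,n^{2}+70780973\,n+108798274\bigr)M_{2}(n)\\ &\quad+77429163\,(n+4141548)(n+113894720)(n^{3}+42853554\,n^{2}+28914352\,n+100598975)M_{4}(n)\\ &\quad+\bigl(12571854\,n^{4}+82951807\,n^{3}+9501843\,n^{2}+38248242\,n+118847240\bigr)M_{6}(n)\\ &\quad+84218605\,(n+53645347)(n^{2}+6688335\,n+93582728)M_{8}(n)\\ &\quad+73449678\,(n+40889782)(n+59666357)M_{10}(n)\\ &\quad+89188917\,(n+120667368)M_{12}(n)\pmod{120667369}.\end{aligned}$$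
   Context: The rank of a partition is its largest part minus its number of parts. $N(m,n)$ is the number of partitions of $n$ with rank $m$; $N(0,0)=1$ and $N(m,0)=0$ for $m\ne0$. The crank of a partition is its largest part if the partition contains no ones; otherwise it is (the number of parts larger than the number of ones) minus (the number of ones). For $n\ge2$, $M(m,n)$ is the number of partitions of $n$ with crank $m$. By convention $M(0,0)=1$ and $M(m,0)=0$ for $m\neq0$; and $M(0,1)=-1$, $M(-1,1)=M(1,1)=1$, $M(m,1)=0$ otherwise. With these conventions it is known that $\sum_{n\ge0}\sum_m M(m,n)z^mq^n=\prod_{n\ge1}\frac{1-q^n}{(1-zq^n)(1-z^{-1}q^n)}$. For even $j\ge2$ the rank and crank moments are the integers $N_j(n)=\sum_{k\in\mathbb Z}k^jN(k,n)$ and $M_j(n)=\sum_{k\in\mathbb Z}k^jM(k,n)$. *)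

theory Defs
  imports
    "HOL-Library.Multiset"
    "HOL-Library.Groups_Big_Fun"
    "HOL-Number_Theory.Cong"
begin

definition partitions_of :: "nat \<Rightarrow> nat multiset set" where
  "partitions_of n = {p. 0 \<notin># p \<and> \<Sum>\<^sub># p = n}"

(* The value at the empty partition is irrelevant: the counts below treat n = 0 separately. *)
definition partition_rank :: "nat multiset \<Rightarrow> int" where
  "partition_rank p = int (Max (set_mset p)) - int (size p)"

definition partition_crank :: "nat multiset \<Rightarrow> int" where
  "partition_crank p =
     (if 1 \<notin># p then int (Max (set_mset p))
      else int (size {#k \<in># p. k > count p 1#}) - int (count p 1))"

definition rank_count :: "int \<Rightarrow> nat \<Rightarrow> int" where
  "rank_count m n =
     (if n = 0 then (if m = 0 then 1 else 0)
      else int (card {p \<in> partitions_of n. partition_rank p = m}))"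

(* At n = 1 the conventional values, which are the coefficients of the generating product,
   replace the actual count (the only partition of 1 has crank -1). *)
definition crank_count :: "int \<Rightarrow> nat \<Rightarrow> int" where
  "crank_count m n =
     (if n = 0 then (if m = 0 then 1 else 0)
      else if n = 1 then (if m = 0 then - 1 else if m = 1 \<or> m = - 1 then 1 else 0)
      else int (card {p \<in> partitions_of n. partition_crank p = m}))"

(* Sum_any is 0 when the summand has infinite support; rank_moment_finite_support and
   crank_moment_finite_support below show that this never happens here. *)
definition rank_moment :: "nat \<Rightarrow> nat \<Rightarrow> int" where
  "rank_moment j n = Sum_any (\<lambda>k::int. k ^ j * rank_count k n)"

definition crank_moment :: "nat \<Rightarrow> nat \<Rightarrow> int" where
  "crank_moment j n = Sum_any (\<lambda>k::int. k ^ j * crank_count k n)"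

lemma finite_partitions_of: "finite (partitions_of n)"
proof -
  have sz: "size p \<le> \<Sum>\<^sub># p" if "0 \<notin># p" for p :: "nat multiset"
    using that by (induction p) auto
  have le: "k \<le> \<Sum>\<^sub># p" if "k \<in># p" for k and p :: "nat multiset"
    using that by (induction p) auto
  have "partitions_of n \<subseteq> mset ` {xs. set xs \<subseteq> {..n} \<and> length xs \<le> n}"
  proof
    fix p assume p: "p \<in> partitions_of n"
    obtain xs where xs: "mset xs = p"
      using ex_mset by blast
    have "length xs \<le> n"
      using p sz[of p] by (simp add: partitions_of_def flip: xs)
    moreover have "set xs \<subseteq> {..n}"
      using p le[of _ p] by (auto simp: partitions_of_def simp flip: xs)
    ultimately show "p \<in> mset ` {xs. set xs \<subseteq> {..n} \<and> length xs \<le> n}"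
      using xs by blast
  qed
  then show ?thesis
    by (rule finite_subset) (intro finite_imageI finite_lists_length_le, simp)
qed

lemma card_nonzero_support:
  "finite {k::int. card {p \<in> partitions_of n. f p = k} \<noteq> 0}"
  by (rule finite_subset[OF _ finite_imageI[OF finite_partitions_of[of n], of f]])
     (auto simp: card_eq_0_iff)

lemma rank_moment_finite_support:
  "finite {k::int. k ^ j * rank_count k n \<noteq> 0}"
  by (rule finite_subset[of _
        "{0} \<union> {k. card {p \<in> partitions_of n. partition_rank p = k} \<noteq> 0}"])
     (use card_nonzero_support in \<open>auto simp: rank_count_def split: if_splits\<close>)

lemma crank_moment_finite_support:
  "finite {k::int. k ^ j * crank_count k n \<noteq> 0}"
  by (rule finite_subset[of _
        "{-1, 0, 1} \<union> {k. card {p \<in> partitions_of n. partition_crank p = k} \<noteq> 0}"])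
     (use card_nonzero_support in \<open>auto simp: crank_count_def split: if_splits\<close>)

end

theory Submission
  imports Defs "HOL-Computational_Algebra.Formal_Power_Series"
begin

text \<open>
  The crank moments are those of the product \<open>\<Prod>\<^sub>k (1 - q\<^sup>k) / ((1 - z q\<^sup>k) (1 - q\<^sup>k / z))\<close>, so by logarithmic
  differentiation in \<open>z\<close> their generating functions are the partition generating function times
  polynomials in the divisor sum series \<open>\<Sum>\<^sub>n \<sigma>\<^sub>l(n) q\<^sup>n\<close> (\<open>l\<close> odd), that is, in the Eisenstein series
  \<open>E\<^sub>2\<close>, \<open>E\<^sub>4\<close>, \<open>E\<^sub>6\<close>. Multiplication by \<open>n\<close> is \<open>q d/dq\<close>, under which this space is stable by
  Ramanujan's differential equations.

  For the rank moments, let \<open>G\<^sub>m\<close> be the generating function of the partitions of rank at most \<open>m\<close>.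
  Dyson's symmetry relates \<open>G\<^sub>m\<close> to \<open>G\<^sub>m\<^sub>-\<^sub>3\<close>; the coefficients of \<open>z\<^sup>m\<close> on both sides of the rank-crank
  partial differential equation of Atkin and Garvan satisfy the same such relation, which has only
  one solution. Taking moments expresses all rank moments through the second one and polynomials in
  \<open>E\<^sub>2\<close>, \<open>E\<^sub>4\<close>, \<open>E\<^sub>6\<close>.

  Each congruence then says that a polynomial in \<open>E\<^sub>2\<close>, \<open>E\<^sub>4\<close>, \<open>E\<^sub>6\<close> has all its coefficients
  divisible by the modulus, up to the relations \<open>E\<^sub>6 = 1\<close> modulo 7 and \<open>E\<^sub>4 E\<^sub>6 = 1\<close> modulo 11.
\<close>

section \<open>Locally finite sums of power series\<close>

text \<open>The products involve both z and 1/z, so each is kept as a family of integer power series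
  in q indexed by the exponent of z, and every interchange of sums rests on local finiteness. For
  the crank, sorting partitions by their number of ones yields a sum with the extra weight
  q^(j(m+j)), which is not visibly a coefficient of a product; identifying the two takes a
  recurrence in m together with the behaviour for large m. For the rank, the poles at z = 1 are
  expanded in positive powers of z, which replaces rank counts by cumulative counts; third
  differences in m remove the poles again at the end. The second rank moment cannot be eliminated in
  this way, because the moment relation of order 2 contains N_0 but not N_2. All series keep integer
  coefficients: denominators such as 24 or 65520 are cleared, and inverted only modulo the modulus
  at hand, so that a congruence becomes the vanishing of a finite list of residues.\<close>

definition locfin :: "('i \<Rightarrow> 'a::comm_ring_1 fps) \<Rightarrow> bool" where
  "locfin f \<longleftrightarrow> (\<forall>n. finite {i. fps_nth (f i) n \<noteq> 0})"

definition fsum :: "('i \<Rightarrow> 'a::comm_ring_1 fps) \<Rightarrow> 'a fps" where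
  "fsum f = Abs_fps (\<lambda>n. \<Sum>i | fps_nth (f i) n \<noteq> 0. fps_nth (f i) n)"

text \<open>Divisibility by q^k. Limits for large m are expressed through it: a series that
  satisfies \<open>vanish k\<close> for every k is 0.\<close>

definition vanish :: "nat \<Rightarrow> 'a::comm_ring_1 fps \<Rightarrow> bool" where
  "vanish k f \<longleftrightarrow> (\<forall>n<k. fps_nth f n = 0)"

lemma fsum_nth:
  assumes "finite S" "\<And>i. i \<notin> S \<Longrightarrow> fps_nth (f i) n = 0"
  shows "fps_nth (fsum f) n = (\<Sum>i\<in>S. fps_nth (f i) n)"
  unfolding fsum_def fps_nth_Abs_fps
  by (rule sum.mono_neutral_left) (use assms in auto)

lemma locfinD: "locfin f \<Longrightarrow> finite {i. fps_nth (f i) n \<noteq> 0}"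
  by (simp add: locfin_def)

lemma locfinI: "(\<And>n. finite {i. fps_nth (f i) n \<noteq> 0}) \<Longrightarrow> locfin f"
  by (simp add: locfin_def)

lemma vanish_0 [simp]: "vanish 0 f"
  by (simp add: vanish_def)

lemma vanish_zero [simp]: "vanish k 0"
  by (simp add: vanish_def)

lemma vanish_mono: "vanish k f \<Longrightarrow> l \<le> k \<Longrightarrow> vanish l f"
  by (simp add: vanish_def)

lemma vanish_add: "vanish k f \<Longrightarrow> vanish k g \<Longrightarrow> vanish k (f + g)"
  by (simp add: vanish_def)

lemma vanish_diff: "vanish k f \<Longrightarrow> vanish k g \<Longrightarrow> vanish k (f - g)"
  by (simp add: vanish_def)

lemma vanish_uminus: "vanish k f \<Longrightarrow> vanish k (- f)"
  by (simp add: vanish_def)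

lemma vanish_mult:
  assumes "vanish k f" "vanish l g"
  shows "vanish (k + l) (f * g)"
  unfolding vanish_def
proof safe
  fix n assume n: "n < k + l"
  have "fps_nth f i * fps_nth g (n - i) = 0" if "i \<le> n" for i
    using assms n that unfolding vanish_def by (cases "i < k") (auto simp: not_less less_diff_conv2)
  then show "fps_nth (f * g) n = 0"
    by (simp add: fps_mult_nth)
qed

lemma vanish_mult_left: "vanish k f \<Longrightarrow> vanish k (g * f)"
  using vanish_mult[of 0 g k f] by simp

lemma vanish_mult_right: "vanish k f \<Longrightarrow> vanish k (f * g)"
  using vanish_mult[of k f 0 g] by simp

lemma vanish_X_power: "vanish k (fps_X ^ k)"
  by (simp add: vanish_def)

lemma vanish_X_mult: "vanish l g \<Longrightarrow> vanish (k + l) (fps_X ^ k * g)"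
  by (rule vanish_mult[OF vanish_X_power])

lemma vanish_X_mult_cancel: "vanish (k + l) (fps_X ^ k * g) \<Longrightarrow> vanish l g"
  unfolding vanish_def fps_X_power_mult_nth
  by (metis add.commute add_diff_cancel_left' add_less_cancel_left not_add_less1)

lemma vanish_fsum: "(\<And>i. vanish k (f i)) \<Longrightarrow> vanish k (fsum f)"
  by (simp add: vanish_def fsum_def)

lemma vanish_all_imp_zero: "(\<And>k. vanish k f) \<Longrightarrow> f = 0"
  by (rule fps_ext) (use lessI in \<open>auto simp: vanish_def\<close>)

lemma vanish_XD: "vanish k f \<Longrightarrow> vanish k (fps_XD f)"
  by (simp add: vanish_def)

lemma locfin_vanish:
  assumes "\<And>i. vanish (h i) (f i)" "\<And>n. finite {i. h i \<le> n}"
  shows "locfin f"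
proof (rule locfinI)
  fix n
  have "{i. fps_nth (f i) n \<noteq> 0} \<subseteq> {i. h i \<le> n}"
    using assms(1) unfolding vanish_def by (auto simp: not_le[symmetric])
  then show "finite {i. fps_nth (f i) n \<noteq> 0}"
    using assms(2) finite_subset by blast
qed

lemma finite_int_bound: "finite {i::int. nat \<bar>i + c\<bar> \<le> n}"
  by (rule finite_subset[of _ "{- int n - c..int n - c}"]) auto

lemma locfin_int:
  fixes f :: "int \<Rightarrow> 'a::comm_ring_1 fps"
  assumes "\<And>i. vanish (nat \<bar>i + c\<bar>) (f i)"
  shows "locfin f"
  by (rule locfin_vanish[OF assms finite_int_bound])

lemma locfin_nat:
  fixes f :: "nat \<Rightarrow> 'a::comm_ring_1 fps"
  assumes "\<And>i. vanish i (f i)"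
  shows "locfin f"
  by (rule locfin_vanish[OF assms]) simp

lemma locfin_add:
  assumes "locfin f" "locfin g"
  shows "locfin (\<lambda>i. f i + g i)"
proof (rule locfinI)
  fix n
  have "{i. fps_nth (f i + g i) n \<noteq> 0} \<subseteq> {i. fps_nth (f i) n \<noteq> 0} \<union> {i. fps_nth (g i) n \<noteq> 0}"
    by auto
  then show "finite {i. fps_nth (f i + g i) n \<noteq> 0}"
    by (rule finite_subset) (use assms in \<open>auto simp: locfinD\<close>)
qed

lemma locfin_uminus: "locfin f \<Longrightarrow> locfin (\<lambda>i. - f i)"
  by (simp add: locfin_def)

lemma locfin_diff: "locfin f \<Longrightarrow> locfin g \<Longrightarrow> locfin (\<lambda>i. f i - g i)"
  using locfin_add[OF _ locfin_uminus] by fastforce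

text \<open>Coefficient n of a product only sees the coefficients of \<open>f i\<close> up to n, so
  the multipliers \<open>c i\<close> may be arbitrary.\<close>

lemma locfin_cmult:
  assumes "locfin f"
  shows "locfin (\<lambda>i. c i * f i)"
proof (rule locfinI)
  fix n
  have "{i. fps_nth (c i * f i) n \<noteq> 0} \<subseteq> (\<Union>k\<le>n. {i. fps_nth (f i) k \<noteq> 0})"
  proof
    fix i assume "i \<in> {i. fps_nth (c i * f i) n \<noteq> 0}"
    then have "\<exists>k\<in>{0..n}. fps_nth (c i) k * fps_nth (f i) (n - k) \<noteq> 0"
      by (metis (mono_tags, lifting) fps_mult_nth mem_Collect_eq sum.not_neutral_contains_not_neutral)
    then obtain k where "k \<le> n" "fps_nth (f i) (n - k) \<noteq> 0"
      by (metis atLeastAtMost_iff mult_zero_right)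
    then show "i \<in> (\<Union>k\<le>n. {i. fps_nth (f i) k \<noteq> 0})"
      by (intro UN_I[of "n - k"]) auto
  qed
  then show "finite {i. fps_nth (c i * f i) n \<noteq> 0}"
    by (rule finite_subset) (use locfinD[OF assms] in auto)
qed

lemma locfin_inj: "locfin f \<Longrightarrow> inj h \<Longrightarrow> locfin (\<lambda>i. f (h i))"
  unfolding locfin_def
  by (metis (no_types, lifting) ext finite_vimageI vimage_Collect_eq)

lemma locfin_restrict: "locfin f \<Longrightarrow> locfin (\<lambda>i. if P i then f i else 0)"
  by (rule locfinI, rule finite_subset[OF _ locfinD[of f]]) (auto split: if_splits)

lemma fsum_add:
  assumes "locfin f" "locfin g"
  shows "fsum (\<lambda>i. f i + g i) = fsum f + fsum g"
proof (rule fps_ext)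
  fix n
  let ?S = "{i. fps_nth (f i) n \<noteq> 0} \<union> {i. fps_nth (g i) n \<noteq> 0}"
  have fin: "finite ?S"
    using assms by (simp add: locfinD)
  show "fps_nth (fsum (\<lambda>i. f i + g i)) n = fps_nth (fsum f + fsum g) n"
    by (subst fps_add_nth, subst (1 2 3) fsum_nth[OF fin]) (auto simp: sum.distrib)
qed

lemma fsum_uminus: "fsum (\<lambda>i. - f i) = - fsum f"
  by (rule fps_ext) (simp add: fsum_def sum_negf)

lemma fsum_diff:
  assumes "locfin f" "locfin g"
  shows "fsum (\<lambda>i. f i - g i) = fsum f - fsum g"
  using fsum_add[OF assms(1) locfin_uminus[OF assms(2)]] by (simp add: fsum_uminus)

lemma fsum_zero [simp]: "fsum (\<lambda>_. 0) = 0"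
  by (rule fps_ext) (simp add: fsum_def)

lemma fsum_cmult:
  assumes "locfin f"
  shows "fsum (\<lambda>i. c * f i) = c * fsum f"
proof (rule fps_ext)
  fix n
  let ?S = "\<Union>k\<le>n. {i. fps_nth (f i) k \<noteq> 0}"
  have fin: "finite ?S"
    using assms by (simp add: locfinD)
  have z: "fps_nth (f i) k = 0" if "i \<notin> ?S" "k \<le> n" for i k
    using that by auto
  have "fps_nth (fsum (\<lambda>i. c * f i)) n = (\<Sum>i\<in>?S. fps_nth (c * f i) n)"
    by (rule fsum_nth[OF fin]) (auto simp: fps_mult_nth intro!: sum.neutral z)
  also have "\<dots> = (\<Sum>j=0..n. fps_nth c j * (\<Sum>i\<in>?S. fps_nth (f i) (n - j)))"
    by (simp add: fps_mult_nth sum_distrib_left sum.swap[of _ ?S])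
  also have "\<dots> = (\<Sum>j=0..n. fps_nth c j * fps_nth (fsum f) (n - j))"
    by (intro sum.cong refl arg_cong2[where f = "(*)"] fsum_nth[OF fin, symmetric]) (auto intro: z)
  finally show "fps_nth (fsum (\<lambda>i. c * f i)) n = fps_nth (c * fsum f) n"
    by (simp add: fps_mult_nth)
qed

lemma fsum_cmult_right: "locfin f \<Longrightarrow> fsum (\<lambda>i. f i * c) = fsum f * c"
  using fsum_cmult[of f c] by (simp add: mult.commute)

lemma fsum_reindex:
  assumes "inj h" "\<And>i. i \<notin> range h \<Longrightarrow> f i = 0"
  shows "fsum (\<lambda>i. f (h i)) = fsum f"
proof (rule fps_ext)
  fix n
  have im: "{i. fps_nth (f i) n \<noteq> 0} = h ` {i. fps_nth (f (h i)) n \<noteq> 0}"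
    using assms(2) by (auto simp: image_iff) (metis rangeE fps_zero_nth)
  show "fps_nth (fsum (\<lambda>i. f (h i))) n = fps_nth (fsum f) n"
    unfolding fsum_def fps_nth_Abs_fps im
    by (subst sum.reindex) (use assms(1) in \<open>auto intro: inj_on_subset\<close>)
qed

lemma fsum_shift: "fsum (\<lambda>i::int. f (i + c)) = fsum f"
  by (rule fsum_reindex[of "\<lambda>i. i + c"]) (auto simp: image_iff inj_def intro: exI[of _ "_ - c"])

lemma fsum_Sigma:
  assumes "locfin (\<lambda>(i, j). f i j)"
  shows "fsum (\<lambda>(i, j). f i j) = fsum (\<lambda>i. fsum (\<lambda>j. f i j))"
proof (rule fps_ext)
  fix n
  let ?T = "{p. fps_nth (case p of (i, j) \<Rightarrow> f i j) n \<noteq> 0}"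
  have fin: "finite ?T"
    using locfinD[OF assms] by simp
  let ?I = "fst ` ?T" let ?J = "snd ` ?T"
  have z: "fps_nth (f i j) n = 0" if "i \<notin> ?I \<or> j \<notin> ?J" for i j
    using that by (auto simp: image_iff)
  have "fps_nth (fsum (\<lambda>(i, j). f i j)) n = (\<Sum>p\<in>?I \<times> ?J. fps_nth (case p of (i, j) \<Rightarrow> f i j) n)"
    by (rule fsum_nth) (use fin z in auto)
  also have "\<dots> = (\<Sum>i\<in>?I. \<Sum>j\<in>?J. fps_nth (f i j) n)"
    by (simp add: sum.cartesian_product split_def)
  also have "\<dots> = (\<Sum>i\<in>?I. fps_nth (fsum (f i)) n)"
    by (intro sum.cong refl fsum_nth[symmetric]) (use fin z in auto)
  also have "\<dots> = fps_nth (fsum (\<lambda>i. fsum (f i))) n"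
    by (rule fsum_nth[symmetric]) (use fin z in \<open>auto simp: fsum_def\<close>)
  finally show "fps_nth (fsum (\<lambda>(i, j). f i j)) n = fps_nth (fsum (\<lambda>i. fsum (\<lambda>j. f i j))) n" .
qed

lemma locfin_fsum:
  assumes "locfin (\<lambda>(i, j). f i j)"
  shows "locfin (\<lambda>i. fsum (f i))"
proof (rule locfinI)
  fix n
  have "{i. fps_nth (fsum (f i)) n \<noteq> 0} \<subseteq> fst ` {p. fps_nth (case p of (i, j) \<Rightarrow> f i j) n \<noteq> 0}"
  proof
    fix i assume "i \<in> {i. fps_nth (fsum (f i)) n \<noteq> 0}"
    then obtain j where "fps_nth (f i j) n \<noteq> 0"
      by (auto simp: fsum_def elim: sum.not_neutral_contains_not_neutral)
    then show "i \<in> fst ` {p. fps_nth (case p of (i, j) \<Rightarrow> f i j) n \<noteq> 0}"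
      by (intro image_eqI[of _ _ "(i, j)"]) auto
  qed
  then show "finite {i. fps_nth (fsum (f i)) n \<noteq> 0}"
    using locfinD[OF assms] finite_surj by blast
qed

lemma fsum_swap_pair: "fsum (\<lambda>(i, j). f i j) = fsum (\<lambda>(j, i). f i j)"
  using fsum_reindex[of prod.swap "\<lambda>(i, j). f i j"]
  by (simp add: split_def)

lemma locfin_swap_pair: "locfin (\<lambda>(i, j). f i j) \<Longrightarrow> locfin (\<lambda>(j, i). f i j)"
  using locfin_inj[of "\<lambda>(i, j). f i j" prod.swap] by (simp add: split_def)

lemma fsum_swap:
  assumes "locfin (\<lambda>(i, j). f i j)"
  shows "fsum (\<lambda>i. fsum (\<lambda>j. f i j)) = fsum (\<lambda>j. fsum (\<lambda>i. f i j))"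
  using fsum_Sigma[OF assms] fsum_Sigma[OF locfin_swap_pair[OF assms]] fsum_swap_pair[of f] by simp

lemma locfin_prod:
  assumes "locfin f" "locfin g"
  shows "locfin (\<lambda>(i, j). f i * g j)"
proof (rule locfinI)
  fix n
  let ?A = "\<Union>k\<le>n. {i. fps_nth (f i) k \<noteq> 0}" and ?B = "\<Union>k\<le>n. {i. fps_nth (g i) k \<noteq> 0}"
  have "fps_nth (f i * g j) n = 0" if "i \<notin> ?A \<or> j \<notin> ?B" for i j
    unfolding fps_mult_nth
  proof (rule sum.neutral, safe)
    fix k assume k: "k \<in> {0..n}"
    from that show "fps_nth (f i) k * fps_nth (g j) (n - k) = 0"
    proof
      assume "i \<notin> ?A"
      then have "fps_nth (f i) k = 0" using k by auto
      then show ?thesis by simp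
    next
      assume "j \<notin> ?B"
      then have "fps_nth (g j) (n - k) = 0" using k by auto
      then show ?thesis by simp
    qed
  qed
  then have "{p. fps_nth (case p of (i, j) \<Rightarrow> f i * g j) n \<noteq> 0} \<subseteq> ?A \<times> ?B"
    by force
  then show "finite {p. fps_nth (case p of (i, j) \<Rightarrow> f i * g j) n \<noteq> 0}"
    by (rule finite_subset) (use assms in \<open>auto simp: locfinD\<close>)
qed

lemma fsum_prod:
  assumes "locfin f" "locfin g"
  shows "fsum f * fsum g = fsum (\<lambda>(i, j). f i * g j)"
  by (simp add: fsum_Sigma[OF locfin_prod[OF assms]] fsum_cmult[OF assms(2)] fsum_cmult_right[OF assms(1)])

lemma locfin_XD: "locfin f \<Longrightarrow> locfin (\<lambda>i. fps_XD (f i))"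
proof (rule locfinI)
  fix n
  assume "locfin f"
  have "{i. fps_nth (fps_XD (f i)) n \<noteq> 0} \<subseteq> {i. fps_nth (f i) n \<noteq> 0}"
    by auto
  then show "finite {i. fps_nth (fps_XD (f i)) n \<noteq> 0}"
    using \<open>locfin f\<close> finite_subset locfinD by blast
qed

lemma fsum_XD:
  assumes "locfin f"
  shows "fps_XD (fsum f) = fsum (\<lambda>i. fps_XD (f i))"
proof (rule fps_ext)
  fix n
  have "fps_nth (fsum (\<lambda>i. fps_XD (f i))) n = (\<Sum>i | fps_nth (f i) n \<noteq> 0. of_nat n * fps_nth (f i) n)"
    by (subst fsum_nth[OF locfinD[OF assms]]) auto
  then show "fps_nth (fps_XD (fsum f)) n = fps_nth (fsum (\<lambda>i. fps_XD (f i))) n"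
    by (simp add: fsum_def sum_distrib_left)
qed

lemma locfin_sum: "finite L \<Longrightarrow> (\<And>l. l \<in> L \<Longrightarrow> locfin (f l)) \<Longrightarrow> locfin (\<lambda>i. \<Sum>l\<in>L. f l i)"
proof (induction rule: finite_induct)
  case empty
  show ?case by (simp add: locfin_def)
next
  case (insert x F)
  then show ?case by (simp add: locfin_add)
qed

lemma fsum_finite:
  assumes "finite S" "\<And>i. i \<notin> S \<Longrightarrow> f i = 0"
  shows "fsum f = (\<Sum>i\<in>S. f i)"
  by (rule fps_ext) (use assms in \<open>simp add: fps_sum_nth fsum_nth[of S]\<close>)

lemma fsum_sum:
  "finite L \<Longrightarrow> (\<And>l. l \<in> L \<Longrightarrow> locfin (f l)) \<Longrightarrow> fsum (\<lambda>i. \<Sum>l\<in>L. f l i) = (\<Sum>l\<in>L. fsum (f l))"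
  by (induction rule: finite_induct) (simp_all add: fsum_add locfin_sum)

section \<open>Lambert series and the generating function of partitions by number of parts\<close>

text \<open>The series q^d / (1 - q^d), given by its coefficients to stay over the integers. Since
  \<open>lam 0 = 0\<close>, sums can run over all natural numbers.\<close>

definition lam :: "nat \<Rightarrow> int fps" where
  "lam d = Abs_fps (\<lambda>n. if 0 < n \<and> d dvd n then 1 else 0)"

lemma lam_0 [simp]: "lam 0 = 0"
  by (rule fps_ext) (auto simp: lam_def)

lemma lam_geometric:
  assumes "d > 0"
  shows "(1 - fps_X ^ d) * lam d = fps_X ^ d"
proof (rule fps_ext)
  fix n
  have "n < d \<Longrightarrow> 0 < n \<Longrightarrow> \<not> d dvd n"
    using nat_dvd_not_less by blast
  moreover have "d dvd n - d \<longleftrightarrow> d dvd n" if "d \<le> n"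
    using that by (meson dvd_minus_self not_less)
  ultimately show "fps_nth ((1 - fps_X ^ d) * lam d) n = fps_nth (fps_X ^ d) n"
    using assms by (auto simp: algebra_simps fps_X_power_mult_nth lam_def)
qed

lemma lam_inverse: "d > 0 \<Longrightarrow> (1 - fps_X ^ d) * (1 + lam d) = 1"
  using lam_geometric[of d] by (simp add: algebra_simps)

lemma vanish_lam: "vanish d (lam d)"
  unfolding vanish_def lam_def using nat_dvd_not_less by auto

lemma one_minus_X_power_nonzero: "d > 0 \<Longrightarrow> (1 - fps_X ^ d :: int fps) \<noteq> 0"
  using lam_inverse[of d] by auto

lemma XD_mult: "fps_XD (f * g) = fps_XD f * g + f * fps_XD (g :: 'a::comm_ring_1 fps)"
  by (simp add: fps_XD_def algebra_simps)

lemma XD_diff: "fps_XD (f - g) = fps_XD f - fps_XD (g :: 'a::comm_ring_1 fps)"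
  by (rule fps_ext) (simp add: algebra_simps)

lemma XD_1 [simp]: "fps_XD (1 :: 'a::comm_ring_1 fps) = 0"
  by (simp add: fps_XD_def)

lemma XD_X_power: "fps_XD (fps_X ^ d :: 'a::comm_ring_1 fps) = of_nat d * fps_X ^ d"
  by (rule fps_ext) (simp add: fps_mult_of_nat_nth)

lemma XD_power: "fps_XD (f ^ r) = of_nat r * f ^ (r - 1) * fps_XD (f :: 'a::comm_ring_1 fps)"
proof (induction r)
  case (Suc r)
  then show ?case
    by (cases r) (simp_all add: XD_mult algebra_simps)
qed simp

text \<open>Differentiate (1 - q^d) lam d = q^d and cancel the factor 1 - q^d, which stands in for
  the quotient rule.\<close>

lemma XD_lam: "fps_XD (lam d) = of_nat d * lam d * (1 + lam d)"
proof (cases "d = 0")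
  case False
  have "fps_XD ((1 - fps_X ^ d) * lam d) = fps_XD (fps_X ^ d)"
    using False by (simp add: lam_geometric)
  then have "(1 - fps_X ^ d) * fps_XD (lam d) = of_nat d * fps_X ^ d * (1 + lam d)"
    by (simp add: XD_mult XD_diff XD_X_power algebra_simps)
  also have "\<dots> = of_nat d * ((1 - fps_X ^ d) * lam d) * (1 + lam d)"
    using False by (simp only: lam_geometric[of d])
  also have "\<dots> = (1 - fps_X ^ d) * (of_nat d * lam d * (1 + lam d))"
    by (simp only: mult_ac)
  finally show ?thesis
    using one_minus_X_power_nonzero[of d] False by simp
qed (simp add: fps_XD_def)

section \<open>Euler's product in z and its logarithmic derivative\<close>

primrec upart :: "nat \<Rightarrow> int fps" where
  "upart 0 = 1"
| "upart (Suc k) = (1 + lam (Suc k)) * upart k"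

lemma upart_Suc: "(1 - fps_X ^ Suc k) * upart (Suc k) = upart k"
  using lam_inverse[of "Suc k"] by (simp flip: mult.assoc)

text \<open>In \<^typ>\<open>int fps fps\<close> the outer variable is \<open>z\<close> and the inner one \<open>q\<close>: \<open>zshift\<close> substitutes \<open>z q\<close>
  for \<open>z\<close>, and \<open>zser\<close> below is the product of all \<open>1 / (1 - z q\<^sup>k)\<close> over \<open>k \<ge> 0\<close>.\<close>

definition zshift :: "int fps fps \<Rightarrow> int fps fps" where
  "zshift f = Abs_fps (\<lambda>j. fps_X ^ j * fps_nth f j)"

lemma zshift_nth [simp]: "fps_nth (zshift f) j = fps_X ^ j * fps_nth f j"
  by (simp add: zshift_def)

lemma zshift_mult: "zshift (f * g) = zshift f * zshift g"
proof (rule fps_ext)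
  fix n
  have "fps_X ^ n * (fps_nth f i * fps_nth g (n - i)) =
      (fps_X ^ i * fps_nth f i) * (fps_X ^ (n - i) * fps_nth g (n - i))" if "i \<le> n" for i
  proof -
    have "fps_X ^ n = (fps_X ^ i * fps_X ^ (n - i) :: int fps)"
      using that by (simp flip: power_add)
    then show ?thesis
      by (simp only: mult_ac)
  qed
  then have "(\<Sum>i=0..n. fps_X ^ n * (fps_nth f i * fps_nth g (n - i))) =
      (\<Sum>i=0..n. (fps_X ^ i * fps_nth f i) * (fps_X ^ (n - i) * fps_nth g (n - i)))"
    by (intro sum.cong) auto
  then show "fps_nth (zshift (f * g)) n = fps_nth (zshift f * zshift g) n"
    by (simp only: fps_mult_nth sum_distrib_left zshift_nth)
qed

lemma zshift_1 [simp]: "zshift 1 = 1"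
  by (rule fps_ext) simp

lemma zshift_power: "zshift (f ^ r) = zshift f ^ r"
  by (induction r) (simp_all add: zshift_mult)

lemma zshift_XD: "zshift (fps_XD f) = fps_XD (zshift f)"
  by (rule fps_ext) (simp add: mult.left_commute)

lemma zshift_diff: "zshift (f - g) = zshift f - zshift g"
  by (rule fps_ext) (simp add: algebra_simps)

definition zser :: "int fps fps" where
  "zser = Abs_fps upart"

text \<open>Since \<open>upart k\<close> is 1 / ((1 - q) ... (1 - q^k)), the series
  \<open>zser\<close> is Euler's expansion of the product. Passing from z to z q removes the factor
  for k = 0; on coefficients this is \<open>upart_Suc\<close>.\<close>

lemma zser_shift: "(1 - fps_X) * zser = zshift zser"
proof (rule fps_ext)
  fix n
  show "fps_nth ((1 - fps_X) * zser) n = fps_nth (zshift zser) n"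
  proof (cases n)
    case (Suc k)
    have "fps_X ^ Suc k * upart (Suc k) = upart (Suc k) - upart k"
      using upart_Suc[of k] by (simp only: left_diff_distrib mult_1_left) (metis diff_diff_eq2 add_diff_cancel_left')
    then show ?thesis
      by (simp add: zser_def Suc left_diff_distrib del: upart.simps power_Suc)
  qed (simp add: zser_def)
qed

text \<open>The second factor is the sum of z^d / (1 - q^d), which expands the sum of all z q^k / (1
  - z q^k). Instead of differentiating an infinite product, the difference W of the two sides is
  shown to satisfy W(z q) = (1 - z) W(z) with constant term 0, and comparing coefficients forces W =
  0.\<close>

lemma zser_XD: "fps_XD zser = zser * Abs_fps (\<lambda>d. if d = 0 then 0 else 1 + lam d)" (is "_ = _ * ?L")
proof -
  define W where "W = fps_XD zser - zser * ?L"
  \<comment> \<open>On coefficients (1 - q^d) (1 + lam d) = 1, so L(z) - L(z q) is z / (1 -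
    z).\<close>
  have L: "(1 - fps_X) * (?L - zshift ?L) = fps_X"
  proof -
    have "?L - zshift ?L = Abs_fps (\<lambda>d. if d = 0 then 0 else 1)"
    proof (rule fps_ext)
      fix d
      show "fps_nth (?L - zshift ?L) d = fps_nth (Abs_fps (\<lambda>d. if d = 0 then 0 else 1)) d"
        using lam_inverse[of d] by (simp add: algebra_simps)
    qed
    moreover have "(1 - fps_X) * Abs_fps (\<lambda>d. if d = 0 then 0 else 1) = (fps_X :: int fps fps)"
      by (rule fps_ext) (auto simp: left_diff_distrib)
    ultimately show ?thesis by simp
  qed
  have A: "zshift (fps_XD zser) = (1 - fps_X) * fps_XD zser - fps_X * zser"
    unfolding zshift_XD zser_shift[symmetric] by (simp add: XD_mult XD_diff fps_XD_def algebra_simps)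
  have B: "zshift (zser * ?L) = (1 - fps_X) * (zser * ?L) - fps_X * zser"
  proof -
    have "zshift (zser * ?L) = zser * ((1 - fps_X) * zshift ?L)"
      unfolding zshift_mult zser_shift[symmetric] by (simp add: mult_ac)
    also have "(1 - fps_X) * zshift ?L = (1 - fps_X) * ?L - fps_X"
      using L by (simp add: algebra_simps)
    finally show ?thesis by (simp add: algebra_simps)
  qed
  have "zshift W = ((1 - fps_X) * fps_XD zser - fps_X * zser) - ((1 - fps_X) * (zser * ?L) - fps_X * zser)"
    by (simp only: W_def zshift_diff A B)
  then have W: "zshift W = (1 - fps_X) * W"
    by (simp add: W_def algebra_simps)
  have "fps_nth W k = 0" for k
  proof (induction k)
    case 0
    show ?case by (simp add: W_def fps_XD_def)
  next
    case (Suc k)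
    have "fps_nth (zshift W) (Suc k) = fps_nth ((1 - fps_X) * W) (Suc k)"
      by (simp add: W)
    then have "(1 - fps_X ^ Suc k) * fps_nth W (Suc k) = 0"
      using Suc by (simp add: algebra_simps)
    then show ?case
      using one_minus_X_power_nonzero[of "Suc k"] by (metis mult_eq_0_iff zero_less_Suc)
  qed
  then have "W = 0" by (simp add: fps_eq_iff)
  then show ?thesis by (simp add: W_def)
qed

section \<open>Coefficients in z of the products, and their moments\<close>

definition acoef :: "nat \<Rightarrow> int \<Rightarrow> int fps" where
  "acoef r i = (if i < 0 then 0 else fps_nth (zser ^ r) (nat i))"

text \<open>\<open>acoef r i\<close> and \<open>Acoef r i\<close> are the coefficients of z^i in the
  r-th power of the product of 1 / (1 - z q^k) over k >= 0 and over k >= 1; replacing z by z q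
  contributes q^i. Both are 0 for negative i, so that indices can be shifted freely over the
  integers.\<close>

definition Acoef :: "nat \<Rightarrow> int \<Rightarrow> int fps" where
  "Acoef r i = fps_X ^ nat i * acoef r i"

lemma acoef_neg [simp]: "i < 0 \<Longrightarrow> acoef r i = 0"
  by (simp add: acoef_def)

lemma Acoef_neg [simp]: "i < 0 \<Longrightarrow> Acoef r i = 0"
  by (simp add: Acoef_def)

lemma Acoef_eq_zshift: "i \<ge> 0 \<Longrightarrow> Acoef r i = fps_nth (zshift (zser ^ r)) (nat i)"
  by (simp add: Acoef_def acoef_def)

lemma vanish_Acoef: "vanish (nat \<bar>i\<bar>) (Acoef r i)"
proof (cases "i < 0")
  case False
  then show ?thesis
    unfolding Acoef_def using vanish_X_mult[of 0 "acoef r i" "nat i"] by simp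
qed simp

lemma locfin_Acoef: "locfin (Acoef r)"
  by (rule locfin_int[of 0]) (simp add: vanish_Acoef)

lemma locfin_lam: "locfin lam"
  by (rule locfin_nat[OF vanish_lam])

text \<open>The logarithmic derivative of \<open>zser\<close> with z replaced by z q: the
  coefficient 1 / (1 - q^d) of z^d turns into q^d / (1 - q^d) = \<open>lam d\<close>.\<close>

lemma Acoef_log_deriv:
  "of_int i * Acoef r i = of_nat r * fsum (\<lambda>d. lam d * Acoef r (i - int d))"
proof (cases "i < 0")
  case False
  then obtain k where k: "i = int k" by (metis nonneg_int_cases not_less)
  have "fps_XD (zser ^ r) = of_nat r * (zser ^ r * Abs_fps (\<lambda>d. if d = 0 then 0 else 1 + lam d))"
    by (subst XD_power, subst zser_XD) (cases r; simp add: mult_ac)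
  then have "zshift (fps_XD (zser ^ r)) = zshift (of_nat r * (zser ^ r * Abs_fps (\<lambda>d. if d = 0 then 0 else 1 + lam d)))"
    by simp
  moreover have zr: "zshift (of_nat r * f) = of_nat r * zshift f" for f
    by (rule fps_ext) (simp add: fps_mult_of_nat_nth mult_ac)
  moreover have "zshift (Abs_fps (\<lambda>d. if d = 0 then 0 else 1 + lam d)) = Abs_fps lam"
    by (rule fps_ext) (use lam_geometric in \<open>auto simp: algebra_simps\<close>)
  ultimately have "fps_XD (zshift (zser ^ r)) = of_nat r * (zshift (zser ^ r) * Abs_fps lam)"
    by (simp only: zr zshift_XD) (simp only: zshift_mult)
  then have "of_nat k * fps_nth (zshift (zser ^ r)) k =
      of_nat r * (\<Sum>d=0..k. lam d * fps_nth (zshift (zser ^ r)) (k - d))"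
    by (metis (no_types, lifting) ext fps_XD_nth fps_mult_nth fps_mult_of_nat_nth(1) fps_nth_Abs_fps mult.commute)
  also have "(\<Sum>d=0..k. lam d * fps_nth (zshift (zser ^ r)) (k - d)) = (\<Sum>d=0..k. lam d * Acoef r (int k - int d))"
    by (intro sum.cong refl) (simp add: Acoef_eq_zshift nat_diff_distrib' del: zshift_nth)
  also have "\<dots> = fsum (\<lambda>d. lam d * Acoef r (int k - int d))"
    by (rule fsum_finite[symmetric]) auto
  finally show ?thesis
    using k by (simp add: Acoef_eq_zshift del: zshift_nth)
next
  case True
  then have "(\<lambda>d. lam d * Acoef r (i - int d)) = (\<lambda>_. 0)" by auto
  then show ?thesis using True by simp
qed

text \<open>The product of 1 / (1 - z q^k) over k >= 1 at z = 1, which is the generating function of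
  all partitions.\<close>

definition pgf :: "int fps" where
  "pgf = fsum (Acoef 1)"

text \<open>\<open>bcoef r m\<close> is the coefficient of \<open>z\<^sup>m\<close> in \<open>\<Prod>\<^sub>k 1 / ((1 - z q\<^sup>k) (1 - q\<^sup>k / z))\<^sup>r\<close> over \<open>k \<ge> 1\<close>;
  only \<open>r = 1\<close> (crank) and \<open>r = 3\<close> (rank-crank equation) are needed.\<close>

definition bcoef :: "nat \<Rightarrow> int \<Rightarrow> int fps" where
  "bcoef r m = fsum (\<lambda>j. Acoef r (m + j) * Acoef r j)"

text \<open>The operator z d/dz applied a times to the series with coefficients
  \<open>bcoef r\<close>, then evaluated at z = 1; a pair (i, j) contributes to z^(i - j).\<close>

definition bmoment :: "nat \<Rightarrow> nat \<Rightarrow> int fps" where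
  "bmoment r a = fsum (\<lambda>(i, j). of_int ((i - j) ^ a) * (Acoef r i * Acoef r j))"

text \<open>The generating function of the divisor sums sigma_l, as a Lambert series.\<close>

definition Phi :: "nat \<Rightarrow> int fps" where
  "Phi l = fsum (\<lambda>d. of_nat (d ^ l) * lam d)"

lemma locfin_AA: "locfin (\<lambda>(i, j). of_int (c i j) * (Acoef r i * Acoef r j))"
  using locfin_cmult[OF locfin_prod[OF locfin_Acoef locfin_Acoef], of "\<lambda>(i, j). of_int (c i j)" r r]
  by (simp add: split_def)

lemma Acoef_0: "Acoef r 0 = 1"
proof -
  have "fps_nth (zser ^ r) 0 = 1"
    by (induction r) (simp_all add: zser_def)
  then show ?thesis by (simp add: Acoef_def acoef_def)
qed

lemma Acoef_power_0: "Acoef 0 i = (if i = 0 then 1 else 0)"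
  by (auto simp: Acoef_def acoef_def)

lemma Acoef_Suc: "Acoef (Suc r) k = fsum (\<lambda>i. Acoef r i * Acoef 1 (k - i))"
proof (cases "k < 0")
  case False
  then obtain n where n: "k = int n" by (metis nonneg_int_cases not_less)
  have "Acoef (Suc r) k = fps_nth (zshift (zser ^ r) * zshift (zser ^ 1)) n"
    unfolding zshift_mult[symmetric] by (simp add: n Acoef_eq_zshift mult.commute del: zshift_nth)
  also have "\<dots> = (\<Sum>i=0..n. Acoef r (int i) * Acoef 1 (k - int i))"
    unfolding fps_mult_nth
    by (intro sum.cong refl) (simp add: n Acoef_eq_zshift nat_diff_distrib' del: zshift_nth)
  also have "\<dots> = (\<Sum>i\<in>int ` {0..n}. Acoef r i * Acoef 1 (k - i))"
    by (simp add: sum.reindex)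
  also have "\<dots> = fsum (\<lambda>i. Acoef r i * Acoef 1 (k - i))"
  proof (rule fsum_finite[symmetric])
    fix i assume "i \<notin> int ` {0..n}"
    then have "i < 0 \<or> k - i < 0"
      using n by (metis atLeast0AtMost atMost_iff diff_less_0_iff_less image_iff int_ops(9) linorder_not_less nonneg_int_cases of_nat_le_iff)
    then show "Acoef r i * Acoef 1 (k - i) = 0" by auto
  qed simp
  finally show ?thesis .
next
  case True
  then have "Acoef r i * Acoef 1 (k - i) = 0" for i
    by (cases "i < 0") auto
  then have "(\<lambda>i. Acoef r i * Acoef 1 (k - i)) = (\<lambda>_. 0)"
    by (rule ext)
  then show ?thesis using True by (simp only: Acoef_neg fsum_zero)
qed

lemma fsum_Acoef: "fsum (Acoef r) = pgf ^ r"
proof (induction r)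
  case 0
  have "fsum (Acoef 0) = (\<Sum>i\<in>{0}. Acoef 0 i)"
    by (rule fsum_finite) (auto simp: Acoef_power_0)
  then show ?case by (simp add: Acoef_0)
next
  case (Suc r)
  have inj: "inj (\<lambda>(k, i). (i, k - i :: int))"
    by (auto simp: inj_def)
  have lf: "locfin (\<lambda>(k, i). Acoef r i * Acoef 1 (k - i))"
    using locfin_inj[OF locfin_prod[OF locfin_Acoef[of r] locfin_Acoef[of 1]] inj] by (simp add: split_def)
  have "fsum (Acoef (Suc r)) = fsum (\<lambda>k. fsum (\<lambda>i. Acoef r i * Acoef 1 (k - i)))"
    by (rule arg_cong[where f = fsum], rule ext, rule Acoef_Suc)
  also have "\<dots> = fsum (\<lambda>(k, i). Acoef r i * Acoef 1 (k - i))"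
    by (rule fsum_Sigma[OF lf, symmetric])
  also have "\<dots> = fsum (\<lambda>(i, j). Acoef r i * Acoef 1 j)"
  proof -
    have r: "p \<in> range (\<lambda>(k, i). (i, k - i))" for p :: "int \<times> int"
      by (rule range_eqI[of _ _ "(fst p + snd p, fst p)"]) simp
    then have "fsum (\<lambda>p. case (case p of (k, i) \<Rightarrow> (i, k - i)) of (i, j) \<Rightarrow> Acoef r i * Acoef 1 j) =
        fsum (\<lambda>(i, j). Acoef r i * Acoef 1 j)"
      using r fsum_reindex[OF inj, of "\<lambda>(i, j). Acoef r i * Acoef 1 j"] by metis
    then show ?thesis by (simp only: split_def fst_conv snd_conv)
  qed
  also have "\<dots> = fsum (Acoef r) * pgf"
    unfolding pgf_def by (rule fsum_prod[symmetric]) (rule locfin_Acoef)+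
  finally show ?case by (simp add: Suc)
qed

lemma bmoment_0: "bmoment r 0 = pgf ^ (2 * r)"
  using fsum_prod[OF locfin_Acoef locfin_Acoef, of r r]
  by (simp add: bmoment_def fsum_Acoef power_mult mult_2 power_add)

lemma bmoment_odd:
  assumes "odd a"
  shows "bmoment r a = 0"
proof -
  have "bmoment r a = fsum (\<lambda>(j, i). of_int ((i - j) ^ a) * (Acoef r i * Acoef r j))"
    unfolding bmoment_def by (rule fsum_swap_pair)
  also have "\<dots> = fsum (\<lambda>(i, j). - (of_int ((i - j) ^ a) * (Acoef r i * Acoef r j)))"
  proof (intro arg_cong[where f = fsum] ext, clarify)
    fix x y :: int
    have "(y - x) ^ a = - ((x - y) ^ a)"
      using assms by (metis minus_diff_eq power_minus_odd)
    then show "of_int ((y - x) ^ a) * (Acoef r y * Acoef r x) = - (of_int ((x - y) ^ a) * (Acoef r x * Acoef r y))"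
      by (simp only: of_int_minus mult_minus_left mult.commute[of "Acoef r y"])
  qed
  also have "\<dots> = - bmoment r a"
    using fsum_uminus[of "\<lambda>(i, j). of_int ((i - j) ^ a) * (Acoef r i * Acoef r j)"]
    by (simp add: bmoment_def split_def)
  finally show ?thesis by (simp add: fps_eq_iff)
qed

text \<open>One factor i - j is split off, and for odd a the two halves agree by exchanging i and j.
  The logarithmic derivative then replaces i \<open>Acoef r i\<close> by a sum over d, and expanding
  (d + (i - j))^a separates the divisor sums from lower moments.\<close>

lemma bmoment_Suc:
  assumes "odd a"
  shows "bmoment r (Suc a) = 2 * of_nat r * (\<Sum>l\<le>a. of_nat (a choose l) * Phi l * bmoment r (a - l))"
proof -
  define T where "T = fsum (\<lambda>(i, j). of_int ((i - j) ^ a * i) * (Acoef r i * Acoef r j))"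
  have "bmoment r (Suc a) = fsum (\<lambda>(i, j). of_int ((i - j) ^ a * i) * (Acoef r i * Acoef r j)
      + of_int (- ((i - j) ^ a * j)) * (Acoef r i * Acoef r j))"
    unfolding bmoment_def by (intro arg_cong[where f = fsum] ext) (auto simp: algebra_simps)
  also have "\<dots> = T + fsum (\<lambda>(i, j). of_int (- ((i - j) ^ a * j)) * (Acoef r i * Acoef r j))"
    unfolding T_def using fsum_add[OF locfin_AA locfin_AA, of "\<lambda>i j. (i - j) ^ a * i" r "\<lambda>i j. - ((i - j) ^ a * j)" r]
    by (simp add: split_def)
  also have "fsum (\<lambda>(i, j). of_int (- ((i - j) ^ a * j)) * (Acoef r i * Acoef r j)) = T"
    unfolding T_def
  proof (subst fsum_swap_pair, intro arg_cong[where f = fsum] ext, clarify)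
    fix x y :: int
    have "(y - x) ^ a = - ((x - y) ^ a)"
      using assms by (metis minus_diff_eq power_minus_odd)
    then show "of_int (- ((y - x) ^ a * x)) * (Acoef r y * Acoef r x) = of_int ((x - y) ^ a * x) * (Acoef r x * Acoef r y)"
      by (simp only: mult_minus_left minus_minus mult.commute[of "Acoef r y"])
  qed
  finally have 1: "bmoment r (Suc a) = 2 * T" by simp
  define F where "F = (\<lambda>(i, j). Acoef r i * Acoef r j)"
  have lF: "locfin F"
    unfolding F_def by (rule locfin_prod[OF locfin_Acoef locfin_Acoef])
  have shift_range: "p \<in> range (\<lambda>(i, j). (i + int d, j))" for p d
    by (rule range_eqI[of _ _ "(fst p - int d, snd p)"]) simp
  have inj: "inj (\<lambda>(p, d). ((fst p - int d, snd p), d))"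
    by (auto simp: inj_def)
  have "locfin (\<lambda>(p, d). F p * lam d)"
    by (rule locfin_prod[OF lF locfin_lam])
  from locfin_inj[OF this inj]
  have lf1: "locfin (\<lambda>(p, d). F (fst p - int d, snd p) * lam d)"
    by (simp add: split_def)
  have lf: "locfin (\<lambda>(p, d). of_int (c p) * (F (fst p - int d, snd p) * lam d))" for c
    using locfin_cmult[OF lf1, of "\<lambda>p. of_int (c (fst p))"] by (simp add: split_def)
  \<comment> \<open>After \<open>Acoef_log_deriv\<close> the inner series is F at (i - d, j);
    shifting i by d restores F and moves d into the power.\<close>
  have "T = fsum (\<lambda>p. of_nat r * fsum (\<lambda>d. of_int ((fst p - snd p) ^ a) * (F (fst p - int d, snd p) * lam d)))"
    unfolding T_def
  proof (intro arg_cong[where f = fsum] ext)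
    fix p :: "int \<times> int"
    have lfd: "locfin (\<lambda>d. lam d * Acoef r (fst p - int d))"
      using locfin_cmult[OF locfin_lam, of "\<lambda>d. Acoef r (fst p - int d)"] by (simp add: mult.commute)
    have "(case p of (i, j) \<Rightarrow> of_int ((i - j) ^ a * i) * (Acoef r i * Acoef r j))
        = of_int ((fst p - snd p) ^ a) * Acoef r (snd p) * (of_int (fst p) * Acoef r (fst p))"
      by (simp add: split_def mult_ac)
    also have "\<dots> = of_nat r * (of_int ((fst p - snd p) ^ a) * Acoef r (snd p) * fsum (\<lambda>d. lam d * Acoef r (fst p - int d)))"
      unfolding Acoef_log_deriv by (simp only: mult_ac)
    also have "\<dots> = of_nat r * fsum (\<lambda>d. of_int ((fst p - snd p) ^ a) * (F (fst p - int d, snd p) * lam d))"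
      unfolding fsum_cmult[OF lfd, symmetric] by (simp add: F_def mult_ac)
    finally show "(case p of (i, j) \<Rightarrow> of_int ((i - j) ^ a * i) * (Acoef r i * Acoef r j)) =
        of_nat r * fsum (\<lambda>d. of_int ((fst p - snd p) ^ a) * (F (fst p - int d, snd p) * lam d))" .
  qed
  also have "\<dots> = of_nat r * fsum (\<lambda>p. fsum (\<lambda>d. of_int ((fst p - snd p) ^ a) * (F (fst p - int d, snd p) * lam d)))"
    by (rule fsum_cmult[OF locfin_fsum[OF lf]])
  also have "\<dots> = of_nat r * fsum (\<lambda>d. fsum (\<lambda>p. of_int ((fst p - snd p) ^ a) * (F (fst p - int d, snd p) * lam d)))"
    by (subst fsum_swap[OF lf]) simp
  also have "(\<lambda>d. fsum (\<lambda>p. of_int ((fst p - snd p) ^ a) * (F (fst p - int d, snd p) * lam d))) =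
      (\<lambda>d. \<Sum>l\<le>a. of_nat (a choose l) * (of_nat (d ^ l) * lam d) * bmoment r (a - l))"
  proof (rule ext)
    fix d
    have lm: "locfin (\<lambda>p. of_int ((fst p - snd p) ^ k) * F p)" for k
      by (rule locfin_cmult[OF lF])
    have "fsum (\<lambda>p. of_int ((fst p - snd p) ^ a) * (F (fst p - int d, snd p) * lam d)) =
        fsum (\<lambda>p. of_int ((fst p + int d - snd p) ^ a) * (F p * lam d))"
      (is "fsum ?f = _")
    proof -
      have "fsum (\<lambda>p. ?f (case p of (i, j) \<Rightarrow> (i + int d, j))) = fsum ?f"
      proof (rule fsum_reindex)
        show "inj (\<lambda>(i, j). (i + int d, j))" by (auto simp: inj_def)
      qed (metis shift_range)
      then show ?thesis by (simp add: split_def)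
    qed
    also have "\<dots> = fsum (\<lambda>p. \<Sum>l\<le>a. (of_nat (a choose l) * (of_nat (d ^ l) * lam d)) * (of_int ((fst p - snd p) ^ (a - l)) * F p))"
    proof (intro arg_cong[where f = fsum] ext)
      fix p :: "int \<times> int"
      have "(fst p + int d - snd p) ^ a = (int d + (fst p - snd p)) ^ a"
        by (simp add: algebra_simps)
      then show "of_int ((fst p + int d - snd p) ^ a) * (F p * lam d) =
          (\<Sum>l\<le>a. (of_nat (a choose l) * (of_nat (d ^ l) * lam d)) * (of_int ((fst p - snd p) ^ (a - l)) * F p))"
        unfolding binomial_ring by (simp add: sum_distrib_right sum_distrib_left mult_ac)
    qed
    also have "\<dots> = (\<Sum>l\<le>a. (of_nat (a choose l) * (of_nat (d ^ l) * lam d)) * bmoment r (a - l))"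
    proof -
      have "bmoment r k = fsum (\<lambda>p. of_int ((fst p - snd p) ^ k) * F p)" for k
        by (simp add: bmoment_def F_def split_def)
      then show ?thesis
        by (subst fsum_sum) (simp_all only: finite_atMost locfin_cmult[OF lm] fsum_cmult[OF lm])
    qed
    finally show "fsum (\<lambda>p. of_int ((fst p - snd p) ^ a) * (F (fst p - int d, snd p) * lam d)) =
      (\<Sum>l\<le>a. of_nat (a choose l) * (of_nat (d ^ l) * lam d) * bmoment r (a - l))" .
  qed
  also have "fsum (\<lambda>d. \<Sum>l\<le>a. of_nat (a choose l) * (of_nat (d ^ l) * lam d) * bmoment r (a - l)) =
      (\<Sum>l\<le>a. of_nat (a choose l) * Phi l * bmoment r (a - l))"
  proof -
    have ll: "locfin (\<lambda>d. of_nat (d ^ l) * lam d)" for l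
      by (rule locfin_cmult[OF locfin_lam])
    have ll2: "locfin (\<lambda>d. of_nat (a choose l) * (of_nat (d ^ l) * lam d))" for l
      by (rule locfin_cmult[OF ll])
    have ll3: "locfin (\<lambda>d. of_nat (a choose l) * (of_nat (d ^ l) * lam d) * bmoment r (a - l))" for l
      using locfin_cmult[OF ll2, of "\<lambda>_. bmoment r (a - l)"] by (simp add: mult.commute)
    show ?thesis
      by (subst fsum_sum) (simp_all only: ll3 fsum_cmult_right[OF ll2] fsum_cmult[OF ll] Phi_def finite_atMost)
  qed
  finally show ?thesis using 1 by (simp add: mult_ac)
qed

text \<open>The terms q^i / ((1 - q) ... (1 - q^i)) with i <= k telescope to \<open>upart k\<close>;
  the remaining ones start at q^(k+1) or later.\<close>

lemma vanish_pgf_upart: "vanish (Suc k) (pgf - upart k)"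
proof -
  have u: "upart k = fsum (\<lambda>i. if i \<le> int k then Acoef 1 i else 0)" for k
  proof (induction k)
    case 0
    have "fsum (\<lambda>i. if i \<le> int 0 then Acoef 1 i else 0) = (\<Sum>i\<in>{0}. if i \<le> int 0 then Acoef 1 i else 0)"
      by (rule fsum_finite) auto
    then show ?case by (simp add: Acoef_0)
  next
    case (Suc k)
    have 1: "locfin (\<lambda>i. if i \<le> int k then Acoef 1 i else 0)"
      by (rule locfin_restrict[OF locfin_Acoef])
    have 2: "locfin (\<lambda>i. if i = int (Suc k) then Acoef 1 i else 0)"
      by (rule locfin_restrict[OF locfin_Acoef])
    have "fsum (\<lambda>i. if i \<le> int (Suc k) then Acoef 1 i else 0) =
        fsum (\<lambda>i. (if i \<le> int k then Acoef 1 i else 0) + (if i = int (Suc k) then Acoef 1 i else 0))"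
      by (intro arg_cong[where f = fsum] ext) auto
    also have "\<dots> = upart k + fsum (\<lambda>i. if i = int (Suc k) then Acoef 1 i else 0)"
      by (simp only: fsum_add[OF 1 2] Suc)
    also have "fsum (\<lambda>i. if i = int (Suc k) then Acoef 1 i else 0) =
        (\<Sum>i\<in>{int (Suc k)}. if i = int (Suc k) then Acoef 1 i else 0)"
      by (rule fsum_finite) auto
    also have "\<dots> = fps_X ^ Suc k * upart (Suc k)"
      by (simp add: Acoef_def acoef_def zser_def nat_add_distrib del: upart.simps of_nat_Suc power_Suc)
    finally show ?case
      using upart_Suc[of k] by (simp only: left_diff_distrib mult_1_left) (metis add_diff_cancel_left' diff_add_cancel)
  qed
  have "pgf - upart k = fsum (\<lambda>i. Acoef 1 i - (if i \<le> int k then Acoef 1 i else 0))"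
    unfolding pgf_def u by (rule fsum_diff[OF locfin_Acoef locfin_restrict[OF locfin_Acoef], symmetric])
  moreover have "vanish (Suc k) (Acoef 1 i - (if i \<le> int k then Acoef 1 i else 0))" for i
    using vanish_mono[OF vanish_Acoef[of i 1], of "Suc k"] by auto
  ultimately show ?thesis by (simp add: vanish_fsum)
qed

text \<open>For the finite products \<open>upart k\<close> this is the product rule; both sides
  agree with their finite versions modulo q^(k+1), for every k.\<close>

lemma XD_pgf: "fps_XD pgf = Phi 1 * pgf"
proof -
  have "fps_XD (upart k) = (\<Sum>d\<le>k. of_nat d * lam d) * upart k" for k
  proof (induction k)
    case (Suc k)
    then show ?case
      by (simp add: XD_mult XD_lam algebra_simps)
  qed simp
  moreover have "vanish (Suc k) (Phi 1 - (\<Sum>d\<le>k. of_nat d * lam d))" for k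
  proof -
    have lf: "locfin (\<lambda>d. of_nat d * lam d)"
      by (rule locfin_cmult[OF locfin_lam])
    have "(\<Sum>d\<le>k. of_nat d * lam d) = fsum (\<lambda>d. if d \<le> k then of_nat d * lam d else 0)"
      by (subst fsum_finite[of "{..k}"]) auto
    then have "Phi 1 - (\<Sum>d\<le>k. of_nat d * lam d) = fsum (\<lambda>d. of_nat d * lam d - (if d \<le> k then of_nat d * lam d else 0))"
      unfolding Phi_def by (simp add: fsum_diff[OF lf locfin_restrict[OF lf]])
    moreover have "vanish (Suc k) (of_nat d * lam d - (if d \<le> k then of_nat d * lam d else 0))" for d
      using vanish_mono[OF vanish_mult_left[OF vanish_lam[of d]], of "Suc k"] by auto
    ultimately show ?thesis by (simp add: vanish_fsum)
  qed
  note lim = this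
  have "vanish (Suc k) (fps_XD (pgf - upart k) - (Phi 1 - (\<Sum>d\<le>k. of_nat d * lam d)) * pgf
      - (\<Sum>d\<le>k. of_nat d * lam d) * (pgf - upart k))" for k
    by (rule vanish_diff, rule vanish_diff, rule vanish_XD, rule vanish_pgf_upart, rule vanish_mult_right,
      rule lim, rule vanish_mult_left, rule vanish_pgf_upart)
  moreover have "fps_XD (pgf - upart k) - (Phi 1 - (\<Sum>d\<le>k. of_nat d * lam d)) * pgf
      - (\<Sum>d\<le>k. of_nat d * lam d) * (pgf - upart k) = fps_XD pgf - Phi 1 * pgf" for k
    using \<open>\<And>k. fps_XD (upart k) = (\<Sum>d\<le>k. of_nat d * lam d) * upart k\<close>
    by (simp add: XD_diff algebra_simps)
  ultimately have "vanish (Suc k) (fps_XD pgf - Phi 1 * pgf)" for k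
    by simp
  then have "fps_XD pgf - Phi 1 * pgf = 0"
    by (intro vanish_all_imp_zero) (meson lessI less_imp_le vanish_mono)
  then show ?thesis by simp
qed

section \<open>The crank generating function\<close>

text \<open>Up to the factor 1 - q, the term at j >= 1 counts the partitions with j ones and m + j
  parts larger than j (\<open>gf_ones_set\<close>). Where j (m + j) is negative one of the factors
  \<open>Acoef\<close> is 0, so truncating the exponent does no harm.\<close>

definition wcoef :: "int \<Rightarrow> int fps" where
  "wcoef m = fsum (\<lambda>j. fps_X ^ nat (j * (m + j)) * (Acoef 1 (m + j) * Acoef 1 j))"

lemma locfin_AA_shift: "locfin (\<lambda>j. c j * (Acoef r (m + j) * Acoef s j))"
  using locfin_cmult[OF locfin_Acoef, of "\<lambda>j. c j * Acoef r (m + j)" s] by (simp add: mult_ac)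

lemma locfin_AA1: "locfin (\<lambda>j. Acoef r (m + j) * Acoef s j)"
  using locfin_AA_shift[of "\<lambda>_. 1"] by simp

text \<open>For i >= 0 the coefficient is q^i / ((1 - q) ... (1 - q^i)). For i <= 0 both sides are
  0, so the recurrences below have no boundary terms.\<close>

lemma Acoef_1_rec: "(1 - fps_X ^ nat i) * Acoef 1 i = fps_X * Acoef 1 (i - 1)"
proof (cases "i \<le> 0")
  case False
  define k where "k = nat (i - 1)"
  have i: "i = int (Suc k)" using False by (simp add: k_def)
  have "(1 - fps_X ^ Suc k) * (fps_X ^ Suc k * upart (Suc k)) = fps_X ^ Suc k * upart k"
    using upart_Suc[of k] by (metis mult.left_commute)
  then show ?thesis
    using False by (simp add: i Acoef_def acoef_def zser_def mult_ac nat_add_distrib del: upart.simps)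
qed auto

lemma bcoef_uminus: "bcoef r (- m) = bcoef r m"
  unfolding bcoef_def
  by (subst fsum_shift[of _ m, symmetric]) (simp add: add_ac mult_ac)

lemma wcoef_uminus: "wcoef (- m) = wcoef m"
  unfolding wcoef_def
  by (subst fsum_shift[of _ m, symmetric]) (simp add: add_ac mult_ac)

text \<open>Shift j by one in the sum for m + 2. By q A_(i-1) = (1 - q^i) A_i both sums then run
  over A_(m+1+j) A_j, with factors 1 - q^(m+1+j) and q^(m+1) (1 - q^j); their difference 1 - q^(m+1)
  is free of j.\<close>

lemma bcoef_rec:
  "fps_X * bcoef 1 (int m) = (1 - fps_X ^ Suc m) * bcoef 1 (int m + 1) + fps_X ^ (m + 2) * bcoef 1 (int m + 2)"
proof -
  let ?A = "Acoef 1"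
  let ?M = "int m + 1"
  have "fps_X * bcoef 1 (int m) - fps_X ^ (m + 2) * bcoef 1 (int m + 2)
      = fsum (\<lambda>j. fps_X * (?A (int m + j) * ?A j)) - fsum (\<lambda>j. fps_X ^ (m + 2) * (?A (int m + 2 + j) * ?A j))"
    unfolding bcoef_def by (simp only: fsum_cmult[OF locfin_AA1])
  also have "fsum (\<lambda>j. fps_X ^ (m + 2) * (?A (int m + 2 + j) * ?A j)) =
      fsum (\<lambda>j. fps_X ^ (m + 2) * (?A (int m + 2 + (j + - 1)) * ?A (j + - 1)))"
    by (rule fsum_shift[symmetric])
  also have "fsum (\<lambda>j. fps_X * (?A (int m + j) * ?A j)) - \<dots> =
      fsum (\<lambda>j. fps_X * (?A (int m + j) * ?A j) - fps_X ^ (m + 2) * (?A (int m + 2 + (j + - 1)) * ?A (j + - 1)))"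
  proof (rule fsum_diff[symmetric])
    show "locfin (\<lambda>j. fps_X * (?A (int m + j) * ?A j))" by (rule locfin_AA_shift)
    show "locfin (\<lambda>j. fps_X ^ (m + 2) * (?A (int m + 2 + (j + - 1)) * ?A (j + - 1)))"
      by (rule locfin_inj[OF locfin_AA_shift[of "\<lambda>_. fps_X ^ (m + 2)" 1 "int m + 2" 1], of "\<lambda>j. j + - 1"]) (simp add: inj_def)
  qed
  also have "\<dots> = fsum (\<lambda>j. (1 - fps_X ^ Suc m) * (?A (?M + j) * ?A j))"
  proof (rule arg_cong[where f = fsum], rule ext)
    fix j :: int
    have 1: "fps_X * ?A (int m + j) = (1 - fps_X ^ nat (?M + j)) * ?A (?M + j)"
      by (subst Acoef_1_rec) (simp add: algebra_simps)
    have 2: "fps_X * ?A (j - 1) = (1 - fps_X ^ nat j) * ?A j"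
      by (subst Acoef_1_rec) simp
    have "fps_X * (?A (int m + j) * ?A j) - fps_X ^ (m + 2) * (?A (int m + 2 + (j + - 1)) * ?A (j + - 1))
        = (fps_X * ?A (int m + j)) * ?A j - fps_X ^ Suc m * ?A (?M + j) * (fps_X * ?A (j - 1))"
      by (simp add: algebra_simps)
    also have "\<dots> = ((1 - fps_X ^ nat (?M + j)) - fps_X ^ Suc m * (1 - fps_X ^ nat j)) * (?A (?M + j) * ?A j)"
      unfolding 1 2 by (simp add: algebra_simps)
    also have "\<dots> = (1 - fps_X ^ Suc m) * (?A (?M + j) * ?A j)"
    proof (cases "j < 0")
      case False
      then have "nat (?M + j) = Suc m + nat j" by simp
      then show ?thesis by (simp add: algebra_simps power_add)
    qed simp
    finally show "fps_X * (?A (int m + j) * ?A j) - fps_X ^ (m + 2) * (?A (int m + 2 + (j + - 1)) * ?A (j + - 1))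
        = (1 - fps_X ^ Suc m) * (?A (?M + j) * ?A j)" .
  qed
  also have "\<dots> = (1 - fps_X ^ Suc m) * bcoef 1 ?M"
    unfolding bcoef_def by (rule fsum_cmult[OF locfin_AA1])
  finally show ?thesis by (simp add: algebra_simps)
qed

text \<open>The same shift, now with weights. As (j - 1)(m + 1 + j) + m + 1 = j (m + j), both terms
  carry the same power of q, and q^(j(m+j)) (q^j - q^(m+1+j)) is 1 - q^(m+1) times the weight
  q^(j(m+1+j)) of the middle sum.\<close>

lemma wcoef_rec:
  "fps_X * wcoef (int m) = (1 - fps_X ^ Suc m) * wcoef (int m + 1) + fps_X ^ (m + 2) * wcoef (int m + 2)"
proof -
  let ?A = "Acoef 1"
  let ?M = "int m + 1"
  let ?f = "\<lambda>j. fps_X * (fps_X ^ nat (j * (int m + j)) * (?A (int m + j) * ?A j))"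
  let ?g = "\<lambda>j. fps_X ^ (m + 2) * (fps_X ^ nat (j * (int m + 2 + j)) * (?A (int m + 2 + j) * ?A j))"
  have lg: "locfin ?g"
    by (rule locfin_cmult[OF locfin_AA_shift])
  have "fps_X * wcoef (int m) - fps_X ^ (m + 2) * wcoef (int m + 2) = fsum ?f - fsum ?g"
    unfolding wcoef_def by (simp only: fsum_cmult[OF locfin_AA_shift])
  also have "fsum ?g = fsum (\<lambda>j. ?g (j + - 1))"
    by (rule fsum_shift[symmetric])
  also have "fsum ?f - \<dots> = fsum (\<lambda>j. ?f j - ?g (j + - 1))"
  proof (rule fsum_diff[symmetric])
    show "locfin ?f" by (rule locfin_cmult[OF locfin_AA_shift])
    show "locfin (\<lambda>j. ?g (j + - 1))"
      by (rule locfin_inj[OF lg, of "\<lambda>j. j + - 1"]) (simp add: inj_def)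
  qed
  also have "\<dots> = fsum (\<lambda>j. (1 - fps_X ^ Suc m) * (fps_X ^ nat (j * (?M + j)) * (?A (?M + j) * ?A j)))"
  proof (rule arg_cong[where f = fsum], rule ext)
    fix j :: int
    have 1: "fps_X * ?A (int m + j) = (1 - fps_X ^ nat (?M + j)) * ?A (?M + j)"
      by (subst Acoef_1_rec) (simp add: algebra_simps)
    have 2: "fps_X * ?A (j - 1) = (1 - fps_X ^ nat j) * ?A j"
      by (subst Acoef_1_rec) simp
    let ?e = "nat (j * (int m + j))"
    have "?f j - ?g (j + - 1)
        = fps_X ^ ?e * (fps_X * ?A (int m + j)) * ?A j
          - fps_X ^ (Suc m + nat ((j - 1) * (?M + j))) * ?A (?M + j) * (fps_X * ?A (j - 1))"
      by (simp add: algebra_simps power_add)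
    also have "\<dots> = (fps_X ^ ?e * (1 - fps_X ^ nat (?M + j)) - fps_X ^ (Suc m + nat ((j - 1) * (?M + j))) * (1 - fps_X ^ nat j)) * (?A (?M + j) * ?A j)"
      unfolding 1 2 by (simp add: algebra_simps)
    also have "\<dots> = (1 - fps_X ^ Suc m) * (fps_X ^ nat (j * (?M + j)) * (?A (?M + j) * ?A j))"
    proof (cases "j < 0")
      case False
      then obtain k where k: "j = int k" by (metis nonneg_int_cases not_less)
      have e: "?e = k * (m + k)" "nat (j * (?M + j)) = k * (m + k) + k" "nat (?M + j) = Suc m + k"
        unfolding k by (simp_all add: nat_mult_distrib nat_add_distrib algebra_simps flip: of_nat_add of_nat_mult)
      \<comment> \<open>At j = 0 the exponent (j - 1)(m + 1 + j) is negative and gets truncated, but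
        there the factor 1 - q^j is 0.\<close>
      have k1: "fps_X ^ (Suc m + nat ((j - 1) * (?M + j))) * (1 - fps_X ^ nat j) = (fps_X ^ ?e * (1 - fps_X ^ nat j) :: int fps)"
      proof (cases k)
        case (Suc l)
        have "nat ((j - 1) * (?M + j)) = l * (Suc m + k)"
          unfolding k Suc by (simp add: nat_mult_distrib nat_add_distrib algebra_simps flip: of_nat_add of_nat_mult)
        then have "Suc m + nat ((j - 1) * (?M + j)) = ?e"
          unfolding e by (simp add: Suc algebra_simps)
        then show ?thesis by simp
      qed (simp add: k)
      show ?thesis
        unfolding k1 e by (simp add: k algebra_simps power_add)
    qed simp
    finally show "?f j - ?g (j + - 1) = (1 - fps_X ^ Suc m) * (fps_X ^ nat (j * (?M + j)) * (?A (?M + j) * ?A j))" .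
  qed
  also have "\<dots> = (1 - fps_X ^ Suc m) * wcoef ?M"
    unfolding wcoef_def by (rule fsum_cmult[OF locfin_AA_shift])
  finally show ?thesis by (simp add: algebra_simps)
qed

text \<open>The product over k >= 1 at z = q: every factor moves up one place, which loses 1 / (1 -
  q).\<close>

lemma fsum_X_Acoef: "fsum (\<lambda>j. fps_X ^ nat j * Acoef 1 j) = (1 - fps_X) * pgf"
proof -
  have lf: "locfin (\<lambda>j. fps_X * Acoef 1 (j - 1))"
    using locfin_inj[OF locfin_cmult[OF locfin_Acoef[of 1], of "\<lambda>_. fps_X"], of "\<lambda>j. j - 1"] by (simp add: inj_def)
  have "fsum (\<lambda>j. fps_X ^ nat j * Acoef 1 j) = fsum (\<lambda>j. Acoef 1 j - fps_X * Acoef 1 (j - 1))"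
    unfolding Acoef_1_rec[symmetric] by (simp add: algebra_simps)
  also have "\<dots> = pgf - fsum (\<lambda>j. fps_X * Acoef 1 (j + - 1))"
    by (simp only: fsum_diff[OF locfin_Acoef lf] pgf_def add_uminus_conv_diff)
  also have "fsum (\<lambda>j. fps_X * Acoef 1 (j + - 1)) = fps_X * pgf"
    unfolding pgf_def by (subst fsum_shift) (rule fsum_cmult[OF locfin_Acoef])
  finally show ?thesis by (simp add: algebra_simps)
qed

lemma Acoef_1_limit:
  assumes "i \<ge> 0"
  shows "vanish (2 * nat i + 1) (fps_X ^ nat i * pgf - Acoef 1 i)"
proof -
  have "fps_X ^ nat i * pgf - Acoef 1 i = fps_X ^ nat i * (pgf - upart (nat i))"
    using assms by (simp add: Acoef_def acoef_def zser_def algebra_simps)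
  then show ?thesis
    using vanish_X_mult[OF vanish_pgf_upart, of "nat i" "nat i"] by (simp add: mult_2)
qed

text \<open>Up to order 2 m + 1 the coefficient A_(m+j) may be replaced by q^(m+j)
  \<open>pgf\<close>; the sum over j is then \<open>fsum_X_Acoef\<close>.\<close>

lemma bcoef_limit: "vanish (2 * m + 1) (fps_X ^ m * (1 - fps_X) * pgf\<^sup>2 - bcoef 1 (int m))"
proof -
  have lf: "locfin (\<lambda>j. fps_X ^ nat j * Acoef 1 j)"
    by (rule locfin_cmult[OF locfin_Acoef])
  have "fps_X ^ m * (1 - fps_X) * pgf\<^sup>2 = fps_X ^ m * pgf * fsum (\<lambda>j. fps_X ^ nat j * Acoef 1 j)"
    unfolding fsum_X_Acoef by (simp add: power2_eq_square mult_ac)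
  also have "\<dots> = fsum (\<lambda>j. fps_X ^ m * pgf * (fps_X ^ nat j * Acoef 1 j))"
    by (rule fsum_cmult[OF lf, symmetric])
  finally have "fps_X ^ m * (1 - fps_X) * pgf\<^sup>2 - bcoef 1 (int m) =
      fsum (\<lambda>j. fps_X ^ m * pgf * (fps_X ^ nat j * Acoef 1 j) - Acoef 1 (int m + j) * Acoef 1 j)"
    unfolding bcoef_def by (simp only: fsum_diff[OF locfin_cmult[OF lf] locfin_AA1])
  moreover have "vanish (2 * m + 1) (fps_X ^ m * pgf * (fps_X ^ nat j * Acoef 1 j) - Acoef 1 (int m + j) * Acoef 1 j)" for j
  proof (cases "j < 0")
    case False
    then have "nat (int m + j) = m + nat j" by (simp add: nat_add_distrib)
    then have "fps_X ^ m * pgf * (fps_X ^ nat j * Acoef 1 j) - Acoef 1 (int m + j) * Acoef 1 j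
        = (fps_X ^ nat (int m + j) * pgf - Acoef 1 (int m + j)) * Acoef 1 j"
      by (simp add: power_add algebra_simps)
    moreover have "vanish (2 * m + 1) (fps_X ^ nat (int m + j) * pgf - Acoef 1 (int m + j))"
      by (rule vanish_mono[OF Acoef_1_limit]) (use False in auto)
    ultimately show ?thesis by (simp add: vanish_mult_right)
  qed simp
  ultimately show ?thesis by (simp add: vanish_fsum)
qed

text \<open>Only j = 0 survives: for j >= 1 the term has order at least j (m + j) + (m + j) + j,
  which exceeds 2 m + 1.\<close>

lemma wcoef_limit: "vanish (2 * m + 1) (fps_X ^ m * pgf - wcoef (int m))"
proof -
  let ?f = "\<lambda>j. fps_X ^ nat (j * (int m + j)) * (Acoef 1 (int m + j) * Acoef 1 j)"
  let ?g = "\<lambda>j::int. if j = 0 then Acoef 1 (int m) else 0"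
  have "fsum ?g = (\<Sum>j\<in>{0::int}. ?g j)"
    by (rule fsum_finite) auto
  then have g: "fsum ?g = Acoef 1 (int m)" by simp
  have lg: "locfin ?g"
    by (rule locfinI, rule finite_subset[of _ "{0}"]) auto
  have "wcoef (int m) - Acoef 1 (int m) = fsum (\<lambda>j. ?f j - ?g j)"
    by (simp only: fsum_diff[OF locfin_AA_shift lg] g wcoef_def)
  moreover have "vanish (2 * m + 1) (?f j - ?g j)" for j
  proof (cases "j \<le> 0")
    case True
    then show ?thesis by (cases "j = 0") (simp_all add: Acoef_0)
  next
    case False
    then have "vanish (nat (j * (int m + j)) + (nat \<bar>int m + j\<bar> + nat \<bar>j\<bar>)) (?f j)"
      by (intro vanish_X_mult vanish_mult vanish_Acoef)
    moreover have "2 * m + 1 \<le> nat (j * (int m + j)) + (nat \<bar>int m + j\<bar> + nat \<bar>j\<bar>)"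
    proof -
      define t where "t = j * (int m + j)"
      have "1 * (int m + j) \<le> t"
        unfolding t_def using False by (intro mult_right_mono) auto
      moreover from this have e: "int (nat t + (nat \<bar>int m + j\<bar> + nat \<bar>j\<bar>)) = t + (int m + j) + j"
        using False by simp
      ultimately show ?thesis
        unfolding t_def[symmetric] using False
        by (subst of_nat_le_iff[where 'a = int, symmetric], subst e) (simp add: algebra_simps)
    qed
    ultimately show ?thesis using False by (auto intro: vanish_mono)
  qed
  ultimately have "vanish (2 * m + 1) (wcoef (int m) - Acoef 1 (int m))"
    by (simp add: vanish_fsum)
  moreover have "vanish (2 * m + 1) (fps_X ^ m * pgf - Acoef 1 (int m))"
    using Acoef_1_limit[of "int m"] by simp
  ultimately show ?thesis
    using vanish_diff by fastforce
qed

text \<open>Both sides satisfy the same second-order recurrence in \<open>m\<close>, whose solutions are determined by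
  their \<open>q\<close>-adic behaviour as \<open>m\<close> tends to infinity.\<close>

lemma bcoef_eq_wcoef_nat: "bcoef 1 (int m) = (1 - fps_X) * pgf * wcoef (int m)"
proof -
  define x where "x m = bcoef 1 (int m) - (1 - fps_X) * pgf * wcoef (int m)" for m
  have rec: "fps_X * x m = (1 - fps_X ^ Suc m) * x (m + 1) + fps_X ^ (m + 2) * x (m + 2)" for m
  proof -
    have "fps_X * x m = fps_X * bcoef 1 (int m) - (1 - fps_X) * pgf * (fps_X * wcoef (int m))"
      by (simp add: x_def algebra_simps)
    then show ?thesis
      unfolding bcoef_rec wcoef_rec by (simp add: x_def algebra_simps)
  qed
  have lim: "vanish (2 * m + 1) (x m)" for m
  proof -
    have "x m = (1 - fps_X) * pgf * (fps_X ^ m * pgf - wcoef (int m)) - (fps_X ^ m * (1 - fps_X) * pgf\<^sup>2 - bcoef 1 (int m))"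
      by (simp add: x_def algebra_simps power2_eq_square)
    then show ?thesis
      using vanish_diff[OF vanish_mult_left[OF wcoef_limit[of m]] bcoef_limit[of m]] by simp
  qed
  \<comment> \<open>Downward induction, where d bounds how far m lies below K. For m >= K the limit
    gives order 2 m + 1 >= m + K. Each step down cancels a factor q in q x_m; the loss is paid for
    by measuring the order as m + K, which is one larger at m + 1.\<close>
  have "\<forall>m. K \<le> m + d \<longrightarrow> vanish (m + K) (x m)" for K d
  proof (induction d)
    case 0
    show ?case
    proof safe
      fix m assume "K \<le> m + 0"
      then show "vanish (m + K) (x m)"
        by (intro vanish_mono[OF lim[of m]]) simp
    qed
  next
    case (Suc d)
    show ?case
    proof safe
      fix m assume m: "K \<le> m + Suc d"
      have 1: "vanish (m + 1 + K) (x (m + 1))"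
        using Suc[rule_format, of "m + 1"] m by simp
      have "vanish (m + 2 + K) (x (m + 2))"
        using Suc[rule_format, of "m + 2"] m by simp
      then have 2: "vanish (m + 1 + K) (x (m + 2))"
        by (rule vanish_mono) simp
      have "vanish (m + 1 + K) (fps_X * x m)"
        unfolding rec by (intro vanish_add vanish_mult_left 1 2)
      then show "vanish (m + K) (x m)"
        using vanish_X_mult_cancel[of 1 "m + K" "x m"] by simp
    qed
  qed
  then have "vanish K (x m)" for K
    using vanish_mono[of "m + K" "x m" K] by (metis le_add1 le_add2)
  then have "x m = 0"
    by (rule vanish_all_imp_zero)
  then show ?thesis by (simp add: x_def)
qed

lemma bcoef_eq_wcoef: "bcoef 1 m = (1 - fps_X) * pgf * wcoef m"
proof (cases "m \<ge> 0")
  case True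
  then show ?thesis using bcoef_eq_wcoef_nat[of "nat m"] by simp
next
  case False
  then show ?thesis
    using bcoef_eq_wcoef_nat[of "nat (- m)"] by (simp add: bcoef_uminus wcoef_uminus)
qed

lemma fsum_bcoef: "fsum (\<lambda>m. of_int (m ^ a) * bcoef r m) = bmoment r a"
  and locfin_bcoef: "locfin (\<lambda>m. of_int (m ^ a) * bcoef r m)"
proof -
  have inj: "inj (\<lambda>(m, j). (m + j, j :: int))"
    by (auto simp: inj_def)
  let ?F = "\<lambda>(i, j). of_int ((i - j) ^ a) * (Acoef r i * Acoef r j)"
  have lf: "locfin (\<lambda>(m, j). of_int (m ^ a) * (Acoef r (m + j) * Acoef r j))"
    using locfin_inj[OF locfin_AA[of "\<lambda>i j. (i - j) ^ a" r] inj] by (simp add: split_def)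
  have e: "of_int (m ^ a) * bcoef r m = fsum (\<lambda>j. of_int (m ^ a) * (Acoef r (m + j) * Acoef r j))" for m
    unfolding bcoef_def by (rule fsum_cmult[OF locfin_AA1, symmetric])
  show "locfin (\<lambda>m. of_int (m ^ a) * bcoef r m)"
    unfolding e by (rule locfin_fsum[OF lf])
  have "fsum (\<lambda>m. of_int (m ^ a) * bcoef r m) = fsum (\<lambda>(m, j). of_int (m ^ a) * (Acoef r (m + j) * Acoef r j))"
    unfolding e by (rule fsum_Sigma[OF lf, symmetric])
  also have "\<dots> = fsum (\<lambda>p. ?F (case p of (m, j) \<Rightarrow> (m + j, j)))"
    by (simp add: split_def)
  also have "\<dots> = fsum ?F"
  proof (rule fsum_reindex[OF inj])
    fix p :: "int \<times> int" assume "p \<notin> range (\<lambda>(m, j). (m + j, j))"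
    moreover have "p = (case (fst p - snd p, snd p) of (m, j) \<Rightarrow> (m + j, j))" by simp
    ultimately show "?F p = 0" by blast
  qed
  finally show "fsum (\<lambda>m. of_int (m ^ a) * bcoef r m) = bmoment r a"
    by (simp add: bmoment_def)
qed

section \<open>Generating functions of sets of partitions\<close>

definition gf :: "nat multiset set \<Rightarrow> int fps" where
  "gf S = Abs_fps (\<lambda>n. int (card {p \<in> S. \<Sum>\<^sub># p = n}))"

definition positive_parts :: "nat multiset set" where
  "positive_parts = {p. 0 \<notin># p}"

lemma partitions_of_eq: "partitions_of n = {p \<in> positive_parts. \<Sum>\<^sub># p = n}"
  by (simp add: partitions_of_def positive_parts_def)

lemma finite_fibre: "S \<subseteq> positive_parts \<Longrightarrow> finite {p \<in> S. \<Sum>\<^sub># p = n}"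
  by (rule finite_subset[OF _ finite_partitions_of[of n]]) (auto simp: partitions_of_eq)

lemma gf_empty [simp]: "gf {} = 0"
  by (rule fps_ext) (simp add: gf_def)

lemma gf_singleton: "gf {p} = fps_X ^ (\<Sum>\<^sub># p)"
  by (rule fps_ext) (auto simp: gf_def Collect_conv_if)

lemma gf_Un:
  assumes "S \<subseteq> positive_parts" "T \<subseteq> positive_parts" "S \<inter> T = {}"
  shows "gf (S \<union> T) = gf S + gf T"
proof (rule fps_ext)
  fix n
  have "{p \<in> S \<union> T. \<Sum>\<^sub># p = n} = {p \<in> S. \<Sum>\<^sub># p = n} \<union> {p \<in> T. \<Sum>\<^sub># p = n}"
    by auto
  moreover have "card ({p \<in> S. \<Sum>\<^sub># p = n} \<union> {p \<in> T. \<Sum>\<^sub># p = n}) =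
      card {p \<in> S. \<Sum>\<^sub># p = n} + card {p \<in> T. \<Sum>\<^sub># p = n}"
    by (rule card_Un_disjoint) (use assms finite_fibre in auto)
  ultimately show "fps_nth (gf (S \<union> T)) n = fps_nth (gf S + gf T) n"
    by (simp add: gf_def)
qed

lemma gf_UN:
  assumes sub: "\<And>j. S j \<subseteq> positive_parts" and disj: "\<And>i j. i \<noteq> j \<Longrightarrow> S i \<inter> S j = {}"
  shows "locfin (\<lambda>j. gf (S j))" "gf (\<Union>j. S j) = fsum (\<lambda>j. gf (S j))"
proof -
  have fin: "finite {p \<in> (\<Union>j. S j). \<Sum>\<^sub># p = n}" for n
    by (rule finite_fibre) (use sub in auto)
  \<comment> \<open>J n collects the indices of the sets met by partitions of n. Disjointness makes
    the index unique, so J n is finite although the index type is arbitrary.\<close>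
  define J where "J n = (\<lambda>p. THE j. p \<in> S j) ` {p \<in> (\<Union>j. S j). \<Sum>\<^sub># p = n}" for n
  have the: "(THE j. p \<in> S j) = j" if "p \<in> S j" for p j
    using that disj by (intro the_equality) auto
  have J: "{p \<in> S j. \<Sum>\<^sub># p = n} = {}" if "j \<notin> J n" for j n
  proof (rule ccontr)
    assume "{p \<in> S j. \<Sum>\<^sub># p = n} \<noteq> {}"
    then obtain p where "p \<in> S j" "\<Sum>\<^sub># p = n" by auto
    then have "j \<in> J n"
      unfolding J_def using the by (intro image_eqI[of _ _ p]) auto
    then show False using that by simp
  qed
  have finJ: "finite (J n)" for n
    unfolding J_def using fin by simp
  show "locfin (\<lambda>j. gf (S j))"
  proof (rule locfinI)
    fix n
    have "{j. fps_nth (gf (S j)) n \<noteq> 0} \<subseteq> J n"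
    proof
      fix j assume "j \<in> {j. fps_nth (gf (S j)) n \<noteq> 0}"
      then have "{p \<in> S j. \<Sum>\<^sub># p = n} \<noteq> {}"
        by (intro notI) (simp add: gf_def)
      then show "j \<in> J n" using J by blast
    qed
    then show "finite {j. fps_nth (gf (S j)) n \<noteq> 0}"
      using finJ finite_subset by blast
  qed
  show "gf (\<Union>j. S j) = fsum (\<lambda>j. gf (S j))"
  proof (rule fps_ext)
    fix n
    have "{p \<in> (\<Union>j. S j). \<Sum>\<^sub># p = n} = (\<Union>j\<in>J n. {p \<in> S j. \<Sum>\<^sub># p = n})"
      using J[of _ n] by blast
    moreover have "card (\<Union>j\<in>J n. {p \<in> S j. \<Sum>\<^sub># p = n}) = (\<Sum>j\<in>J n. card {p \<in> S j. \<Sum>\<^sub># p = n})"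
    proof (rule card_UN_disjoint)
      show "\<forall>j\<in>J n. finite {p \<in> S j. \<Sum>\<^sub># p = n}"
        using finite_fibre[OF sub] by blast
      show "\<forall>i\<in>J n. \<forall>j\<in>J n. i \<noteq> j \<longrightarrow> {p \<in> S i. \<Sum>\<^sub># p = n} \<inter> {p \<in> S j. \<Sum>\<^sub># p = n} = {}"
        using disj by blast
    qed (rule finJ)
    moreover have "fps_nth (fsum (\<lambda>j. gf (S j))) n = (\<Sum>j\<in>J n. fps_nth (gf (S j)) n)"
      by (rule fsum_nth[OF finJ]) (simp add: gf_def J)
    ultimately show "fps_nth (gf (\<Union>j. S j)) n = fps_nth (fsum (\<lambda>j. gf (S j))) n"
      by (simp add: gf_def)
  qed
qed

text \<open>The change of size is split into two nonnegative shifts c and d, so that maps which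
  lower the size are covered without dividing by powers of q.\<close>

lemma gf_image:
  assumes inj: "inj_on f S" and sum: "\<And>p. p \<in> S \<Longrightarrow> \<Sum>\<^sub># (f p) + c = \<Sum>\<^sub># p + d"
  shows "fps_X ^ c * gf (f ` S) = fps_X ^ d * gf S"
proof (rule fps_ext)
  fix n
  have "card {q \<in> f ` S. \<Sum>\<^sub># q + c = n} = card {p \<in> S. \<Sum>\<^sub># p + d = n}"
  proof -
    have "{q \<in> f ` S. \<Sum>\<^sub># q + c = n} = f ` {p \<in> S. \<Sum>\<^sub># p + d = n}"
      using sum by auto
    then show ?thesis
      using card_image[OF inj_on_subset[OF inj, of "{p \<in> S. \<Sum>\<^sub># p + d = n}"]] by auto
  qed
  moreover have "fps_nth (fps_X ^ e * gf T) n = int (card {p \<in> T. \<Sum>\<^sub># p + e = n})" for e T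
  proof (cases "n < e")
    case True
    then have "{p \<in> T. \<Sum>\<^sub># p + e = n} = {}" by auto
    then show ?thesis using True by (simp add: fps_X_power_mult_nth)
  next
    case False
    then have "{p \<in> T. \<Sum>\<^sub># p + e = n} = {p \<in> T. \<Sum>\<^sub># p = n - e}" by auto
    then show ?thesis using False by (simp add: fps_X_power_mult_nth gf_def)
  qed
  ultimately show "fps_nth (fps_X ^ c * gf (f ` S)) n = fps_nth (fps_X ^ d * gf S) n"
    by simp
qed

lemma gf_image_0:
  assumes "inj_on f S" "\<And>p. p \<in> S \<Longrightarrow> \<Sum>\<^sub># (f p) = \<Sum>\<^sub># p + d"
  shows "gf (f ` S) = fps_X ^ d * gf S"
  using gf_image[OF assms(1), of 0 d] assms(2) by simp

lemma gf_prod: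
  assumes inj: "inj_on (\<lambda>(p, q). p + q) (S \<times> T)"
    and sub: "S \<subseteq> positive_parts" "T \<subseteq> positive_parts"
  shows "gf ((\<lambda>(p, q). p + q) ` (S \<times> T)) = gf S * gf T"
proof (rule fps_ext)
  fix n
  let ?W = "\<Union>i\<in>{0..n}. {p \<in> S. \<Sum>\<^sub># p = i} \<times> {q \<in> T. \<Sum>\<^sub># q = n - i}"
  have "{r \<in> (\<lambda>(p, q). p + q) ` (S \<times> T). \<Sum>\<^sub># r = n} = (\<lambda>(p, q). p + q) ` ?W"
    by (auto simp: image_iff)
  moreover have "inj_on (\<lambda>(p, q). p + q) ?W"
    by (rule inj_on_subset[OF inj]) auto
  ultimately have "card {r \<in> (\<lambda>(p, q). p + q) ` (S \<times> T). \<Sum>\<^sub># r = n} = card ?W"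
    by (simp add: card_image)
  also have "\<dots> = (\<Sum>i=0..n. card ({p \<in> S. \<Sum>\<^sub># p = i} \<times> {q \<in> T. \<Sum>\<^sub># q = n - i}))"
    by (rule card_UN_disjoint) (use finite_fibre[OF sub(1)] finite_fibre[OF sub(2)] in auto)
  finally show "fps_nth (gf ((\<lambda>(p, q). p + q) ` (S \<times> T))) n = fps_nth (gf S * gf T) n"
    by (simp add: gf_def fps_mult_nth card_cartesian_product)
qed

lemma gf_parts_in:
  assumes "finite A" "0 \<notin> A"
  shows "gf {p. set_mset p \<subseteq> A} = (\<Prod>k\<in>A. 1 + lam k)"
  using assms
proof (induction rule: finite_induct)
  case empty
  have "{p. set_mset p \<subseteq> {}} = {{#} :: nat multiset}" by auto
  then show ?case by (simp add: gf_singleton)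
next
  case (insert k A)
  let ?S = "\<lambda>A. {p :: nat multiset. set_mset p \<subseteq> A}"
  have k: "k > 0" using insert by (metis insertCI not_gr_zero)
  have E: "?S (insert k A) = ?S A \<union> add_mset k ` ?S (insert k A)"
  proof (intro equalityI subsetI)
    fix p assume p: "p \<in> ?S (insert k A)"
    show "p \<in> ?S A \<union> add_mset k ` ?S (insert k A)"
    proof (cases "k \<in># p")
      case True
      then have "p = add_mset k (p - {#k#})" by simp
      moreover have "p - {#k#} \<in> ?S (insert k A)"
        using p by (auto dest: in_diffD)
      ultimately show ?thesis by blast
    next
      case False
      then show ?thesis using p by auto
    qed
  qed auto
  have "gf (?S A \<union> add_mset k ` ?S (insert k A)) = gf (?S A) + gf (add_mset k ` ?S (insert k A))"
  proof (rule gf_Un)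
    show "?S A \<inter> add_mset k ` ?S (insert k A) = {}"
      using insert.hyps(2) by auto
  qed (use insert.prems in \<open>auto simp: positive_parts_def\<close>)
  then have "gf (?S (insert k A)) = gf (?S A) + gf (add_mset k ` ?S (insert k A))"
    by (rule trans[OF arg_cong[where f = gf, OF E]])
  also have "gf (add_mset k ` ?S (insert k A)) = fps_X ^ k * gf (?S (insert k A))"
    by (rule gf_image_0) (auto simp: inj_on_def)
  finally have "(1 - fps_X ^ k) * gf (?S (insert k A)) = gf (?S A)"
    by (simp add: algebra_simps)
  then have "(1 + lam k) * ((1 - fps_X ^ k) * gf (?S (insert k A))) = (1 + lam k) * gf (?S A)"
    by simp
  also have "(1 + lam k) * ((1 - fps_X ^ k) * gf (?S (insert k A))) = gf (?S (insert k A))"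
  proof -
    have "(1 + lam k) * ((1 - fps_X ^ k) * g) = ((1 - fps_X ^ k) * (1 + lam k)) * g" for g
      by (simp only: mult_ac)
    then show ?thesis by (simp only: lam_inverse[OF k] mult_1)
  qed
  finally show ?case
    using insert by simp
qed

definition big_parts :: "nat \<Rightarrow> nat \<Rightarrow> nat multiset set" where
  "big_parts j i = {p. (\<forall>x\<in>#p. j < x) \<and> size p = i}"

lemma gf_big_parts_shift: "gf (big_parts j i) = fps_X ^ (i * j) * gf (big_parts 0 i)"
proof -
  have "big_parts j i = image_mset (\<lambda>x. x + j) ` big_parts 0 i"
  proof (intro equalityI subsetI)
    fix p assume p: "p \<in> big_parts j i"
    have "p = image_mset (\<lambda>x. x + j) (image_mset (\<lambda>x. x - j) p)"
    proof -
      have "image_mset (\<lambda>x. x - j + j) p = image_mset (\<lambda>x. x) p"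
        using p by (intro image_mset_cong) (auto simp: big_parts_def less_imp_le)
      then show ?thesis by (simp add: multiset.map_comp comp_def)
    qed
    moreover have "image_mset (\<lambda>x. x - j) p \<in> big_parts 0 i"
      using p by (auto simp: big_parts_def)
    ultimately show "p \<in> image_mset (\<lambda>x. x + j) ` big_parts 0 i" by blast
  qed (auto simp: big_parts_def)
  moreover have "gf (image_mset (\<lambda>x. x + j) ` big_parts 0 i) = fps_X ^ (i * j) * gf (big_parts 0 i)"
  proof (rule gf_image_0)
    show "inj_on (image_mset (\<lambda>x. x + j)) (big_parts 0 i)"
      by (rule inj_on_subset[OF multiset.inj_map]) (auto simp: inj_def)
    fix p assume "p \<in> big_parts 0 i"
    then show "\<Sum>\<^sub># (image_mset (\<lambda>x. x + j) p) = \<Sum>\<^sub># p + i * j"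
      by (simp add: big_parts_def sum_mset.distrib)
  qed
  ultimately show ?thesis by simp
qed

text \<open>A partition with i + 1 parts either contains a 1, which is removed, or has all parts
  above 1, and then 1 is subtracted from each. Hence (1 - q^(i+1)) v_(i+1) = q v_i.\<close>

lemma gf_size: "gf (big_parts 0 i) = Acoef 1 (int i)"
proof -
  have "gf (big_parts 0 i) = fps_X ^ i * upart i"
  proof (induction i)
    case 0
    have "big_parts 0 0 = {{#}}" by (auto simp: big_parts_def)
    then show ?case by (simp add: gf_singleton)
  next
    case (Suc i)
    let ?v = "\<lambda>i. gf (big_parts 0 i)"
    have U: "big_parts 0 (Suc i) = big_parts 1 (Suc i) \<union> add_mset 1 ` big_parts 0 i"
    proof (intro equalityI subsetI)
      fix p assume p: "p \<in> big_parts 0 (Suc i)"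
      show "p \<in> big_parts 1 (Suc i) \<union> add_mset 1 ` big_parts 0 i"
      proof (cases "1 \<in># p")
        case True
        then have "p = add_mset 1 (p - {#1#})" by simp
        moreover have "p - {#1#} \<in> big_parts 0 i"
          using p True by (auto simp: big_parts_def size_Diff_singleton dest: in_diffD)
        ultimately show ?thesis by blast
      next
        case False
        then have "1 < x" if "x \<in># p" for x
          using that p by (metis (mono_tags, lifting) One_nat_def big_parts_def less_one linorder_neqE_nat mem_Collect_eq not_less_iff_gr_or_eq)
        then show ?thesis using p by (auto simp: big_parts_def)
      qed
    qed (auto simp: big_parts_def)
    have "?v (Suc i) = gf (big_parts 1 (Suc i)) + gf (add_mset 1 ` big_parts 0 i)"
      unfolding U by (rule gf_Un) (auto simp: big_parts_def positive_parts_def)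
    also have "gf (big_parts 1 (Suc i)) = fps_X ^ Suc i * ?v (Suc i)"
      using gf_big_parts_shift[of 1 "Suc i"] by simp
    also have "gf (add_mset 1 ` big_parts 0 i) = fps_X ^ 1 * ?v i"
      by (rule gf_image_0) (auto simp: inj_on_def)
    finally have "(1 - fps_X ^ Suc i) * ?v (Suc i) = fps_X ^ Suc i * upart i"
      using Suc by (simp add: algebra_simps)
    also have "\<dots> = (1 - fps_X ^ Suc i) * (fps_X ^ Suc i * upart (Suc i))"
      using upart_Suc[of i] by (metis mult.left_commute)
    finally show ?case
      using one_minus_X_power_nonzero[of "Suc i"] by (metis mult_left_cancel zero_less_Suc)
  qed
  then show ?thesis by (simp add: Acoef_def acoef_def zser_def)
qed

lemma gf_positive_parts: "gf positive_parts = pgf"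
proof -
  let ?S = "\<lambda>i::int. if i < 0 then {} else big_parts 0 (nat i)"
  have "positive_parts = (\<Union>i. ?S i)"
  proof (intro equalityI subsetI)
    fix p assume "p \<in> positive_parts"
    then have "p \<in> ?S (int (size p))"
      by (auto simp: positive_parts_def big_parts_def intro: gr0I)
    then show "p \<in> (\<Union>i. ?S i)" by blast
  qed (auto simp: positive_parts_def big_parts_def split: if_splits)
  also have "gf \<dots> = fsum (\<lambda>i. gf (?S i))"
    by (rule gf_UN(2)) (auto simp: positive_parts_def big_parts_def)
  also have "\<dots> = pgf"
    unfolding pgf_def by (intro arg_cong[where f = fsum] ext) (auto simp: gf_size)
  finally show ?thesis .
qed

section \<open>Counting partitions by their crank\<close>

definition crank_set :: "int \<Rightarrow> nat multiset set" where
  "crank_set m = {p \<in> positive_parts. p \<noteq> {#} \<and> partition_crank p = m}"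

definition no_ones_set :: "int \<Rightarrow> nat multiset set" where
  "no_ones_set m = {p \<in> positive_parts. p \<noteq> {#} \<and> 1 \<notin># p \<and> int (Max (set_mset p)) = m}"

text \<open>Empty for j = 0, so that the union may run over all natural numbers while partitions
  without ones stay apart.\<close>

definition ones_set :: "int \<Rightarrow> nat \<Rightarrow> nat multiset set" where
  "ones_set m j = {p \<in> positive_parts. j > 0 \<and> count p 1 = j \<and> int (size {#k \<in># p. k > j#}) = m + int j}"

lemma positive_sum_0: "p \<in> positive_parts \<Longrightarrow> \<Sum>\<^sub># p = 0 \<longleftrightarrow> p = {#}"
  by (cases p) (auto simp: positive_parts_def)

lemma positive_sum_1: "p \<in> positive_parts \<Longrightarrow> \<Sum>\<^sub># p = 1 \<longleftrightarrow> p = {#1#}"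
proof (cases p)
  case (add x q)
  assume "p \<in> positive_parts"
  then have "x > 0" "q \<in> positive_parts" by (auto simp: add positive_parts_def)
  then show ?thesis
    using positive_sum_0[of q] unfolding add by (auto simp: add_eq_if)
qed auto

text \<open>The factor 1 - q forbids parts equal to 1. The remaining q^j can be read as one largest
  part j (\<open>gf_no_ones_set\<close>) or as j ones (\<open>gf_ones_set\<close>).\<close>

lemma one_minus_X_Acoef:
  assumes "j > 0"
  shows "(1 - fps_X) * Acoef 1 (int j) = fps_X ^ j * (\<Prod>k=2..j. 1 + lam k)"
proof -
  have "(1 - fps_X) * upart j = (\<Prod>k=2..j. 1 + lam k)"
    using assms
  proof (induction j rule: nat_induct_non_zero)
    case 1
    show ?case using upart_Suc[of 0] by simp
  next
    case (Suc n)
    have "{2..Suc n} = insert (Suc n) {2..n}" using Suc by auto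
    then have "(\<Prod>k=2..Suc n. 1 + lam k) = (1 + lam (Suc n)) * ((1 - fps_X) * upart n)"
      by (simp add: Suc)
    then show ?case by (simp only: upart.simps mult_ac)
  qed
  then have "fps_X ^ j * ((1 - fps_X) * upart j) = fps_X ^ j * (\<Prod>k=2..j. 1 + lam k)"
    by (simp only:)
  then show ?thesis
    by (simp add: Acoef_def acoef_def zser_def mult_ac)
qed

lemma no_ones_set_empty:
  assumes "m \<le> 1"
  shows "no_ones_set m = {}"
proof (rule ccontr)
  assume "no_ones_set m \<noteq> {}"
  then obtain p where p: "0 \<notin># p" "1 \<notin># p" "p \<noteq> {#}" "int (Max (set_mset p)) = m"
    by (auto simp: no_ones_set_def positive_parts_def)
  have "Max (set_mset p) \<in># p" using p(3) by simp
  moreover have "Max (set_mset p) \<in> {0, 1}" using p(4) assms by auto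
  ultimately show False using p(1,2) by auto
qed

lemma gf_no_ones_set:
  assumes "k \<ge> 2"
  shows "gf (no_ones_set (int k)) = (1 - fps_X) * Acoef 1 (int k)"
proof -
  have "no_ones_set (int k) = add_mset k ` {p. set_mset p \<subseteq> {2..k}}"
  proof (intro equalityI subsetI)
    fix p assume "p \<in> no_ones_set (int k)"
    then have p: "0 \<notin># p" "1 \<notin># p" "p \<noteq> {#}" "Max (set_mset p) = k"
      by (auto simp: no_ones_set_def positive_parts_def)
    then have "k \<in># p" using Max_in[of "set_mset p"] by auto
    then have "p = add_mset k (p - {#k#})" by simp
    moreover have "set_mset (p - {#k#}) \<subseteq> {2..k}"
    proof
      fix x assume "x \<in># p - {#k#}"
      then have x: "x \<in># p" by (rule in_diffD)
      then have "x \<le> k" using p(4) by auto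
      moreover have "x \<noteq> 0" "x \<noteq> 1" using x p by metis+
      ultimately show "x \<in> {2..k}" by auto
    qed
    ultimately show "p \<in> add_mset k ` {p. set_mset p \<subseteq> {2..k}}" by blast
  next
    fix p assume "p \<in> add_mset k ` {p. set_mset p \<subseteq> {2..k}}"
    then obtain q where q: "p = add_mset k q" "set_mset q \<subseteq> {2..k}" by auto
    have "Max (set_mset p) = k"
      unfolding q(1) by (rule Max_eqI) (use q(2) in auto)
    then show "p \<in> no_ones_set (int k)"
      using q assms by (auto simp: no_ones_set_def positive_parts_def)
  qed
  also have "gf \<dots> = fps_X ^ k * gf {p. set_mset p \<subseteq> {2..k}}"
    by (rule gf_image_0) (auto simp: inj_on_def)
  also have "gf {p. set_mset p \<subseteq> {2..k}} = (\<Prod>k=2..k. 1 + lam k)"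
    by (rule gf_parts_in) auto
  finally show ?thesis
    using assms by (simp only: one_minus_X_Acoef)
qed

text \<open>Such a partition splits into j ones, parts from 2 to j, and i = m + j parts above j;
  subtracting j from each of the latter accounts for q^(i j).\<close>

lemma gf_ones_set:
  assumes j: "j > 0"
  shows "gf (ones_set m j) = (1 - fps_X) * (fps_X ^ nat (int j * (m + int j)) * (Acoef 1 (m + int j) * Acoef 1 (int j)))"
proof (cases "m + int j < 0")
  case True
  then show ?thesis by (auto simp: ones_set_def)
next
  case False
  then obtain i where i: "m + int j = int i" by (metis nonneg_int_cases not_less)
  let ?S = "{p. set_mset p \<subseteq> {2..j}}"
  have "ones_set m j = (\<lambda>p. replicate_mset j 1 + p) ` (\<lambda>(p, q). p + q) ` (?S \<times> big_parts j i)"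
  proof (intro equalityI subsetI)
    fix p assume "p \<in> ones_set m j"
    then have p: "0 \<notin># p" "count p 1 = j" "size {#k \<in># p. k > j#} = i"
      using i by (auto simp: ones_set_def positive_parts_def)
    let ?a = "{#k \<in># p. k \<in> {2..j}#}" and ?b = "{#k \<in># p. k > j#}"
    have "p = replicate_mset j 1 + (?a + ?b)"
    proof (rule multiset_eqI)
      fix x
      show "count p x = count (replicate_mset j 1 + (?a + ?b)) x"
        using p(1,2) j by (cases "x = 0"; cases "x = 1") (auto simp: not_in_iff)
    qed
    moreover have "?a \<in> ?S" "?b \<in> big_parts j i"
      using p by (auto simp: big_parts_def)
    ultimately show "p \<in> (\<lambda>p. replicate_mset j 1 + p) ` (\<lambda>(p, q). p + q) ` (?S \<times> big_parts j i)"
      by (intro image_eqI[of p _ "?a + ?b"] image_eqI[of "?a + ?b" _ "(?a, ?b)"]) auto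
  next
    fix r assume "r \<in> (\<lambda>p. replicate_mset j 1 + p) ` (\<lambda>(p, q). p + q) ` (?S \<times> big_parts j i)"
    then obtain p q where r: "r = replicate_mset j 1 + (p + q)" and p: "set_mset p \<subseteq> {2..j}"
      and q: "\<forall>x\<in>#q. j < x" "size q = i"
      by (auto simp: big_parts_def)
    have "{#k \<in># p. k > j#} = {#}"
      using p by auto
    moreover have "{#k \<in># q. k > j#} = q"
      using q by (simp add: filter_mset_eq_conv)
    moreover have "{#k \<in># replicate_mset j 1. k > j#} = {#}"
      using j by (auto intro!: multiset_eqI)
    ultimately have "{#k \<in># r. k > j#} = q"
      unfolding r by simp
    moreover have "1 \<notin># p" "1 \<notin># q" "0 \<notin># p" "0 \<notin># q"
      using p q j by auto
    ultimately show "r \<in> ones_set m j"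
      using j i q(2) by (auto simp: ones_set_def positive_parts_def r not_in_iff)
  qed
  also have "gf \<dots> = fps_X ^ j * gf ((\<lambda>(p, q). p + q) ` (?S \<times> big_parts j i))"
    by (rule gf_image_0) (auto simp: inj_on_def)
  also have "gf ((\<lambda>(p, q). p + q) ` (?S \<times> big_parts j i)) = gf ?S * gf (big_parts j i)"
  proof (rule gf_prod)
    show "inj_on (\<lambda>(p, q). p + q) (?S \<times> big_parts j i)"
    proof (rule inj_on_inverseI, clarify)
      fix p q assume p: "set_mset p \<subseteq> {2..j}" and q: "q \<in> big_parts j i"
      have "{#k \<in># p + q. k \<le> j#} = p"
      proof (rule multiset_eqI)
        fix x
        show "count {#k \<in># p + q. k \<le> j#} x = count p x"
          using p q by (auto simp: big_parts_def count_eq_zero_iff subset_iff)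
      qed
      moreover have "{#k \<in># p + q. k > j#} = q"
      proof (rule multiset_eqI)
        fix x
        show "count {#k \<in># p + q. k > j#} x = count q x"
          using p q by (auto simp: big_parts_def count_eq_zero_iff subset_iff)
      qed
      ultimately show "(\<lambda>r. ({#k \<in># r. k \<le> j#}, {#k \<in># r. k > j#})) (p + q) = (p, q)"
        by simp
    qed
  qed (auto simp: positive_parts_def big_parts_def)
  also have "gf ?S = (\<Prod>k=2..j. 1 + lam k)"
    by (rule gf_parts_in) auto
  also have "gf (big_parts j i) = fps_X ^ (i * j) * Acoef 1 (int i)"
    by (simp only: gf_big_parts_shift[of j i] gf_size)
  also have "fps_X ^ j * ((\<Prod>k=2..j. 1 + lam k) * (fps_X ^ (i * j) * Acoef 1 (int i))) =
      (fps_X ^ j * (\<Prod>k=2..j. 1 + lam k)) * (fps_X ^ (i * j) * Acoef 1 (int i))"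
    by (simp only: mult_ac)
  also have "fps_X ^ j * (\<Prod>k=2..j. 1 + lam k) = (1 - fps_X) * Acoef 1 (int j)"
    by (rule one_minus_X_Acoef[OF j, symmetric])
  also have "\<dots> * (fps_X ^ (i * j) * Acoef 1 (int i)) =
      (1 - fps_X) * (fps_X ^ (i * j) * (Acoef 1 (int i) * Acoef 1 (int j)))"
    by (simp only: mult_ac)
  also have "i * j = nat (int j * (m + int j))"
    unfolding i by (simp add: mult.commute flip: of_nat_mult)
  finally show ?thesis by (simp only: i)
qed

lemma crank_set_eq: "crank_set m = no_ones_set m \<union> (\<Union>j. ones_set m j)"
proof (intro equalityI subsetI)
  fix p assume p: "p \<in> crank_set m"
  show "p \<in> no_ones_set m \<union> (\<Union>j. ones_set m j)"
  proof (cases "1 \<in># p")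
    case True
    then have "p \<in> ones_set m (count p 1)"
      using p by (auto simp: crank_set_def ones_set_def partition_crank_def)
    then show ?thesis by blast
  next
    case False
    then show ?thesis
      using p by (auto simp: crank_set_def no_ones_set_def partition_crank_def)
  qed
next
  fix p assume "p \<in> no_ones_set m \<union> (\<Union>j. ones_set m j)"
  then show "p \<in> crank_set m"
  proof
    assume "p \<in> (\<Union>j. ones_set m j)"
    then obtain j where j: "p \<in> ones_set m j" by blast
    then have "1 \<in># p" by (auto simp: ones_set_def simp flip: count_greater_zero_iff)
    then show ?thesis using j by (auto simp: ones_set_def crank_set_def partition_crank_def)
  qed (auto simp: no_ones_set_def crank_set_def partition_crank_def)
qed

lemma crank_gf: "Abs_fps (crank_count m) = (1 - fps_X) * wcoef m"
proof -
  \<comment> \<open>The term j = 0 of the sum is (1 - q) A_m, which counts partitions without ones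
    only for m >= 2. Its values 1 - q at m = 0 and q at m = 1 are exactly the conventional counts at
    n = 0 and n = 1; the value at m = -1, n = 1 comes from the partition 1 itself, of crank
    -1.\<close>
  define D :: "int fps" where "D = (if m = 0 then 1 - fps_X else if m = 1 then fps_X else 0)"
  let ?t = "\<lambda>j::int. (1 - fps_X) * (fps_X ^ nat (j * (m + j)) * (Acoef 1 (m + j) * Acoef 1 j))"
  have ones: "locfin (\<lambda>j. gf (ones_set m j))" "gf (\<Union>j. ones_set m j) = fsum (\<lambda>j. gf (ones_set m j))"
    by (rule gf_UN; auto simp: ones_set_def)+
  have split: "gf (crank_set m) = gf (no_ones_set m) + fsum (\<lambda>j. gf (ones_set m j))"
    unfolding crank_set_eq ones(2)[symmetric]
    by (rule gf_Un) (auto simp: no_ones_set_def ones_set_def simp flip: count_greater_zero_iff)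
  have "(1 - fps_X) * wcoef m = fsum ?t"
    unfolding wcoef_def by (rule fsum_cmult[OF locfin_AA_shift, symmetric])
  also have "\<dots> = fsum (\<lambda>j. ?t (int j))"
  proof (rule fsum_reindex[symmetric])
    fix j :: int assume "j \<notin> range int"
    then have "j < 0" by (metis nonneg_int_cases not_less rangeI)
    then show "?t j = 0" by simp
  qed (simp add: inj_def)
  also have "\<dots> = fsum (\<lambda>j. (if j = 0 then (1 - fps_X) * Acoef 1 m else 0) + gf (ones_set m j))"
  proof (rule arg_cong[where f = fsum], rule ext)
    fix j
    show "?t (int j) = (if j = 0 then (1 - fps_X) * Acoef 1 m else 0) + gf (ones_set m j)"
    proof (cases "j = 0")
      case True
      then show ?thesis by (simp add: Acoef_0 ones_set_def)
    qed (simp add: gf_ones_set)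
  qed
  also have "\<dots> = fsum (\<lambda>j::nat. if j = 0 then (1 - fps_X) * Acoef 1 m else 0) + fsum (\<lambda>j. gf (ones_set m j))"
  proof (rule fsum_add[OF _ ones(1)])
    show "locfin (\<lambda>j::nat. if j = 0 then (1 - fps_X) * Acoef 1 m else 0)"
      by (rule locfinI, rule finite_subset[of _ "{0}"]) auto
  qed
  also have "fsum (\<lambda>j::nat. if j = 0 then (1 - fps_X) * Acoef 1 m else 0) =
      (\<Sum>j\<in>{0::nat}. if j = 0 then (1 - fps_X) * Acoef 1 m else 0)"
    by (rule fsum_finite) auto
  also have "\<dots> = D + gf (no_ones_set m)"
  proof -
    consider "m < 0" | "m = 0" | "m = 1" | "m \<ge> 2" by linarith
    then have "(1 - fps_X) * Acoef 1 m = D + gf (no_ones_set m)"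
    proof cases
      case 3
      then show ?thesis
        using one_minus_X_Acoef[of 1] by (simp add: D_def no_ones_set_empty)
    next
      case 4
      then show ?thesis
        using gf_no_ones_set[of "nat m"] by (simp add: D_def)
    qed (simp_all add: D_def no_ones_set_empty Acoef_0)
    then show ?thesis by simp
  qed
  finally have w: "(1 - fps_X) * wcoef m = D + gf (crank_set m)"
    using split by (simp add: add_ac)
  show ?thesis
    unfolding w
  proof (rule fps_ext)
    fix n
    show "fps_nth (Abs_fps (crank_count m)) n = fps_nth (D + gf (crank_set m)) n"
    proof (cases "n = 0 \<or> n = 1")
      case False
      then have "{p \<in> crank_set m. \<Sum>\<^sub># p = n} = {p \<in> partitions_of n. partition_crank p = m}"
        by (auto simp: crank_set_def partitions_of_eq)
      then show ?thesis
        using False by (auto simp: D_def gf_def crank_count_def)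
    next
      case True
      then show ?thesis
      proof
        assume n: "n = 0"
        have "{p \<in> crank_set m. \<Sum>\<^sub># p = 0} = {}"
          using positive_sum_0 by (auto simp: crank_set_def)
        then have "fps_nth (gf (crank_set m)) 0 = 0"
          by (simp only: gf_def fps_nth_Abs_fps card.empty of_nat_0)
        then show ?thesis by (simp add: n crank_count_def D_def)
      next
        assume n: "n = 1"
        have "partition_crank {#1#} = -1"
          by (simp add: partition_crank_def)
        then have "{p \<in> crank_set m. \<Sum>\<^sub># p = 1} = (if m = -1 then {{#1#}} else {})"
          using positive_sum_1 by (auto simp: crank_set_def positive_parts_def)
        then have "fps_nth (gf (crank_set m)) 1 = (if m = - 1 then 1 else 0)"
          by (simp only: gf_def fps_nth_Abs_fps) simp
        then show ?thesis by (simp add: n crank_count_def D_def)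
      qed
    qed
  qed
qed

definition crank_fps :: "nat \<Rightarrow> int fps" where
  "crank_fps a = Abs_fps (crank_moment a)"

text \<open>\<open>bcoef_eq_wcoef\<close> and \<open>crank_gf\<close> together give the product
  formula for the crank; its numerator, the product of 1 - q^k, appears as the factor
  \<open>pgf\<close> on the other side.\<close>

lemma pgf_crank_fps: "pgf * crank_fps a = bmoment 1 a"
proof -
  have b: "bcoef 1 k = pgf * Abs_fps (crank_count k)" for k
    by (simp only: bcoef_eq_wcoef crank_gf mult_ac)
  have lf: "locfin (\<lambda>k. of_int (k ^ a) * Abs_fps (crank_count k))"
  proof (rule locfin_cmult, rule locfinI)
    fix n
    show "finite {k. fps_nth (Abs_fps (crank_count k)) n \<noteq> 0}"
      using crank_moment_finite_support[of 0 n] by simp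
  qed
  have "crank_fps a = fsum (\<lambda>k. of_int (k ^ a) * Abs_fps (crank_count k))"
  proof (rule fps_ext)
    fix n
    show "fps_nth (crank_fps a) n = fps_nth (fsum (\<lambda>k. of_int (k ^ a) * Abs_fps (crank_count k))) n"
      by (simp add: crank_fps_def fsum_def crank_moment_def Sum_any.expand_set fps_mult_of_int_nth del: of_int_power)
  qed
  then have "pgf * crank_fps a = fsum (\<lambda>k. of_int (k ^ a) * bcoef 1 k)"
    unfolding b by (simp only: fsum_cmult[OF lf, symmetric] mult.left_commute)
  then show ?thesis by (simp only: fsum_bcoef)
qed

section \<open>Dyson's symmetry of the rank\<close>

text \<open>The empty partition gets rank 0, in accordance with \<^const>\<open>rank_count\<close>.\<close>

definition rk :: "nat multiset \<Rightarrow> int" where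
  "rk p = (if p = {#} then 0 else partition_rank p)"

definition rank_le :: "int \<Rightarrow> int fps" where
  "rank_le m = gf {p \<in> positive_parts. rk p \<le> m}"

lemma rk_nonempty: "p \<noteq> {#} \<Longrightarrow> rk p = int (Max (set_mset p)) - int (size p)"
  by (simp add: rk_def partition_rank_def)

lemma rank_count_gf: "Abs_fps (rank_count m) = gf {p \<in> positive_parts. rk p = m}"
proof (rule fps_ext)
  fix n
  show "fps_nth (Abs_fps (rank_count m)) n = fps_nth (gf {p \<in> positive_parts. rk p = m}) n"
  proof (cases "n = 0")
    case True
    have "{p \<in> {p \<in> positive_parts. rk p = m}. \<Sum>\<^sub># p = 0} = (if m = 0 then {{#}} else {})"
      using positive_sum_0 by (auto simp: rk_def positive_parts_def simp del: sum_mset_0_iff)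
    then have "fps_nth (gf {p \<in> positive_parts. rk p = m}) 0 = (if m = 0 then 1 else 0)"
      by (simp only: gf_def fps_nth_Abs_fps) simp
    then show ?thesis by (simp add: True rank_count_def)
  next
    case False
    then have "{p \<in> {p \<in> positive_parts. rk p = m}. \<Sum>\<^sub># p = n} = {p \<in> partitions_of n. partition_rank p = m}"
      by (auto simp: partitions_of_eq rk_def)
    then show ?thesis using False by (simp add: gf_def rank_count_def)
  qed
qed

lemma rank_le_step: "rank_le m = rank_le (m - 1) + Abs_fps (rank_count m)"
proof -
  have "{p \<in> positive_parts. rk p \<le> m} = {p \<in> positive_parts. rk p \<le> m - 1} \<union> {p \<in> positive_parts. rk p = m}"
    by auto
  then show ?thesis
    unfolding rank_le_def rank_count_gf by (simp only:) (rule gf_Un; auto)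
qed

text \<open>Dyson's map removes the first column of the Ferrers diagram and inserts a part of its
  length plus \<open>m - 1\<close>, which is a largest part because the rank is at most \<open>m\<close>.\<close>

definition dyson :: "int \<Rightarrow> nat multiset \<Rightarrow> nat multiset" where
  "dyson m p = filter_mset (\<lambda>x. x \<noteq> 0) (add_mset (nat (int (size p) + m - 1)) (image_mset (\<lambda>x. x - 1) p))"

text \<open>The largest part b equals the number of parts of the original partition plus m - 1, so
  that partition has b - m + 1 parts: those of r raised by one, padded with ones. An inserted part 0
  is invisible, whence b = 0 for empty q.\<close>

definition dyson_inv :: "int \<Rightarrow> nat multiset \<Rightarrow> nat multiset" where
  "dyson_inv m q = (let b = (if q = {#} then 0 else Max (set_mset q)); r = q - {#b#}
     in image_mset Suc r + replicate_mset (nat (int b - m + 1) - size r) 1)"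

definition dyson_dom :: "int \<Rightarrow> nat multiset set" where
  "dyson_dom m = {p \<in> positive_parts. p \<noteq> {#} \<and> rk p \<le> m}"

text \<open>The inserted part was c = size p + m - 1 and at most size p other parts remain, so the
  rank is at least m - 2. The empty result needs c = 0, hence m <= 0. The single part m - 1 would
  come from the empty partition, which is outside the domain.\<close>

definition dyson_ran :: "int \<Rightarrow> nat multiset set" where
  "dyson_ran m = {q \<in> positive_parts. m - 2 \<le> rk q \<and> (q = {#} \<longrightarrow> m \<le> 0) \<and> (m \<ge> 2 \<longrightarrow> q \<noteq> {#nat (m - 1)#})}"

lemma shrink_restore:
  "0 \<notin># p \<Longrightarrow>
    image_mset Suc {#x \<in># image_mset (\<lambda>x. x - 1) p. x \<noteq> 0#} +
      replicate_mset (size p - size {#x \<in># image_mset (\<lambda>x. x - 1) p. x \<noteq> 0#}) 1 = p"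
proof (induction p)
  case (add x p)
  have le: "size {#x \<in># image_mset (\<lambda>x. x - 1) p. x \<noteq> 0#} \<le> size p"
    by (metis size_filter_mset_lesseq size_image_mset)
  show ?case
  proof (cases "x = 1")
    case True
    then show ?thesis
      using add le by (simp add: Suc_diff_le)
  next
    case False
    then have "x > 1" using add.prems by auto
    then show ?thesis
      using add by simp
  qed
qed simp

lemma sum_shrink: "0 \<notin># p \<Longrightarrow> \<Sum>\<^sub># {#x \<in># image_mset (\<lambda>x. x - 1) p. x \<noteq> (0::nat)#} + size p = \<Sum>\<^sub># p"
  by (induction p) auto

lemma dyson_dom_size:
  assumes "p \<in> dyson_dom m"
  shows "int (Max (set_mset p)) - 1 \<le> int (size p) + m - 1" "0 < Max (set_mset p)" "0 < size p" "0 \<notin># p"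
proof -
  have p: "p \<noteq> {#}" "0 \<notin># p" "rk p \<le> m"
    using assms by (auto simp: dyson_dom_def positive_parts_def)
  then show "int (Max (set_mset p)) - 1 \<le> int (size p) + m - 1" "0 \<notin># p" "0 < size p"
    by (simp_all add: rk_nonempty nonempty_has_size)
  have "Max (set_mset p) \<in># p" using p by simp
  then show "0 < Max (set_mset p)" using p(2) by (metis gr0I)
qed

text \<open>The sum changes by m - 1, the removed column being replaced by a part m - 1 longer. This
  number is written as the difference of \<open>nat m\<close> and \<open>nat (- m) + 1\<close> to
  keep exponents nonnegative.\<close>

lemma dyson_image:
  assumes "p \<in> dyson_dom m"
  shows "dyson m p \<in> dyson_ran m" "dyson_inv m (dyson m p) = p"
    "\<Sum>\<^sub># (dyson m p) + (nat (- m) + 1) = \<Sum>\<^sub># p + nat m"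
proof -
  note d = dyson_dom_size[OF assms]
  define c where "c = nat (int (size p) + m - 1)"
  have c: "int c = int (size p) + m - 1" using d by (simp add: c_def)
  define s where "s = {#x \<in># image_mset (\<lambda>x. x - 1) p. x \<noteq> 0#}"
  have s_le: "x \<le> c" if x: "x \<in># s" for x
  proof -
    obtain y where y: "y \<in># p" "x = y - 1" using x by (auto simp: s_def)
    then have "y \<le> Max (set_mset p)" by simp
    then show ?thesis using d(1) c y(2) by linarith
  qed
  have s0: "0 \<notin># s" by (simp add: s_def)
  have size_s: "size s \<le> size p"
    unfolding s_def by (metis size_filter_mset_lesseq size_image_mset)
  have eq: "dyson m p = (if c = 0 then s else add_mset c s)"
    by (simp add: dyson_def c_def s_def)
  have empty: "s = {#}" if "c = 0"
  proof (rule ccontr)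
    assume "s \<noteq> {#}"
    then obtain x where "x \<in># s" by blast
    then show False using s_le[of x] s0 that by auto
  qed
  have max: "Max (set_mset (add_mset c s)) = c"
    by (rule Max_eqI) (use s_le in auto)
  show "dyson m p \<in> dyson_ran m"
  proof (cases "c = 0")
    case True
    then have "m \<le> 0" using c d(3) by linarith
    then show ?thesis
      by (simp add: eq True empty dyson_ran_def positive_parts_def rk_def)
  next
    case False
    have "rk (add_mset c s) = int c - int (size s) - 1"
      using max by (simp add: rk_nonempty)
    moreover have "add_mset c s \<noteq> {#nat (m - 1)#}"
    proof
      assume "add_mset c s = {#nat (m - 1)#}"
      then have "c = nat (m - 1)" by (simp add: add_mset_eq_single)
      then show False using c d(3) False by linarith
    qed
    ultimately show ?thesis
      using False c size_s s0 by (auto simp: eq dyson_ran_def positive_parts_def)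
  qed
  have "nat (int c - m + 1) = size p" using c by simp
  then show "dyson_inv m (dyson m p) = p"
    using shrink_restore[OF d(4), folded s_def] max empty s0
    by (auto simp: dyson_inv_def eq Let_def)
  have "\<Sum>\<^sub># (dyson m p) = c + \<Sum>\<^sub># s"
    by (simp add: eq)
  moreover have "\<Sum>\<^sub># s + size p = \<Sum>\<^sub># p"
    unfolding s_def by (rule sum_shrink[OF d(4)])
  ultimately show "\<Sum>\<^sub># (dyson m p) + (nat (- m) + 1) = \<Sum>\<^sub># p + nat m"
    using c by linarith
qed

lemma dyson_preimage:
  assumes "q \<in> dyson_ran m"
  shows "dyson_inv m q \<in> dyson_dom m" "dyson m (dyson_inv m q) = q"
proof -
  have q: "0 \<notin># q" "m - 2 \<le> rk q" "q = {#} \<longrightarrow> m \<le> 0" "m \<ge> 2 \<longrightarrow> q \<noteq> {#nat (m - 1)#}"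
    using assms by (auto simp: dyson_ran_def positive_parts_def)
  define b where "b = (if q = {#} then 0 else Max (set_mset q))"
  define r where "r = q - {#b#}"
  define l where "l = nat (int b - m + 1)"
  have bq: "b \<in># q" if "q \<noteq> {#}"
    using that by (simp add: b_def)
  have b0: "b = 0 \<longleftrightarrow> q = {#}"
  proof (cases "q = {#}")
    case False
    then show ?thesis using bq q(1) by metis
  qed (simp add: b_def)
  have r0: "0 \<notin># r" using q(1) by (auto simp: r_def dest: in_diffD)
  have qr: "q = (if b = 0 then r else add_mset b r)"
    using bq b0 by (auto simp: r_def)
  have r_le: "x \<le> b" if "x \<in># r" for x
  proof -
    have "x \<in># q" using that by (auto simp: r_def dest: in_diffD)
    then show ?thesis by (auto simp: b_def)
  qed
  \<comment> \<open>This is the number of parts to be restored. The rank bound gives the first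
    inequality, and the second fails only for the excluded single part m - 1.\<close>
  have "int b - m + 1 \<ge> int (size r) \<and> int b - m + 1 > 0"
  proof (cases "q = {#}")
    case True
    then show ?thesis using q(3) b0 by (auto simp: r_def)
  next
    case False
    have sz: "size q = Suc (size r)" using False b0 qr by (metis size_add_mset)
    have "m - 2 \<le> int b - int (size q)"
      using q(2) False by (simp add: rk_nonempty b_def)
    then have 1: "int b - m + 1 \<ge> int (size r)" using sz by simp
    have "int b - m + 1 \<noteq> 0"
    proof
      assume 0: "int b - m + 1 = 0"
      then have "r = {#}" using 1 by simp
      then have "q = {#b#}" using qr b0 False by simp
      moreover have "b = nat (m - 1)" "m \<ge> 2" using 0 b0 False by auto
      ultimately show False using q(4) by simp
    qed
    then show ?thesis using 1 by linarith
  qed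
  then have l: "int l = int b - m + 1" "size r \<le> l" "l > 0"
    by (auto simp: l_def)
  define p where "p = image_mset Suc r + replicate_mset (l - size r) 1"
  have p: "dyson_inv m q = p"
    by (simp add: dyson_inv_def p_def l_def Let_def flip: b_def r_def)
  have size_p: "size p = l" using l by (simp add: p_def)
  then have p_ne: "p \<noteq> {#}" using l(3) by auto
  have p_le: "x \<le> b + 1" if "x \<in># p" for x
    using that r_le by (auto simp: p_def split: if_splits)
  have "Max (set_mset p) \<le> b + 1"
    using p_ne p_le by simp
  then have "rk p \<le> m"
    using l(1) size_p by (simp add: rk_nonempty[OF p_ne])
  moreover have "p \<in> positive_parts"
    by (auto simp: positive_parts_def p_def)
  ultimately show "dyson_inv m q \<in> dyson_dom m"
    using p p_ne by (simp add: dyson_dom_def)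
  have "nat (int (size p) + m - 1) = b"
    using l(1) size_p by simp
  moreover have "{#x \<in># image_mset (\<lambda>x. x - 1) p. x \<noteq> 0#} = r"
  proof -
    have "image_mset (\<lambda>x. x - 1) p = r + replicate_mset (l - size r) 0"
      by (simp add: p_def multiset.map_comp comp_def)
    moreover have "{#x \<in># r. x \<noteq> 0#} = r"
      by (rule multiset_eqI) (use r0 in \<open>auto simp: not_in_iff\<close>)
    ultimately show ?thesis by auto
  qed
  ultimately have "dyson m p = (if b = 0 then r else add_mset b r)"
    by (simp add: dyson_def)
  then show "dyson m (dyson_inv m q) = q"
    unfolding p using qr by (rule trans[OF _ sym])
qed

lemma gf_dyson: "fps_X ^ (nat (- m) + 1) * gf (dyson_ran m) = fps_X ^ nat m * gf (dyson_dom m)"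
proof -
  have "dyson m ` dyson_dom m = dyson_ran m"
  proof (intro equalityI subsetI)
    fix q assume "q \<in> dyson_ran m"
    then show "q \<in> dyson m ` dyson_dom m"
      using dyson_preimage[of q m] by (intro image_eqI[of _ _ "dyson_inv m q"]) auto
  qed (use dyson_image(1) in auto)
  moreover have "inj_on (dyson m) (dyson_dom m)"
    by (rule inj_on_inverseI[of _ "dyson_inv m"]) (rule dyson_image(2))
  ultimately show ?thesis
    using gf_image[of "dyson m" "dyson_dom m" "nat (- m) + 1" "nat m"] dyson_image(3) by metis
qed

lemma gf_dyson_dom: "rank_le m = gf (dyson_dom m) + (if 0 \<le> m then 1 else 0)"
proof -
  have "{p \<in> positive_parts. rk p \<le> m} = dyson_dom m \<union> (if 0 \<le> m then {{#}} else {})"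
    by (auto simp: dyson_dom_def rk_def positive_parts_def)
  moreover have "gf (dyson_dom m \<union> (if 0 \<le> m then {{#}} else {})) = gf (dyson_dom m) + gf (if 0 \<le> m then {{#}} else {})"
    by (rule gf_Un) (auto simp: dyson_dom_def positive_parts_def)
  ultimately show ?thesis
    by (simp add: rank_le_def gf_singleton)
qed

text \<open>Every partition has rank at most m - 3, or lies in the range, or is one of the excluded
  ones: the empty partition for m = 1 and m = 2, and the single part m - 1, whose rank is m -
  2.\<close>

lemma gf_dyson_ran:
  "pgf = rank_le (m - 3) + gf (dyson_ran m) + (if 0 < m \<and> m \<le> 2 then 1 else 0) + (if m \<ge> 2 then fps_X ^ nat (m - 1) else 0)"
proof -
  let ?A = "if 0 < m \<and> m \<le> 2 then {{#} :: nat multiset} else {}"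
  let ?B = "if m \<ge> 2 then {{#nat (m - 1)#}} else {}"
  have r1: "rk {#nat (m - 1)#} = m - 2" if "m \<ge> 2"
    using that by (simp add: rk_nonempty)
  have r0: "rk {#} = 0" by (simp add: rk_def)
  have "positive_parts = {p \<in> positive_parts. rk p \<le> m - 3} \<union> (dyson_ran m \<union> (?A \<union> ?B))" (is "?L = ?R")
  proof (intro equalityI subsetI)
    fix p assume p: "p \<in> ?L"
    consider "rk p \<le> m - 3" | "p = {#}" "0 < m" "m - 2 \<le> rk p" | "m \<ge> 2" "p = {#nat (m - 1)#}" | "p \<in> dyson_ran m"
      using p by (force simp: dyson_ran_def)
    then show "p \<in> ?R"
    proof cases
      case 2
      then have "p \<in> ?A" using r0 by simp
      then show ?thesis by blast
    next
      case 3
      then have "p \<in> ?B" by simp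
      then show ?thesis by blast
    qed (use p in auto)
  qed (auto simp: dyson_ran_def positive_parts_def split: if_splits)
  then have "pgf = gf ({p \<in> positive_parts. rk p \<le> m - 3} \<union> (dyson_ran m \<union> (?A \<union> ?B)))"
    by (simp only: flip: gf_positive_parts)
  also have "\<dots> = gf {p \<in> positive_parts. rk p \<le> m - 3} + gf (dyson_ran m \<union> (?A \<union> ?B))"
    using r1 r0 by (intro gf_Un) (auto simp: dyson_ran_def positive_parts_def split: if_splits)
  also have "gf (dyson_ran m \<union> (?A \<union> ?B)) = gf (dyson_ran m) + gf (?A \<union> ?B)"
    by (rule gf_Un) (auto simp: dyson_ran_def positive_parts_def split: if_splits)
  also have "gf (?A \<union> ?B) = gf ?A + gf ?B"
    by (rule gf_Un) (auto simp: positive_parts_def split: if_splits)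
  finally show ?thesis
    by (simp add: rank_le_def gf_singleton add_ac split: if_splits)
qed

text \<open>The corrections for the empty partition and for the single part m - 1 cancel each other
  except at m = 0 and m = 2.\<close>

lemma dyson_relation:
  "fps_X ^ nat m * rank_le m + fps_X ^ (nat (- m) + 1) * rank_le (m - 3) =
    fps_X ^ (nat (- m) + 1) * pgf + (if m = 0 then 1 else if m = 2 then - fps_X else 0)"
proof -
  define A where "A = gf (dyson_ran m)"
  have 1: "rank_le (m - 3) = pgf - A - (if 0 < m \<and> m \<le> 2 then 1 else 0) - (if m \<ge> 2 then fps_X ^ nat (m - 1) else 0)"
    by (subst gf_dyson_ran[of m]) (simp add: A_def)
  have "fps_X ^ nat m * rank_le m = fps_X ^ (nat (- m) + 1) * A + fps_X ^ nat m * (if 0 \<le> m then 1 else 0)"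
    unfolding gf_dyson_dom distrib_left gf_dyson[symmetric] A_def ..
  then have 2: "fps_X ^ nat m * rank_le m + fps_X ^ (nat (- m) + 1) * rank_le (m - 3) =
      fps_X ^ (nat (- m) + 1) * pgf + (fps_X ^ nat m * (if 0 \<le> m then 1 else 0)
      - fps_X ^ (nat (- m) + 1) * ((if 0 < m \<and> m \<le> 2 then 1 else 0) + (if m \<ge> 2 then fps_X ^ nat (m - 1) else 0)))"
    unfolding 1 by (simp add: algebra_simps)
  consider "m < 0" | "m = 0" | "m = 1" | "m = 2" | "m > 2" by linarith
  then have "fps_X ^ nat m * (if 0 \<le> m then 1 else 0)
      - fps_X ^ (nat (- m) + 1) * ((if 0 < m \<and> m \<le> 2 then 1 else 0) + (if m \<ge> 2 then fps_X ^ nat (m - 1) else 0))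
      = (if m = 0 then 1 else if m = 2 then - fps_X else 0 :: int fps)"
  proof cases
    case 5
    then have "nat m = Suc (nat (m - 1))" by simp
    then show ?thesis using 5 by simp
  qed (simp_all add: numeral_2_eq_2 algebra_simps)
  then show ?thesis unfolding 2 by simp
qed

section \<open>The rank-crank differential equation\<close>

lemma zcoeff_diff:
  fixes f :: "int fps fps"
  defines "c \<equiv> \<lambda>(f :: int fps fps) i::int. if i < 0 then 0 else fps_nth f (nat i)"
  shows "c ((1 - fps_X) * f) i = c f i - c f (i - 1)"
proof (cases "i \<le> 0")
  case False
  then have "nat i = Suc (nat (i - 1))" by simp
  then show ?thesis using False by (simp add: c_def left_diff_distrib)
qed (auto simp: c_def)

text \<open>Multiplication by (1 - z)^3 removes the factors with k = 0 from the cube of the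
  product.\<close>

lemma acoef_diff3:
  "acoef 3 i - 3 * acoef 3 (i - 1) + 3 * acoef 3 (i - 2) - acoef 3 (i - 3) = Acoef 3 i"
proof -
  let ?c = "\<lambda>(f :: int fps fps) i::int. if i < 0 then 0 else fps_nth f (nat i)"
  have "zshift (zser ^ 3) = (1 - fps_X) * ((1 - fps_X) * ((1 - fps_X) * zser ^ 3))"
    unfolding zshift_power zser_shift[symmetric] by (simp add: power3_eq_cube mult_ac)
  then have "Acoef 3 i = ?c ((1 - fps_X) * ((1 - fps_X) * ((1 - fps_X) * zser ^ 3))) i"
    by (cases "i < 0") (simp_all add: Acoef_eq_zshift del: zshift_nth)
  also have "\<dots> = ?c (zser ^ 3) i - 3 * ?c (zser ^ 3) (i - 1) + 3 * ?c (zser ^ 3) (i - 2) - ?c (zser ^ 3) (i - 3)"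
    by (simp only: zcoeff_diff) (simp add: algebra_simps)
  finally show ?thesis by (simp add: acoef_def)
qed

text \<open>With \<open>R\<close> the rank generating function, \<open>rankg m\<close> is the coefficient of \<open>z\<^sup>m\<close> in
  \<open>(6 \<delta>\<^sub>q + \<delta>\<^sub>z + \<delta>\<^sub>z\<^sup>2) (R / (1 - z))\<close>, the left-hand side of the rank-crank equation;
  \<open>cubec m\<close> below is the coefficient of \<open>z\<^sup>m\<close> in \<open>2 z / ((1 - z)\<^sup>3 \<Prod>\<^sub>k (1 - z q\<^sup>k)\<^sup>3 (1 - q\<^sup>k / z)\<^sup>3)\<close>.\<close>

definition rankg :: "int \<Rightarrow> int fps" where
  "rankg m = 6 * fps_XD (rank_le m) + of_int (m * (m + 1)) * rank_le m"

lemma XD_of_int_mult: "fps_XD (of_int c * f) = of_int c * fps_XD (f :: int fps)"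
  by (rule fps_ext) (simp add: fps_mult_of_int_nth)

lemma rankg_relation:
  "fps_X ^ nat m * rankg m + fps_X ^ (nat (- m) + 1) * rankg (m - 3) =
    fps_X ^ (nat (- m) + 1) * (of_int ((m - 2) * (m - 3)) * pgf + 6 * fps_XD pgf)"
proof -
  define a b where "a = nat m" and "b = nat (- m) + 1"
  have ab: "int a = m + int b - 1" by (simp add: a_def b_def)
  \<comment> \<open>The operator L = 6 q d/dq + t acts on q^k f as q^k times 6 q d/dq + 6 k + t. The
    constant t is chosen so that 6 a + t = m (m + 1); then 6 b + t = (m - 3)(m - 2) automatically,
    which is what \<open>rankg (m - 3)\<close> requires, and L kills both exceptional terms 1 and
    -q.\<close>
  define t where "t = m * (m + 1) - 6 * int a"
  define L where "L f = 6 * fps_XD f + of_int t * f" for f :: "int fps"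
  have L_add: "L (f + g) = L f + L g" for f g
    by (simp add: L_def algebra_simps)
  have L_X: "L (fps_X ^ k * f) = fps_X ^ k * (6 * fps_XD f + of_int (6 * int k + t) * f)" for k f
    by (simp add: L_def XD_mult XD_X_power algebra_simps)
  define E :: "int fps" where "E = (if m = 0 then 1 else if m = 2 then - fps_X else 0)"
  have "L E = 0"
  proof (cases "m = 0")
    case True
    then show ?thesis by (simp add: L_def E_def t_def a_def)
  next
    case False
    show ?thesis
    proof (cases "m = 2")
      case True
      have "fps_XD (- fps_X) = (- fps_X :: int fps)"
        using XD_X_power[of 1, where 'a = int] by (simp add: fps_XD_def)
      then show ?thesis using True by (simp add: L_def E_def t_def a_def)
    qed (use False in \<open>simp add: L_def E_def fps_XD_def\<close>)
  qed
  moreover have "fps_X ^ a * rank_le m + fps_X ^ b * rank_le (m - 3) = fps_X ^ b * pgf + E"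
    using dyson_relation[of m] by (simp add: a_def b_def E_def)
  ultimately have "L (fps_X ^ a * rank_le m) + L (fps_X ^ b * rank_le (m - 3)) = L (fps_X ^ b * pgf)"
    by (metis L_add add.right_neutral)
  moreover have "6 * int a + t = m * (m + 1)" "6 * int b + t = (m - 3) * (m - 2)"
    using ab by (simp_all add: t_def algebra_simps)
  ultimately have "fps_X ^ a * rankg m + fps_X ^ b * rankg (m - 3) =
      fps_X ^ b * (6 * fps_XD pgf + of_int ((m - 3) * (m - 2)) * pgf)"
    unfolding L_X by (simp add: rankg_def)
  then show ?thesis
    by (simp add: a_def b_def mult.commute add.commute)
qed

lemma locfin_acoef_Acoef: "locfin (\<lambda>j. acoef r (m + j) * Acoef r j)"
  by (rule locfin_cmult[OF locfin_Acoef])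

definition cubec :: "int \<Rightarrow> int fps" where
  "cubec m = 2 * fsum (\<lambda>j. acoef 3 (m - 1 + j) * Acoef 3 j)"

text \<open>The first sum is half of \<open>cubec m\<close> after an index shift that releases a
  power of q, the second is half of \<open>cubec (m - 3)\<close>; see
  \<open>cubec_relation\<close>.\<close>

definition cubes :: "int \<Rightarrow> int fps" where
  "cubes m = fsum (\<lambda>j. acoef 3 (j + (1 - m)) * Acoef 3 j) + fsum (\<lambda>j. acoef 3 (m - 4 + j) * Acoef 3 j)"

lemma locfin_diff3:
  fixes f :: "int \<Rightarrow> int \<Rightarrow> int fps"
  assumes "\<And>m. locfin (f m)"
  shows "fsum (f a) - 3 * fsum (f b) + 3 * fsum (f c) - fsum (f d) =
    fsum (\<lambda>j. f a j - 3 * f b j + 3 * f c j - f d j)"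
proof -
  have l3: "locfin (\<lambda>j. 3 * f m j)" for m
    by (rule locfin_cmult[OF assms])
  have "fsum (\<lambda>j. f a j - 3 * f b j + 3 * f c j - f d j) =
      fsum (f a) - fsum (\<lambda>j. 3 * f b j) + fsum (\<lambda>j. 3 * f c j) - fsum (f d)"
    by (simp only: fsum_diff fsum_add locfin_diff locfin_add l3 assms)
  then show ?thesis by (simp only: fsum_cmult[OF assms])
qed

text \<open>Both sums turn into the same convolution of \<open>Acoef 3\<close> with itself, with
  opposite signs because m enters their indices with opposite signs.\<close>

lemma cubes_diff3: "cubes m - 3 * cubes (m - 1) + 3 * cubes (m - 2) - cubes (m - 3) = 0"
proof -
  define f g where "f = (\<lambda>m j. acoef 3 (j + (1 - m)) * Acoef 3 j)" and "g = (\<lambda>m j. acoef 3 (m - 4 + j) * Acoef 3 j)"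
  have lf: "locfin (f m)" for m
    using locfin_acoef_Acoef[of 3 "1 - m"] by (simp add: f_def add.commute)
  have lg: "locfin (g m)" for m
    using locfin_acoef_Acoef[of 3 "m - 4"] by (simp add: g_def)
  have cs: "cubes m = fsum (f m) + fsum (g m)" for m
    by (simp add: cubes_def f_def g_def)
  have "fsum (f m) - 3 * fsum (f (m - 1)) + 3 * fsum (f (m - 2)) - fsum (f (m - 3)) =
      fsum (\<lambda>j. - (Acoef 3 (j + (4 - m)) * Acoef 3 j))"
    unfolding locfin_diff3[of f, OF lf]
  proof (rule arg_cong[where f = fsum], rule ext)
    fix j
    show "f m j - 3 * f (m - 1) j + 3 * f (m - 2) j - f (m - 3) j = - (Acoef 3 (j + (4 - m)) * Acoef 3 j)"
      unfolding acoef_diff3[of "j + (4 - m)", symmetric] f_def by (simp add: algebra_simps)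
  qed
  also have "\<dots> = - fsum (\<lambda>j. Acoef 3 (j + (m - 4) + (4 - m)) * Acoef 3 (j + (m - 4)))"
    by (simp only: fsum_uminus fsum_shift[of "\<lambda>j. Acoef 3 (j + (4 - m)) * Acoef 3 j" "m - 4"])
  finally have 1: "fsum (f m) - 3 * fsum (f (m - 1)) + 3 * fsum (f (m - 2)) - fsum (f (m - 3)) =
      - fsum (\<lambda>j. Acoef 3 j * Acoef 3 (j + (m - 4)))"
    by simp
  have 2: "fsum (g m) - 3 * fsum (g (m - 1)) + 3 * fsum (g (m - 2)) - fsum (g (m - 3)) =
      fsum (\<lambda>j. Acoef 3 j * Acoef 3 (j + (m - 4)))"
    unfolding locfin_diff3[of g, OF lg]
  proof (rule arg_cong[where f = fsum], rule ext)
    fix j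
    show "g m j - 3 * g (m - 1) j + 3 * g (m - 2) j - g (m - 3) j = Acoef 3 j * Acoef 3 (j + (m - 4))"
      unfolding acoef_diff3[of "j + (m - 4)", symmetric] g_def by (simp add: algebra_simps)
  qed
  have "cubes m - 3 * cubes (m - 1) + 3 * cubes (m - 2) - cubes (m - 3) =
      (fsum (f m) - 3 * fsum (f (m - 1)) + 3 * fsum (f (m - 2)) - fsum (f (m - 3))) +
      (fsum (g m) - 3 * fsum (g (m - 1)) + 3 * fsum (g (m - 2)) - fsum (g (m - 3)))"
    unfolding cs by (simp add: algebra_simps)
  also have "\<dots> = 0"
    unfolding 1 2 by simp
  finally show ?thesis .
qed

lemma third_difference_unique:
  fixes d :: "int \<Rightarrow> int fps"
  assumes neg: "\<And>i. i < 0 \<Longrightarrow> d i = 0"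
    and rec: "\<And>i. d i - 3 * d (i - 1) + 3 * d (i - 2) - d (i - 3) = 0"
  shows "d i = 0"
proof -
  have "\<forall>i<int n. d i = 0" for n
  proof (induction n)
    case (Suc n)
    have "d (int n) = 0"
      using rec[of "int n"] Suc by simp
    moreover have "i < int n \<or> i = int n" if "i < int (Suc n)" for i
      using that by auto
    ultimately show ?case using Suc by blast
  qed (use neg in auto)
  then show ?thesis
    by (metis neg not_less zless_nat_eq_int_zless lessI zero_le_imp_eq_int of_nat_less_iff)
qed

text \<open>The coefficients of 2 / (1 - z)^3; the factor 2 keeps them polynomial over the
  integers.\<close>

definition tri :: "int \<Rightarrow> int" where
  "tri n = (if n \<ge> 0 then (n + 1) * (n + 2) else 0)"

lemma tri_diff3: "tri n - 3 * tri (n - 1) + 3 * tri (n - 2) - tri (n - 3) = (if n = 0 then 2 else 0)"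
proof -
  consider "n < 0" | "n = 0" | "n = 1" | "n = 2" | "n \<ge> 3" by linarith
  then show ?thesis
    by cases (auto simp: tri_def algebra_simps)
qed

lemma acoef_tri: "2 * acoef 3 i = fsum (\<lambda>l. of_int (tri (i - l)) * Acoef 3 l)"
proof -
  define f where "f = (\<lambda>i l. of_int (tri (i - l)) * Acoef 3 l)"
  have lf: "locfin (f m)" for m
    unfolding f_def by (rule locfin_cmult[OF locfin_Acoef])
  have f: "fsum (f i) - 3 * fsum (f (i - 1)) + 3 * fsum (f (i - 2)) - fsum (f (i - 3)) = 2 * Acoef 3 i" for i
  proof -
    have "fsum (f i) - 3 * fsum (f (i - 1)) + 3 * fsum (f (i - 2)) - fsum (f (i - 3)) =
        fsum (\<lambda>l. if l = i then 2 * Acoef 3 i else 0)"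
      unfolding locfin_diff3[of f, OF lf]
    proof (rule arg_cong[where f = fsum], rule ext)
      fix l
      have "f i l - 3 * f (i - 1) l + 3 * f (i - 2) l - f (i - 3) l =
          of_int (tri (i - l) - 3 * tri (i - l - 1) + 3 * tri (i - l - 2) - tri (i - l - 3)) * Acoef 3 l"
        by (simp add: f_def algebra_simps)
      then show "f i l - 3 * f (i - 1) l + 3 * f (i - 2) l - f (i - 3) l = (if l = i then 2 * Acoef 3 i else 0)"
        unfolding tri_diff3 by auto
    qed
    also have "\<dots> = (\<Sum>l\<in>{i}. if l = i then 2 * Acoef 3 i else 0)"
      by (rule fsum_finite) auto
    finally show ?thesis by simp
  qed
  define d where "d i = 2 * acoef 3 i - fsum (f i)" for i
  have "d i = 0"
  proof (rule third_difference_unique)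
    fix i
    have "d i - 3 * d (i - 1) + 3 * d (i - 2) - d (i - 3) =
        2 * (acoef 3 i - 3 * acoef 3 (i - 1) + 3 * acoef 3 (i - 2) - acoef 3 (i - 3))
        - (fsum (f i) - 3 * fsum (f (i - 1)) + 3 * fsum (f (i - 2)) - fsum (f (i - 3)))"
      by (simp add: d_def algebra_simps)
    then show "d i - 3 * d (i - 1) + 3 * d (i - 2) - d (i - 3) = 0"
      unfolding f acoef_diff3 by simp
  next
    fix i :: int assume i: "i < 0"
    have "f i l = 0" for l
      using i by (cases "l < 0") (auto simp: f_def tri_def)
    then have "f i = (\<lambda>_. 0)" by (rule ext)
    then show "d i = 0" using i by (simp add: d_def)
  qed
  then show ?thesis by (simp add: d_def f_def)
qed

lemma bmoment_2: "bmoment r 2 = 2 * of_nat r * Phi 1 * pgf ^ (2 * r)"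
  using bmoment_Suc[of 1 r] bmoment_odd[of 1 r] by (simp add: numeral_2_eq_2 bmoment_0 mult_ac)

text \<open>For large m the first sum is q-adically small. In the second, \<open>tri\<close> may be
  replaced by its polynomial: they differ only where l > m - 4 + j, and there
  \<open>Acoef 3 l\<close> has order at least m - 3. What remains is a combination of the moments of
  order 0, 1 and 2.\<close>

lemma cubes_limit:
  "vanish (nat (m - 3)) (2 * cubes m - (of_int ((m - 2) * (m - 3)) * pgf ^ 6 + 6 * Phi 1 * pgf ^ 6))"
proof -
  let ?A = "Acoef 3"
  have 1: "vanish (nat (m - 3)) (2 * fsum (\<lambda>j. acoef 3 (j + (1 - m)) * ?A j))"
  proof (rule vanish_mult_left, rule vanish_fsum)
    fix j
    show "vanish (nat (m - 3)) (acoef 3 (j + (1 - m)) * ?A j)"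
    proof (cases "j + (1 - m) < 0")
      case False
      then show ?thesis
        by (intro vanish_mult_left vanish_mono[OF vanish_Acoef]) auto
    qed simp
  qed
  have lfA: "locfin (\<lambda>l. of_int (c l) * ?A l)" for c
    by (rule locfin_cmult[OF locfin_Acoef])
  have lfP: "locfin (\<lambda>(j, l). of_int (c j l) * (?A j * ?A l))" for c
    by (rule locfin_AA)
  have "2 * fsum (\<lambda>j. acoef 3 (m - 4 + j) * ?A j) = fsum (\<lambda>j. 2 * (acoef 3 (m - 4 + j) * ?A j))"
    by (rule fsum_cmult[OF locfin_acoef_Acoef, symmetric])
  also have "\<dots> = fsum (\<lambda>j. fsum (\<lambda>l. of_int (tri (m - 4 + j - l)) * (?A j * ?A l)))"
  proof (rule arg_cong[where f = fsum], rule ext)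
    fix j
    have "2 * (acoef 3 (m - 4 + j) * ?A j) = ?A j * (2 * acoef 3 (m - 4 + j))" by simp
    also have "\<dots> = fsum (\<lambda>l. ?A j * (of_int (tri (m - 4 + j - l)) * ?A l))"
      unfolding acoef_tri by (rule fsum_cmult[OF lfA, symmetric])
    finally show "2 * (acoef 3 (m - 4 + j) * ?A j) = fsum (\<lambda>l. of_int (tri (m - 4 + j - l)) * (?A j * ?A l))"
      by (simp add: mult_ac)
  qed
  also have "\<dots> = fsum (\<lambda>(j, l). of_int (tri (m - 4 + j - l)) * (?A j * ?A l))"
    by (rule fsum_Sigma[OF lfP, symmetric])
  finally have t: "2 * fsum (\<lambda>j. acoef 3 (m - 4 + j) * ?A j) = fsum (\<lambda>(j, l). of_int (tri (m - 4 + j - l)) * (?A j * ?A l))" .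
  have lfp: "locfin (\<lambda>p. of_int (c p) * (?A (fst p) * ?A (snd p)))" for c
    using lfP[of "\<lambda>j l. c (j, l)"] by (simp add: split_def)
  have bm: "bmoment 3 a = fsum (\<lambda>p. of_int ((fst p - snd p) ^ a) * (?A (fst p) * ?A (snd p)))" for a
    unfolding bmoment_def by (simp add: split_def)
  \<comment> \<open>With x = i - j, the polynomial (m - 3 + x)(m - 2 + x) is (m - 3)(m - 2) + (2 m -
    5) x + x^2. The first moment vanishes, being odd, and the second is known.\<close>
  define q where "q = of_int ((m - 3) * (m - 2)) * bmoment 3 0 + (of_int (2 * m - 5) * bmoment 3 1 + bmoment 3 2)"
  have "q = fsum (\<lambda>p. of_int ((m - 3) * (m - 2)) * (of_int ((fst p - snd p) ^ 0) * (?A (fst p) * ?A (snd p)))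
      + (of_int (2 * m - 5) * (of_int ((fst p - snd p) ^ 1) * (?A (fst p) * ?A (snd p)))
      + of_int ((fst p - snd p) ^ 2) * (?A (fst p) * ?A (snd p))))"
    unfolding q_def bm fsum_cmult[OF lfp, symmetric]
    by (simp only: fsum_add locfin_add locfin_cmult lfp)
  also have "\<dots> = fsum (\<lambda>p. of_int ((m - 3 + (fst p - snd p)) * (m - 2 + (fst p - snd p))) * (?A (fst p) * ?A (snd p)))"
    by (intro arg_cong[where f = fsum] ext) (simp add: algebra_simps power2_eq_square)
  finally have q: "q = fsum (\<lambda>p. of_int ((m - 3 + (fst p - snd p)) * (m - 2 + (fst p - snd p))) * (?A (fst p) * ?A (snd p)))" .
  have "2 * fsum (\<lambda>j. acoef 3 (m - 4 + j) * ?A j) - q =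
      fsum (\<lambda>p. of_int (tri (m - 4 + fst p - snd p)) * (?A (fst p) * ?A (snd p)) -
        of_int ((m - 3 + (fst p - snd p)) * (m - 2 + (fst p - snd p))) * (?A (fst p) * ?A (snd p)))"
    unfolding t q split_def by (rule fsum_diff[OF lfp lfp, symmetric])
  moreover have "vanish (nat (m - 3)) (of_int (tri (m - 4 + fst p - snd p)) * (?A (fst p) * ?A (snd p)) -
        of_int ((m - 3 + (fst p - snd p)) * (m - 2 + (fst p - snd p))) * (?A (fst p) * ?A (snd p)))" for p
  proof -
    have "vanish (nat (m - 3)) (?A (snd p))" if "m - 4 + fst p - snd p < 0" "fst p \<ge> 0"
      by (rule vanish_mono[OF vanish_Acoef]) (use that in auto)
    moreover have "tri (m - 4 + fst p - snd p) = (m - 3 + (fst p - snd p)) * (m - 2 + (fst p - snd p))"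
      if "\<not> m - 4 + fst p - snd p < 0"
      using that by (simp add: tri_def algebra_simps)
    ultimately show ?thesis
      by (cases "fst p < 0"; cases "m - 4 + fst p - snd p < 0") (auto intro!: vanish_diff vanish_mult_left)
  qed
  ultimately have 2: "vanish (nat (m - 3)) (2 * fsum (\<lambda>j. acoef 3 (m - 4 + j) * ?A j) - q)"
    by (simp add: vanish_fsum)
  have "q = of_int ((m - 2) * (m - 3)) * pgf ^ 6 + 6 * Phi 1 * pgf ^ 6"
    unfolding q_def bmoment_0 bmoment_2 by (simp add: bmoment_odd algebra_simps)
  then have "2 * cubes m - (of_int ((m - 2) * (m - 3)) * pgf ^ 6 + 6 * Phi 1 * pgf ^ 6) =
      2 * fsum (\<lambda>j. acoef 3 (j + (1 - m)) * ?A j) + (2 * fsum (\<lambda>j. acoef 3 (m - 4 + j) * ?A j) - q)"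
    by (simp add: cubes_def algebra_simps)
  then show ?thesis
    using vanish_add[OF 1 2] by simp
qed

text \<open>The difference of the two sides has third difference 0 in m and tends to 0 q-adically as
  m grows, so running the recurrence downwards makes it 0 everywhere.\<close>

lemma cubes_eq: "2 * cubes m = of_int ((m - 2) * (m - 3)) * pgf ^ 6 + 6 * Phi 1 * pgf ^ 6"
proof -
  define E where "E m = 2 * cubes m - (of_int ((m - 2) * (m - 3)) * pgf ^ 6 + 6 * Phi 1 * pgf ^ 6)" for m
  have rec: "E m = E (m + 3) - 3 * E (m + 2) + 3 * E (m + 1)" for m
  proof -
    have "E (m + 3) - 3 * E (m + 2) + 3 * E (m + 1) - E m =
        2 * (cubes (m + 3) - 3 * cubes (m + 2) + 3 * cubes (m + 1) - cubes m)"
      by (simp add: E_def algebra_simps)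
    also have "\<dots> = 0"
    proof -
      have e: "m + 3 - 1 = m + 2" "m + 3 - 2 = m + 1" "m + 3 - 3 = m" by simp_all
      show ?thesis
        by (simp only: cubes_diff3[of "m + 3", unfolded e] mult_zero_right)
    qed
    finally show ?thesis by simp
  qed
  have all: "\<forall>m. m + int d \<ge> int K + 3 \<longrightarrow> vanish K (E m)" for K d
  proof (induction d rule: less_induct)
    case (less d)
    show ?case
    proof safe
      fix m assume m: "m + int d \<ge> int K + 3"
      show "vanish K (E m)"
      proof (cases "m \<ge> int K + 3")
        case True
        then show ?thesis
          unfolding E_def by (intro vanish_mono[OF cubes_limit]) auto
      next
        case False
        then have d: "d > 0" using m by auto
        have v: "vanish K (E (m + i))" if "i \<ge> 1" for i
          using less[of "d - 1"] d m that by auto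
        show ?thesis
          by (subst rec) (intro vanish_add vanish_diff vanish_mult_left v; simp)
      qed
    qed
  qed
  have "vanish K (E m)" for K
    using all[of K "nat (int K + 3 - m)"] by auto
  then have "E m = 0" by (rule vanish_all_imp_zero)
  then show ?thesis by (simp add: E_def)
qed

text \<open>Shifting j by m - 1 exchanges the two coefficients, so that the power of q sits on the
  other factor; the exponents match since nat m + j = nat (-m) + 1 + (m - 1 + j).\<close>

lemma cubec_relation:
  "fps_X ^ nat m * cubec m + fps_X ^ (nat (- m) + 1) * cubec (m - 3) = fps_X ^ (nat (- m) + 1) * (2 * cubes m)"
proof -
  define b where "b = nat (- m) + 1"
  have lf: "locfin (\<lambda>j. acoef 3 (k + j) * Acoef 3 j)" for k
    by (rule locfin_acoef_Acoef)
  have lf': "locfin (\<lambda>j. acoef 3 (j + (1 - m)) * Acoef 3 j)"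
    using lf[of "1 - m"] by (simp add: add.commute)
  have "fps_X ^ nat m * fsum (\<lambda>j. acoef 3 (m - 1 + j) * Acoef 3 j) =
      fsum (\<lambda>j. fps_X ^ nat m * (acoef 3 (m - 1 + j) * Acoef 3 j))"
    by (rule fsum_cmult[OF lf, symmetric])
  also have "\<dots> = fsum (\<lambda>j. fps_X ^ b * (acoef 3 (j + (m - 1) + (1 - m)) * Acoef 3 (j + (m - 1))))"
  proof (rule arg_cong[where f = fsum], rule ext)
    fix j
    show "fps_X ^ nat m * (acoef 3 (m - 1 + j) * Acoef 3 j) =
        fps_X ^ b * (acoef 3 (j + (m - 1) + (1 - m)) * Acoef 3 (j + (m - 1)))"
    proof (cases "j < 0 \<or> m - 1 + j < 0")
      case False
      have "nat m + nat j = b + nat (m - 1 + j)"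
        using False unfolding b_def by arith
      then have "fps_X ^ nat m * fps_X ^ nat j = (fps_X ^ b * fps_X ^ nat (m - 1 + j) :: int fps)"
        by (simp flip: power_add)
      then have "fps_X ^ nat m * fps_X ^ nat j * (acoef 3 (m - 1 + j) * acoef 3 j) =
          fps_X ^ b * fps_X ^ nat (m - 1 + j) * (acoef 3 (m - 1 + j) * acoef 3 j)"
        by simp
      then show ?thesis
        by (simp add: Acoef_def mult_ac add_ac)
    qed (auto simp: add_ac)
  qed
  also have "\<dots> = fsum (\<lambda>j. fps_X ^ b * (acoef 3 (j + (1 - m)) * Acoef 3 j))"
    by (rule fsum_shift[of "\<lambda>j. fps_X ^ b * (acoef 3 (j + (1 - m)) * Acoef 3 j)" "m - 1"])
  also have "\<dots> = fps_X ^ b * fsum (\<lambda>j. acoef 3 (j + (1 - m)) * Acoef 3 j)"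
    by (rule fsum_cmult[OF lf'])
  finally have 1: "fps_X ^ nat m * cubec m = 2 * (fps_X ^ b * fsum (\<lambda>j. acoef 3 (j + (1 - m)) * Acoef 3 j))"
    by (simp add: cubec_def)
  have "cubec (m - 3) = 2 * fsum (\<lambda>j. acoef 3 (m - 4 + j) * Acoef 3 j)"
    by (simp add: cubec_def)
  then show ?thesis
    using 1 by (simp add: cubes_def algebra_simps b_def)
qed

text \<open>For k >= -2 the relation reads Z_k = - q^(k+2) Z_(k+3), so moving up makes Z_k divisible
  by ever higher powers of q; below -2 the relation descends from known zeros.\<close>

lemma relation_unique:
  fixes Z :: "int \<Rightarrow> int fps"
  assumes rel: "\<And>m. fps_X ^ nat m * Z m + fps_X ^ (nat (- m) + 1) * Z (m - 3) = 0"
  shows "Z m = 0"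
proof -
  have pos: "Z k = - (fps_X ^ nat (k + 2) * Z (k + 3))" if "k \<ge> -2" for k
  proof -
    have "nat (k + 3) = Suc (nat (k + 2))" using that by simp
    then have "fps_X * (fps_X ^ nat (k + 2) * Z (k + 3) + Z k) = 0"
      using rel[of "k + 3"] that by (simp add: algebra_simps)
    then show ?thesis by (simp add: add_eq_0_iff)
  qed
  have "\<forall>k\<ge>-2. vanish K (Z k)" for K
  proof (induction K)
    case (Suc K)
    show ?case
    proof safe
      fix k :: int assume k: "k \<ge> -2"
      \<comment> \<open>Two steps are taken at once because a single one gains nothing at k = -2;
        together they gain at least q^3.\<close>
      have "Z k = - (fps_X ^ nat (k + 2) * - (fps_X ^ nat (k + 5) * Z (k + 6)))"
        using pos[OF k] pos[of "k + 3"] k by (simp add: add.commute)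
      moreover have "vanish (nat (k + 2) + (nat (k + 5) + K)) (- (fps_X ^ nat (k + 2) * - (fps_X ^ nat (k + 5) * Z (k + 6))))"
        using Suc k by (intro vanish_uminus vanish_X_mult) auto
      moreover have "Suc K \<le> nat (k + 2) + (nat (k + 5) + K)" using k by linarith
      ultimately show "vanish (Suc K) (Z k)"
        by (metis vanish_mono)
    qed
  qed simp
  then have z: "Z k = 0" if "k \<ge> -2" for k
    using that by (intro vanish_all_imp_zero) auto
  have "\<forall>k\<ge>-2 - int n. Z k = 0" for n
  proof (induction n)
    case (Suc n)
    have "Z k = 0" if k: "k \<ge> -2 - int (Suc n)" for k
    proof (cases "k \<ge> -2")
      case False
      then have "Z (k + 3) = 0" using Suc k by simp
      then have "fps_X ^ (nat (- (k + 3)) + 1) * Z k = 0"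
        using rel[of "k + 3"] by simp
      then show ?thesis by simp
    qed (rule z)
    then show ?case by blast
  qed (use z in auto)
  from this[of "nat (- m)"] show ?thesis by auto
qed

text \<open>The coefficient form of the rank-crank equation. Since q d/dq \<open>pgf\<close> is
  \<open>Phi 1 * pgf\<close>, the right-hand side of \<open>rankg_relation\<close> times
  \<open>pgf ^ 5\<close> is the value found in \<open>cubes_eq\<close>.\<close>

lemma rankg_eq_cubec: "pgf ^ 5 * rankg m = cubec m"
proof -
  define Z where "Z m = pgf ^ 5 * rankg m - cubec m" for m
  have "Z m = 0"
  proof (rule relation_unique)
    fix m
    have "fps_X ^ nat m * Z m + fps_X ^ (nat (- m) + 1) * Z (m - 3) =
        pgf ^ 5 * (fps_X ^ nat m * rankg m + fps_X ^ (nat (- m) + 1) * rankg (m - 3))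
        - (fps_X ^ nat m * cubec m + fps_X ^ (nat (- m) + 1) * cubec (m - 3))"
      by (simp add: Z_def algebra_simps)
    also have "\<dots> = 0"
      unfolding rankg_relation cubec_relation cubes_eq XD_pgf
      by (simp add: algebra_simps power_Suc[symmetric] del: power_Suc) (simp add: algebra_simps eval_nat_numeral)
    finally show "fps_X ^ nat m * Z m + fps_X ^ (nat (- m) + 1) * Z (m - 3) = 0" .
  qed
  then show ?thesis by (simp add: Z_def)
qed

text \<open>Multiplication by (1 - z)^3; the indices are offset by one because of the factor z in
  the series of \<open>cubec\<close>.\<close>

lemma cubec_diff3: "cubec (k + 1) - 3 * cubec k + 3 * cubec (k - 1) - cubec (k - 2) = 2 * bcoef 3 k"
proof -
  define f where "f = (\<lambda>m j. acoef 3 (m - 1 + j) * Acoef 3 j)"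
  have lf: "locfin (f m)" for m
    unfolding f_def by (rule locfin_acoef_Acoef)
  have "cubec m = 2 * fsum (f m)" for m by (simp add: cubec_def f_def)
  then have "cubec (k + 1) - 3 * cubec k + 3 * cubec (k - 1) - cubec (k - 2) =
      2 * (fsum (f (k + 1)) - 3 * fsum (f k) + 3 * fsum (f (k - 1)) - fsum (f (k - 2)))"
    by (simp add: algebra_simps)
  also have "fsum (f (k + 1)) - 3 * fsum (f k) + 3 * fsum (f (k - 1)) - fsum (f (k - 2)) = bcoef 3 k"
    unfolding locfin_diff3[of f, OF lf] bcoef_def
  proof (rule arg_cong[where f = fsum], rule ext)
    fix j
    show "f (k + 1) j - 3 * f k j + 3 * f (k - 1) j - f (k - 2) j = Acoef 3 (k + j) * Acoef 3 j"
      unfolding acoef_diff3[of "k + j", symmetric] f_def by (simp add: algebra_simps)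
  qed
  finally show ?thesis .
qed

abbreviation rank_row :: "int \<Rightarrow> int fps" where
  "rank_row m \<equiv> Abs_fps (rank_count m)"

text \<open>The third difference of the equation for R / (1 - z). Differences of cumulative counts
  are rank counts, and G drops out because third differences of m (m + 1) are 0.\<close>

lemma rank_row_relation:
  "pgf ^ 5 * (6 * (fps_XD (rank_row (k + 1)) - 2 * fps_XD (rank_row k) + fps_XD (rank_row (k - 1)))
    + of_int ((k + 1) * (k + 2)) * rank_row (k + 1) + of_int ((k + 1) * (2 - 2 * k)) * rank_row k
    + of_int ((k - 1) * (k - 2)) * rank_row (k - 1)) = 2 * bcoef 3 k"
proof -
  define G where "G = rank_le (k - 2)"
  define N1 N2 N3 where "N1 = rank_row (k - 1)" and "N2 = rank_row k" and "N3 = rank_row (k + 1)"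
  have G: "rank_le (k - 1) = G + N1" "rank_le k = G + N1 + N2" "rank_le (k + 1) = G + N1 + N2 + N3"
    using rank_le_step[of "k - 1"] rank_le_step[of k] rank_le_step[of "k + 1"]
    by (simp_all add: G_def N1_def N2_def N3_def)
  have "rankg (k + 1) - 3 * rankg k + 3 * rankg (k - 1) - rankg (k - 2) =
    6 * (fps_XD N3 - 2 * fps_XD N2 + fps_XD N1)
    + of_int ((k + 1) * (k + 2)) * N3 + of_int ((k + 1) * (2 - 2 * k)) * N2 + of_int ((k - 1) * (k - 2)) * N1"
    unfolding rankg_def G G_def[symmetric] by (simp add: algebra_simps)
  moreover have "pgf ^ 5 * (rankg (k + 1) - 3 * rankg k + 3 * rankg (k - 1) - rankg (k - 2)) =
      cubec (k + 1) - 3 * cubec k + 3 * cubec (k - 1) - cubec (k - 2)"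
    by (simp add: rankg_eq_cubec[symmetric] algebra_simps)
  ultimately show ?thesis
    unfolding N1_def N2_def N3_def cubec_diff3 by simp
qed

definition rank_fps :: "nat \<Rightarrow> int fps" where
  "rank_fps a = Abs_fps (rank_moment a)"

lemma locfin_rank_row: "locfin rank_row"
proof (rule locfinI)
  fix n
  show "finite {k. fps_nth (rank_row k) n \<noteq> 0}"
    using rank_moment_finite_support[of 0 n] by simp
qed

lemma rank_fps_eq: "rank_fps a = fsum (\<lambda>k. of_int (k ^ a) * rank_row k)"
  by (rule fps_ext)
    (simp add: rank_fps_def fsum_def rank_moment_def Sum_any.expand_set fps_mult_of_int_nth del: of_int_power)

text \<open>\<open>rank_row_relation\<close> multiplied by k^a and summed over k; the weights at m
  come from k = m - 1, m and m + 1.\<close>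

lemma rank_moment_relation_raw:
  "pgf ^ 5 * (fps_XD (fsum (\<lambda>m. of_int (6 * ((m - 1) ^ a - 2 * m ^ a + (m + 1) ^ a)) * rank_row m))
    + fsum (\<lambda>m. of_int ((m - 1) ^ a * (m * (m + 1)) + m ^ a * ((m + 1) * (2 - 2 * m)) + (m + 1) ^ a * (m * (m - 1))) * rank_row m))
   = 2 * bmoment 3 a"
proof -
  let ?N = rank_row
  have lN: "locfin (\<lambda>m. of_int (c m) * ?N m)" for c
    by (rule locfin_cmult[OF locfin_rank_row])
  have lX: "locfin (\<lambda>m. of_int (c m) * fps_XD (?N m))" for c
    by (rule locfin_cmult[OF locfin_XD[OF locfin_rank_row]])
  have sh: "fsum (\<lambda>k. of_int (k ^ a * c k) * f (k + i)) = fsum (\<lambda>m. of_int ((m - i) ^ a * c (m - i)) * f m)" for f c i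
    using fsum_shift[of "\<lambda>m. of_int ((m - i) ^ a * c (m - i)) * f m" i] by simp
  note shX = sh[of _ "\<lambda>m. fps_XD (rank_row m)"] and shN = sh[of _ rank_row]
  have lXs: "locfin (\<lambda>k. of_int (c k) * fps_XD (?N (k + i)))" for c i
    using locfin_inj[OF lX[of "\<lambda>m. c (m - i)"], of "\<lambda>k. k + i"] by (simp add: inj_def)
  have lNs: "locfin (\<lambda>k. of_int (c k) * ?N (k + i))" for c i
    using locfin_inj[OF lN[of "\<lambda>m. c (m - i)"], of "\<lambda>k. k + i"] by (simp add: inj_def)
  define F where "F k = of_int (k ^ a * 6) * fps_XD (?N (k + 1)) + (of_int (k ^ a * (- 12)) * fps_XD (?N (k + 0)) +
      (of_int (k ^ a * 6) * fps_XD (?N (k + - 1)) + (of_int (k ^ a * ((k + 1) * (k + 2))) * ?N (k + 1)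
      + (of_int (k ^ a * ((k + 1) * (2 - 2 * k))) * ?N (k + 0) + of_int (k ^ a * ((k - 1) * (k - 2))) * ?N (k + - 1)))))" for k
  have lF: "locfin F"
    unfolding F_def by (intro locfin_add lXs lNs)
  have "fsum F = fsum (\<lambda>m. of_int ((m - 1) ^ a * 6) * fps_XD (?N m)) + (fsum (\<lambda>m. of_int ((m - 0) ^ a * (- 12)) * fps_XD (?N m)) +
      (fsum (\<lambda>m. of_int ((m - - 1) ^ a * 6) * fps_XD (?N m)) + (fsum (\<lambda>m. of_int ((m - 1) ^ a * ((m - 1 + 1) * (m - 1 + 2))) * ?N m)
      + (fsum (\<lambda>m. of_int ((m - 0) ^ a * ((m - 0 + 1) * (2 - 2 * (m - 0)))) * ?N m) + fsum (\<lambda>m. of_int ((m - - 1) ^ a * ((m - - 1 - 1) * (m - - 1 - 2))) * ?N m)))))"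
    unfolding F_def by (simp only: fsum_add locfin_add lXs lNs shX shN)
  also have "\<dots> = fsum (\<lambda>m. of_int ((m - 1) ^ a * 6) * fps_XD (?N m) + (of_int ((m - 0) ^ a * (- 12)) * fps_XD (?N m) +
      of_int ((m - - 1) ^ a * 6) * fps_XD (?N m))) + fsum (\<lambda>m. of_int ((m - 1) ^ a * ((m - 1 + 1) * (m - 1 + 2))) * ?N m
      + (of_int ((m - 0) ^ a * ((m - 0 + 1) * (2 - 2 * (m - 0)))) * ?N m + of_int ((m - - 1) ^ a * ((m - - 1 - 1) * (m - - 1 - 2))) * ?N m))"
    by (simp only: fsum_add locfin_add lX lN add.assoc)
  also have "fsum (\<lambda>m. of_int ((m - 1) ^ a * 6) * fps_XD (?N m) + (of_int ((m - 0) ^ a * (- 12)) * fps_XD (?N m) +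
      of_int ((m - - 1) ^ a * 6) * fps_XD (?N m))) = fps_XD (fsum (\<lambda>m. of_int (6 * ((m - 1) ^ a - 2 * m ^ a + (m + 1) ^ a)) * ?N m))"
    unfolding fsum_XD[OF lN] XD_of_int_mult
    by (intro arg_cong[where f = fsum] ext) (simp add: algebra_simps)
  also have "fsum (\<lambda>m. of_int ((m - 1) ^ a * ((m - 1 + 1) * (m - 1 + 2))) * ?N m
      + (of_int ((m - 0) ^ a * ((m - 0 + 1) * (2 - 2 * (m - 0)))) * ?N m + of_int ((m - - 1) ^ a * ((m - - 1 - 1) * (m - - 1 - 2))) * ?N m))
      = fsum (\<lambda>m. of_int ((m - 1) ^ a * (m * (m + 1)) + m ^ a * ((m + 1) * (2 - 2 * m)) + (m + 1) ^ a * (m * (m - 1))) * ?N m)"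
    by (intro arg_cong[where f = fsum] ext) (simp add: algebra_simps)
  finally have "pgf ^ 5 * (fps_XD (fsum (\<lambda>m. of_int (6 * ((m - 1) ^ a - 2 * m ^ a + (m + 1) ^ a)) * ?N m))
    + fsum (\<lambda>m. of_int ((m - 1) ^ a * (m * (m + 1)) + m ^ a * ((m + 1) * (2 - 2 * m)) + (m + 1) ^ a * (m * (m - 1))) * ?N m))
    = pgf ^ 5 * fsum F"
    by simp
  also have "\<dots> = fsum (\<lambda>k. pgf ^ 5 * F k)"
    by (rule fsum_cmult[OF lF, symmetric])
  also have "\<dots> = fsum (\<lambda>k. 2 * (of_int (k ^ a) * bcoef 3 k))"
  proof (rule arg_cong[where f = fsum], rule ext)
    fix k
    have "2 * (of_int (k ^ a) * bcoef 3 k) = of_int (k ^ a) * (2 * bcoef 3 k)" by simp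
    also have "\<dots> = pgf ^ 5 * F k"
      unfolding rank_row_relation[symmetric] F_def by (simp add: algebra_simps)
    finally show "pgf ^ 5 * F k = 2 * (of_int (k ^ a) * bcoef 3 k)" ..
  qed
  also have "\<dots> = 2 * bmoment 3 a"
    by (simp only: fsum_cmult[OF locfin_bcoef] fsum_bcoef)
  finally show ?thesis .
qed

section \<open>Identities between Eisenstein series\<close>

text \<open>With x = q^a and y = q^b this is the partial fraction identity x/(1-x) * y/(1-y) =
  xy/(1-xy) * (1 + x/(1-x) + y/(1-y)).\<close>

lemma lam_mult:
  assumes "a > 0" "b > 0"
  shows "lam a * lam b = lam (a + b) * (1 + lam a + lam b)"
proof -
  let ?A = "fps_X ^ a :: int fps" and ?B = "fps_X ^ b :: int fps"
  have 1: "(1 - ?A) * lam a = ?A" "(1 - ?B) * lam b = ?B" "(1 - ?A * ?B) * lam (a + b) = ?A * ?B"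
    unfolding power_add[symmetric] by (rule lam_geometric; use assms in simp)+
  have "(1 - ?A) * (1 - ?B) * (lam a * lam b) = ((1 - ?A) * lam a) * ((1 - ?B) * lam b)"
    by (simp only: mult_ac)
  also have "\<dots> = lam (a + b) * (1 - ?A * ?B)"
    unfolding 1(1,2) by (rule trans[OF 1(3)[symmetric] mult.commute])
  also have "1 - ?A * ?B = (1 - ?A) * (1 - ?B) + (1 - ?B) * ((1 - ?A) * lam a) + (1 - ?A) * ((1 - ?B) * lam b)"
    by (simp only: 1(1,2)) (simp add: algebra_simps)
  also have "lam (a + b) * \<dots> = (1 - ?A) * (1 - ?B) * (lam (a + b) * (1 + lam a + lam b))"
    by (simp add: algebra_simps)
  finally show ?thesis
    using one_minus_X_power_nonzero[of a] one_minus_X_power_nonzero[of b] assms by simp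
qed

lemma locfin_lam_pair: "locfin (\<lambda>(a, b). of_int (c a b) * (lam a * lam b))"
  using locfin_cmult[OF locfin_prod[OF locfin_lam locfin_lam], of "\<lambda>(a, b). of_int (c a b)"]
  by (simp add: split_def)

lemma locfin_diag: "locfin (\<lambda>a. of_int (c a) * (lam a * lam a))"
  using locfin_inj[OF locfin_lam_pair[of "\<lambda>a _. c a"], of "\<lambda>a. (a, a)"] by (simp add: inj_def)

lemma fsum_symmetric_pair:
  assumes sym: "\<And>a b. h a b = h b a"
  shows "fsum (\<lambda>(a, c). of_int (h a c) * (lam a * lam c)) =
    2 * fsum (\<lambda>(a, c). if a < c then of_int (h a c) * (lam a * lam c) else 0)
    + fsum (\<lambda>a. of_int (h a a) * (lam a * lam a))"
proof -
  define F where "F = (\<lambda>(a, c). of_int (h a c) * (lam a * lam c))"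
  have lF: "locfin F" unfolding F_def by (rule locfin_lam_pair)
  define lo up di where "lo p = (if fst p < snd p then F p else 0)" and "up p = (if snd p < fst p then F p else 0)"
    and "di p = (if fst p = snd p then F p else 0)" for p
  have l: "locfin lo" "locfin up" "locfin di"
    unfolding lo_def up_def di_def by (rule locfin_restrict[OF lF])+
  have "F = (\<lambda>p. lo p + (up p + di p))"
    by (rule ext) (auto simp: lo_def up_def di_def)
  then have "fsum F = fsum lo + (fsum up + fsum di)"
    by (simp add: fsum_add locfin_add l)
  moreover have "fsum up = fsum lo"
  proof -
    have "fsum up = fsum (\<lambda>q. up (prod.swap q))"
      by (rule fsum_reindex[symmetric]) auto
    moreover have "up (prod.swap q) = lo q" for q
      using sym[of "fst q" "snd q"] by (simp add: up_def lo_def F_def split_def mult.commute)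
    ultimately show ?thesis by simp
  qed
  moreover have "fsum di = fsum (\<lambda>a. of_int (h a a) * (lam a * lam a))"
  proof -
    have "fsum di = fsum (\<lambda>a. fsum (\<lambda>c. di (a, c)))"
      using fsum_Sigma[of "\<lambda>a c. di (a, c)"] l(3) by (simp add: split_def)
    also have "fsum (\<lambda>c. di (a, c)) = (\<Sum>c\<in>{a}. di (a, c))" for a
      by (rule fsum_finite) (auto simp: di_def)
    then have "(\<lambda>a. fsum (\<lambda>c. di (a, c))) = (\<lambda>a. of_int (h a a) * (lam a * lam a))"
      by (simp add: di_def F_def)
    finally show ?thesis .
  qed
  ultimately show ?thesis
    unfolding lo_def[abs_def] F_def split_def by simp
qed

text \<open>Skoruppa's elementary approach: a symmetric polynomial \<open>p\<close> for which \<open>p(a, c) - p(a, c - a)\<close>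
  is again symmetric yields, via the partial fraction identity for \<open>lam a * lam b\<close>, a relation between
  products of divisor sums.\<close>

lemma lambert_product_relation:
  fixes p s :: "int \<Rightarrow> int \<Rightarrow> int"
  assumes p: "\<And>a b. p a b = p b a" and s: "\<And>a b. s a b = s b a"
    and ps: "\<And>a c. s a c = p a c - p a (c - a)"
  shows "fsum (\<lambda>(a, c). of_int (s (int a) (int c)) * (lam a * lam c))
      + fsum (\<lambda>a. of_int (p (int a) (int a) - s (int a) (int a)) * (lam a * lam a))
    = fsum (\<lambda>n. of_int (\<Sum>a\<in>{1..<n}. p (int a) (int n - int a)) * lam n)"
proof -
  define P where "P a b = p (int a) (int b)" for a b
  define S where "S a b = s (int a) (int b)" for a b
  define pos where "pos a b f = (if 0 < a \<and> 0 < b then f else 0)" for a b :: nat and f :: "int fps"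
  have fin: "finite {(a :: nat, b). a + b \<le> n}" for n
    by (rule finite_subset[of _ "{..n} \<times> {..n}"]) auto
  have lf: "locfin (\<lambda>(a, b). pos a b (of_int (P a b) * (lam (a + b) * c a b)))" for c
  proof (rule locfin_vanish[of "\<lambda>(a, b). a + b"])
    show "vanish (case q of (a, b) \<Rightarrow> a + b) (case q of (a, b) \<Rightarrow> pos a b (of_int (P a b) * (lam (a + b) * c a b)))" for q
      by (auto simp: pos_def split_def intro!: vanish_mult_left[OF vanish_mult_right[OF vanish_lam]])
    show "finite {q. (case q of (a, b) \<Rightarrow> a + b) \<le> (n :: nat)}" for n
      using fin[of n] by (simp add: split_def)
  qed
  let ?T = "\<lambda>c. fsum (\<lambda>(a, b). pos a b (of_int (P a b) * (lam (a + b) * c a b)))"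
  have 1: "fsum (\<lambda>(a, b). of_int (P a b) * (lam a * lam b)) = ?T (\<lambda>_ _. 1) + (?T (\<lambda>a _. lam a) + ?T (\<lambda>_ b. lam b))"
  proof -
    have "of_int (P a b) * (lam a * lam b) = pos a b (of_int (P a b) * (lam (a + b) * 1))
        + (pos a b (of_int (P a b) * (lam (a + b) * lam a)) + pos a b (of_int (P a b) * (lam (a + b) * lam b)))" for a b
    proof (cases "0 < a \<and> 0 < b")
      case True
      then have "of_int (P a b) * (lam a * lam b) = of_int (P a b) * (lam (a + b) * (1 + lam a + lam b))"
        by (simp only: lam_mult)
      then show ?thesis
        using True by (simp only: pos_def if_True) (simp add: distrib_left add.assoc)
    qed (auto simp: pos_def)
    then have "fsum (\<lambda>(a, b). of_int (P a b) * (lam a * lam b)) =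
        fsum (\<lambda>q. (case q of (a, b) \<Rightarrow> pos a b (of_int (P a b) * (lam (a + b) * 1)))
        + ((case q of (a, b) \<Rightarrow> pos a b (of_int (P a b) * (lam (a + b) * lam a)))
          + (case q of (a, b) \<Rightarrow> pos a b (of_int (P a b) * (lam (a + b) * lam b)))))"
      by (simp only: split_def)
    then show ?thesis
      by (simp only: fsum_add locfin_add lf)
  qed
  have 2: "?T (\<lambda>_ b. lam b) = ?T (\<lambda>a _. lam a)"
  proof -
    have "?T (\<lambda>_ b. lam b) = fsum (\<lambda>(b, a). pos a b (of_int (P a b) * (lam (a + b) * lam b)))"
      by (rule fsum_swap_pair)
    also have "\<dots> = ?T (\<lambda>a _. lam a)"
      by (rule arg_cong[where f = fsum]) (auto simp: pos_def P_def p[of "int _" "int _"] add.commute fun_eq_iff)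
    finally show ?thesis .
  qed
  have 3: "?T (\<lambda>_ _. 1) = fsum (\<lambda>n. of_int (\<Sum>a\<in>{1..<n}. p (int a) (int n - int a)) * lam n)"
  proof -
    let ?h = "\<lambda>n a. if 0 < a \<and> a < n then of_int (p (int a) (int n - int a)) * lam n else 0"
    let ?g = "\<lambda>(n, a). ?h n a"
    have lg: "locfin ?g"
    proof (rule locfinI)
      fix k
      have "{q. fps_nth (?g q) k \<noteq> 0} \<subseteq> {..k} \<times> {..k}"
      proof
        fix q assume "q \<in> {q. fps_nth (?g q) k \<noteq> 0}"
        then have q: "snd q < fst q" "fps_nth (of_int (p (int (snd q)) (int (fst q) - int (snd q))) * lam (fst q)) k \<noteq> 0"
          by (cases q; auto split: if_splits)+
        have "vanish (fst q) (of_int (p (int (snd q)) (int (fst q) - int (snd q))) * lam (fst q))"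
          by (rule vanish_mult_left[OF vanish_lam])
        then have "fst q \<le> k" using q(2) by (auto simp: vanish_def not_less[symmetric])
        then show "q \<in> {..k} \<times> {..k}" using q(1) by (cases q) auto
      qed
      then show "finite {q. fps_nth (?g q) k \<noteq> 0}"
        by (rule finite_subset) simp
    qed
    have "?T (\<lambda>_ _. 1) = fsum (\<lambda>q. ?g (case q of (a, b) \<Rightarrow> (a + b, a)))"
      by (rule arg_cong[where f = fsum]) (auto simp: pos_def P_def fun_eq_iff)
    also have "\<dots> = fsum ?g"
    proof (rule fsum_reindex)
      show "inj (\<lambda>(a, b). (a + b, a :: nat))" by (auto simp: inj_def)
      fix q :: "nat \<times> nat" assume q: "q \<notin> range (\<lambda>(a, b). (a + b, a))"
      have "\<not> snd q < fst q"
      proof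
        assume "snd q < fst q"
        then have "q = (case (snd q, fst q - snd q) of (a, b) \<Rightarrow> (a + b, a))" by (cases q) auto
        then show False using q by blast
      qed
      then show "?g q = 0" by (cases q) auto
    qed
    also have "\<dots> = fsum (\<lambda>n. fsum (\<lambda>a. ?h n a))"
      by (rule fsum_Sigma[OF lg])
    also have "\<dots> = fsum (\<lambda>n. of_int (\<Sum>a\<in>{1..<n}. p (int a) (int n - int a)) * lam n)"
    proof (rule arg_cong[where f = fsum], rule ext)
      fix n
      have "fsum (\<lambda>a. ?h n a) = (\<Sum>a\<in>{1..<n}. ?h n a)"
        by (rule fsum_finite) auto
      also have "\<dots> = (\<Sum>a\<in>{1..<n}. of_int (p (int a) (int n - int a)) * lam n)"
        by (rule sum.cong) auto
      finally show "fsum (\<lambda>a. ?h n a) = of_int (\<Sum>a\<in>{1..<n}. p (int a) (int n - int a)) * lam n"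
        by (simp add: sum_distrib_right)
    qed
    finally show ?thesis .
  qed
  \<comment> \<open>The substitution c = a + b turns \<open>lam (a + b) * lam a\<close> into a term
    for the pair a < c with weight p(a, c - a).\<close>
  have 4: "?T (\<lambda>a _. lam a) = fsum (\<lambda>(a, c). if a < c then of_int (p (int a) (int c - int a)) * (lam a * lam c) else 0)"
  proof -
    let ?g = "\<lambda>(a, c). if a < c then of_int (p (int a) (int c - int a)) * (lam a * lam c) else 0"
    have "?T (\<lambda>a _. lam a) = fsum (\<lambda>q. ?g (case q of (a, b) \<Rightarrow> (a, a + b)))"
      by (rule arg_cong[where f = fsum]) (auto simp: pos_def P_def fun_eq_iff mult.commute)
    also have "\<dots> = fsum ?g"
    proof (rule fsum_reindex)
      show "inj (\<lambda>(a, b). (a, a + b :: nat))" by (auto simp: inj_def)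
      fix q :: "nat \<times> nat" assume q: "q \<notin> range (\<lambda>(a, b). (a, a + b))"
      have "\<not> fst q < snd q"
      proof
        assume "fst q < snd q"
        then have "q = (case (fst q, snd q - fst q) of (a, b) \<Rightarrow> (a, a + b))" by (cases q) auto
        then show False using q by blast
      qed
      then show "?g q = 0" by (cases q) auto
    qed
    finally show ?thesis .
  qed
  have lr: "locfin (\<lambda>(a, c). if a < c then of_int (h a c) * (lam a * lam c) else 0)" for h :: "nat \<Rightarrow> nat \<Rightarrow> int"
    using locfin_restrict[OF locfin_lam_pair[of h], of "\<lambda>(a, c). a < c"]
    unfolding split_def .
  have 5: "fsum (\<lambda>(a, c). if a < c then of_int (P a c) * (lam a * lam c) else 0) - 
      fsum (\<lambda>(a, c). if a < c then of_int (p (int a) (int c - int a)) * (lam a * lam c) else 0)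
      = fsum (\<lambda>(a, c). if a < c then of_int (S a c) * (lam a * lam c) else 0)"
    unfolding fsum_diff[OF lr lr, symmetric]
    by (rule arg_cong[where f = fsum]) (auto simp: S_def P_def ps fun_eq_iff algebra_simps)
  have 6: "fsum (\<lambda>a. of_int (P a a - S a a) * (lam a * lam a)) =
      fsum (\<lambda>a. of_int (P a a) * (lam a * lam a)) - fsum (\<lambda>a. of_int (S a a) * (lam a * lam a))"
    unfolding fsum_diff[OF locfin_diag locfin_diag, symmetric] by (simp add: left_diff_distrib)
  \<comment> \<open>Over a < c, subtracting p(a, c - a) from p(a, c) leaves s(a, c). By symmetry
    twice that sum is the full double sum without its diagonal, which is corrected
    separately.\<close>
  have "fsum (\<lambda>(a, c). of_int (S a c) * (lam a * lam c)) + fsum (\<lambda>a. of_int (P a a - S a a) * (lam a * lam a))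
      = fsum (\<lambda>(a, b). of_int (P a b) * (lam a * lam b))
      - 2 * fsum (\<lambda>(a, c). if a < c then of_int (p (int a) (int c - int a)) * (lam a * lam c) else 0)"
  proof -
    have S: "S a b = S b a" and P: "P a b = P b a" for a b
      unfolding S_def P_def by (rule s, rule p)
    show ?thesis
      unfolding fsum_symmetric_pair[of S, OF S] fsum_symmetric_pair[of P, OF P] 6 5[symmetric] by simp
  qed
  also have "\<dots> = fsum (\<lambda>n. of_int (\<Sum>a\<in>{1..<n}. p (int a) (int n - int a)) * lam n)"
    unfolding 1 2 3 4 by simp
  finally show ?thesis by (simp add: S_def P_def)
qed

definition lam_pow :: "nat \<Rightarrow> nat \<Rightarrow> int fps" where
  "lam_pow i n = of_nat (n ^ i) * lam n"

lemma locfin_lam_pow: "locfin (lam_pow i)"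
  unfolding lam_pow_def by (rule locfin_cmult[OF locfin_lam])

lemma fsum_lam_pow: "fsum (lam_pow i) = Phi i"
  by (simp only: Phi_def lam_pow_def[abs_def])

lemma locfin_sum_list:
  "(\<And>x. x \<in> set xs \<Longrightarrow> locfin (f x)) \<Longrightarrow> locfin (\<lambda>i. \<Sum>x\<leftarrow>xs. f x i)"
proof (induction xs)
  case Nil
  show ?case by (simp add: locfin_def)
qed (simp add: locfin_add)

lemma fsum_sum_list:
  "(\<And>x. x \<in> set xs \<Longrightarrow> locfin (f x)) \<Longrightarrow> fsum (\<lambda>i. \<Sum>x\<leftarrow>xs. f x i) = (\<Sum>x\<leftarrow>xs. fsum (f x))"
  by (induction xs) (simp_all add: fsum_add locfin_sum_list)

definition lam_pow2 :: "nat \<Rightarrow> nat \<Rightarrow> nat \<times> nat \<Rightarrow> int fps" where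
  "lam_pow2 i j q = lam_pow i (fst q) * lam_pow j (snd q)"

lemma locfin_lam_pow2: "locfin (lam_pow2 i j)"
  using locfin_prod[OF locfin_lam_pow[of i] locfin_lam_pow[of j]] by (simp add: lam_pow2_def[abs_def] split_def)

lemma fsum_lam_pow2: "fsum (lam_pow2 i j) = Phi i * Phi j"
  using fsum_prod[OF locfin_lam_pow[of i] locfin_lam_pow[of j]]
  by (simp add: lam_pow2_def[abs_def] split_def fsum_lam_pow)

text \<open>By \<open>XD_lam\<close>, a (lam a)^2 is q d/dq (lam a) minus a lam a, so squares on the
  diagonal produce a derivative.\<close>

lemma fsum_diag: "fsum (\<lambda>a. of_int (c * int a ^ Suc k) * (lam a * lam a)) = of_int c * (fps_XD (Phi k) - Phi (Suc k))"
proof -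
  have "fps_XD (Phi k) - Phi (Suc k) = fsum (\<lambda>a. fps_XD (lam_pow k a) - lam_pow (Suc k) a)"
    by (simp only: fsum_lam_pow[symmetric] fsum_XD[OF locfin_lam_pow] fsum_diff locfin_XD locfin_lam_pow)
  also have "\<dots> = fsum (\<lambda>a. of_int (int a ^ Suc k) * (lam a * lam a))"
  proof (rule arg_cong[where f = fsum], rule ext)
    fix a
    have "fps_XD (lam_pow k a) = of_nat (a ^ k) * fps_XD (lam a)"
      using XD_of_int_mult[of "int (a ^ k)" "lam a"] by (simp add: lam_pow_def)
    then show "fps_XD (lam_pow k a) - lam_pow (Suc k) a = of_int (int a ^ Suc k) * (lam a * lam a)"
      by (simp add: XD_lam lam_pow_def algebra_simps)
  qed
  finally have "of_int c * (fps_XD (Phi k) - Phi (Suc k)) = fsum (\<lambda>a. of_int c * (of_int (int a ^ Suc k) * (lam a * lam a)))"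
    by (simp only: fsum_cmult[OF locfin_diag])
  then show ?thesis by (simp add: mult_ac)
qed

text \<open>The lists S and T hold the monomials of s and of the power sum. Setting c = a in
  \<open>ps\<close> shows that the diagonal weight p(a, a) - s(a, a) is p(a, 0), so a derivative
  enters only through a pure power in p. L clears the denominators of the power sums, and p(0, n) is
  subtracted because they start at 0.\<close>

lemma eisenstein_relation:
  fixes p :: "int \<Rightarrow> int \<Rightarrow> int"
  assumes p: "\<And>a b. p a b = p b a"
    and s: "\<And>a b. (\<Sum>(i, j, k)\<leftarrow>S. k * a ^ i * b ^ j) = (\<Sum>(i, j, k)\<leftarrow>S. k * b ^ i * a ^ j)"
    and ps: "\<And>a c. (\<Sum>(i, j, k)\<leftarrow>S. k * a ^ i * c ^ j) = p a c - p a (c - a)"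
    and diag: "\<And>a. p a a - (\<Sum>(i, j, k)\<leftarrow>S. k * a ^ i * a ^ j) = d * a ^ Suc e"
    and sums: "\<And>n. L * ((\<Sum>a<n. p (int a) (int n - int a)) - p 0 (int n)) = (\<Sum>(i, k)\<leftarrow>T. k * int n ^ i)"
  shows "of_int L * ((\<Sum>(i, j, k)\<leftarrow>S. of_int k * (Phi i * Phi j)) + of_int d * (fps_XD (Phi e) - Phi (Suc e)))
    = (\<Sum>(i, k)\<leftarrow>T. of_int k * Phi i)"
proof -
  define s where "s a b = (\<Sum>(i, j, k)\<leftarrow>S. k * a ^ i * b ^ j)" for a b :: int
  have rel: "fsum (\<lambda>(a, c). of_int (s (int a) (int c)) * (lam a * lam c))
      + fsum (\<lambda>a. of_int (p (int a) (int a) - s (int a) (int a)) * (lam a * lam a))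
    = fsum (\<lambda>n. of_int (\<Sum>a\<in>{1..<n}. p (int a) (int n - int a)) * lam n)"
    by (rule lambert_product_relation[OF p]; unfold s_def; rule assms)
  have "fsum (\<lambda>(a, c). of_int (s (int a) (int c)) * (lam a * lam c))
      = fsum (\<lambda>q. \<Sum>(i, j, k)\<leftarrow>S. of_int k * lam_pow2 i j q)"
  proof (rule arg_cong[where f = fsum], rule ext, clarify)
    fix a c :: nat
    show "of_int (s (int a) (int c)) * (lam a * lam c) = (\<Sum>(i, j, k)\<leftarrow>S. of_int k * lam_pow2 i j (a, c))"
      unfolding s_def by (induction S) (auto simp: lam_pow2_def lam_pow_def algebra_simps)
  qed
  also have "\<dots> = (\<Sum>(i, j, k)\<leftarrow>S. of_int k * (Phi i * Phi j))"
    using fsum_sum_list[of S "\<lambda>(i, j, k) q. of_int k * lam_pow2 i j q"]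
    by (simp add: split_def locfin_cmult locfin_lam_pow2 fsum_cmult fsum_lam_pow2)
  finally have 1: "fsum (\<lambda>(a, c). of_int (s (int a) (int c)) * (lam a * lam c)) =
      (\<Sum>(i, j, k)\<leftarrow>S. of_int k * (Phi i * Phi j))" .
  have 2: "fsum (\<lambda>a. of_int (p (int a) (int a) - s (int a) (int a)) * (lam a * lam a)) =
      of_int d * (fps_XD (Phi e) - Phi (Suc e))"
    unfolding s_def diag by (rule fsum_diag)
  have lf: "locfin (\<lambda>n. of_int (\<Sum>a\<in>{1..<n}. p (int a) (int n - int a)) * lam n)"
    by (rule locfin_cmult[OF locfin_lam])
  have "of_int L * fsum (\<lambda>n. of_int (\<Sum>a\<in>{1..<n}. p (int a) (int n - int a)) * lam n) =
      fsum (\<lambda>n. of_int L * (of_int (\<Sum>a\<in>{1..<n}. p (int a) (int n - int a)) * lam n))"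
    by (rule fsum_cmult[OF lf, symmetric])
  also have "\<dots> = fsum (\<lambda>n. \<Sum>(i, k)\<leftarrow>T. of_int k * lam_pow i n)"
  proof (rule arg_cong[where f = fsum], rule ext)
    fix n
    show "of_int L * (of_int (\<Sum>a\<in>{1..<n}. p (int a) (int n - int a)) * lam n) = (\<Sum>(i, k)\<leftarrow>T. of_int k * lam_pow i n)"
    proof (cases "n = 0")
      case True
      then show ?thesis by (simp add: lam_pow_def split_def)
    next
      case False
      then have "(\<Sum>a<n. p (int a) (int n - int a)) = p 0 (int n) + (\<Sum>a\<in>{1..<n}. p (int a) (int n - int a))"
        by (simp add: lessThan_atLeast0 sum.atLeast_Suc_lessThan)
      then have "L * (\<Sum>a\<in>{1..<n}. p (int a) (int n - int a)) = (\<Sum>(i, k)\<leftarrow>T. k * int n ^ i)"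
        using sums[of n] by simp
      then have "of_int L * (of_int (\<Sum>a\<in>{1..<n}. p (int a) (int n - int a)) * lam n) =
          of_int (\<Sum>(i, k)\<leftarrow>T. k * int n ^ i) * lam n"
        by (simp only: mult.assoc[symmetric] of_int_mult[symmetric])
      also have "\<dots> = (\<Sum>(i, k)\<leftarrow>T. of_int k * lam_pow i n)"
        by (induction T) (auto simp: lam_pow_def algebra_simps)
      finally show ?thesis .
    qed
  qed
  also have "\<dots> = (\<Sum>(i, k)\<leftarrow>T. of_int k * Phi i)"
    using fsum_sum_list[of T "\<lambda>(i, k) n. of_int k * lam_pow i n"]
    by (simp add: split_def locfin_cmult locfin_lam_pow fsum_cmult fsum_lam_pow)
  finally show ?thesis
    unfolding rel[symmetric] 1 2 .
qed

section \<open>Faulhaber's formulas and the resulting relations between divisor sum series\<close>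

lemma power_sum_step:
  fixes G :: "int \<Rightarrow> int"
  assumes "G 0 = 0" "\<And>x. G (x + 1) = G x + c * x ^ k"
  shows "c * (\<Sum>a<n. int a ^ k) = G (int n)"
proof (induction n)
  case (Suc n)
  then show ?case
    using assms(2)[of "int n"] by (simp add: distrib_left add.commute)
qed (simp add: assms)

lemma power_sum_0: "(\<Sum>a<n. int a ^ 0) = int n"
  by simp

lemma power_sum_1: "2 * (\<Sum>a<n. int a ^ 1) = int n ^ 2 - int n"
  by (rule power_sum_step[of "\<lambda>x. x ^ 2 - x"]) (simp, algebra)

lemma power_sum_2: "6 * (\<Sum>a<n. int a ^ 2) = 2 * int n ^ 3 - 3 * int n ^ 2 + int n"
  by (rule power_sum_step[of "\<lambda>x. 2 * x ^ 3 - 3 * x ^ 2 + x"]) (simp, algebra)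

lemma power_sum_3: "4 * (\<Sum>a<n. int a ^ 3) = int n ^ 4 - 2 * int n ^ 3 + int n ^ 2"
  by (rule power_sum_step[of "\<lambda>x. x ^ 4 - 2 * x ^ 3 + x ^ 2"]) (simp, algebra)

lemma power_sum_4: "30 * (\<Sum>a<n. int a ^ 4) = 6 * int n ^ 5 - 15 * int n ^ 4 + 10 * int n ^ 3 - int n"
  by (rule power_sum_step[of "\<lambda>x. 6 * x ^ 5 - 15 * x ^ 4 + 10 * x ^ 3 - x"]) (simp, algebra)

lemma power_sum_5: "12 * (\<Sum>a<n. int a ^ 5) = 2 * int n ^ 6 - 6 * int n ^ 5 + 5 * int n ^ 4 - int n ^ 2"
  by (rule power_sum_step[of "\<lambda>x. 2 * x ^ 6 - 6 * x ^ 5 + 5 * x ^ 4 - x ^ 2"]) (simp, algebra)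

lemma power_sum_6: "42 * (\<Sum>a<n. int a ^ 6) = 6 * int n ^ 7 - 21 * int n ^ 6 + 21 * int n ^ 5 - 7 * int n ^ 3 + int n"
  by (rule power_sum_step[of "\<lambda>x. 6 * x ^ 7 - 21 * x ^ 6 + 21 * x ^ 5 - 7 * x ^ 3 + x"]) (simp, algebra)

lemma power_sum_7: "24 * (\<Sum>a<n. int a ^ 7) = 3 * int n ^ 8 - 12 * int n ^ 7 + 14 * int n ^ 6 - 7 * int n ^ 4 + 2 * int n ^ 2"
  by (rule power_sum_step[of "\<lambda>x. 3 * x ^ 8 - 12 * x ^ 7 + 14 * x ^ 6 - 7 * x ^ 4 + 2 * x ^ 2"]) (simp, algebra)

lemma power_sum_8: "90 * (\<Sum>a<n. int a ^ 8) = 10 * int n ^ 9 - 45 * int n ^ 8 + 60 * int n ^ 7 - 42 * int n ^ 5 + 20 * int n ^ 3 - 3 * int n"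
  by (rule power_sum_step[of "\<lambda>x. 10 * x ^ 9 - 45 * x ^ 8 + 60 * x ^ 7 - 42 * x ^ 5 + 20 * x ^ 3 - 3 * x"]) (simp, algebra)

lemma power_sum_9: "20 * (\<Sum>a<n. int a ^ 9) = 2 * int n ^ 10 - 10 * int n ^ 9 + 15 * int n ^ 8 - 14 * int n ^ 6 + 10 * int n ^ 4 - 3 * int n ^ 2"
  by (rule power_sum_step[of "\<lambda>x. 2 * x ^ 10 - 10 * x ^ 9 + 15 * x ^ 8 - 14 * x ^ 6 + 10 * x ^ 4 - 3 * x ^ 2"]) (simp, algebra)

lemma power_sum_10: "66 * (\<Sum>a<n. int a ^ 10) = 6 * int n ^ 11 - 33 * int n ^ 10 + 55 * int n ^ 9 - 66 * int n ^ 7 + 66 * int n ^ 5 - 33 * int n ^ 3 + 5 * int n"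
  by (rule power_sum_step[of "\<lambda>x. 6 * x ^ 11 - 33 * x ^ 10 + 55 * x ^ 9 - 66 * x ^ 7 + 66 * x ^ 5 - 33 * x ^ 3 + 5 * x"]) (simp, algebra)

text \<open>Ramanujan's equation for E2 in terms of divisor sums. On a + b = n the polynomial p is
  n^2 - n a + a^2, and p(a, c) - p(a, c - a) = 2 a c.\<close>

lemma XD_Phi_1: "12 * Phi 1 ^ 2 + 6 * fps_XD (Phi 1) = 5 * Phi 3 + Phi 1"
proof -
  let ?p = "\<lambda>a b. a ^ 2 + b ^ 2 + a * b :: int"
  let ?T = "[(1, 1), (2, -6), (3, 5)]"
  have sums: "6 * ((\<Sum>a<n. ?p (int a) (int n - int a)) - ?p 0 (int n)) = (\<Sum>(i, k)\<leftarrow>?T. k * int n ^ i)" for n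
  proof -
    have "?p a (x - a) = x ^ 2 * a ^ 0 - x * a ^ 1 + a ^ 2" for a x
      by algebra
    then have "(\<Sum>a<n. ?p (int a) (int n - int a)) = int n ^ 2 * (\<Sum>a<n. int a ^ 0) - int n * (\<Sum>a<n. int a ^ 1) + (\<Sum>a<n. int a ^ 2)"
      by (simp only: sum.distrib sum_subtractf sum_distrib_left sum_negf)
    then have "6 * ((\<Sum>a<n. ?p (int a) (int n - int a)) - ?p 0 (int n)) = 6 * (int n ^ 2 * (\<Sum>a<n. int a ^ 0) - int n * (\<Sum>a<n. int a ^ 1) + (\<Sum>a<n. int a ^ 2) - int n ^ 2)"
      by simp
    also have "\<dots> = 5 * int n ^ 3 - 6 * int n ^ 2 + int n"
      unfolding power_sum_0 using power_sum_1[of n] power_sum_2[of n] by algebra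
    finally show ?thesis
      by (simp; algebra?)
  qed
  have "of_int 6 * ((\<Sum>(i, j, k)\<leftarrow>[(1, 1, 2)]. of_int k * (Phi i * Phi j)) + of_int 1 * (fps_XD (Phi 1) - Phi (Suc 1)))
    = (\<Sum>(i, k)\<leftarrow>?T. of_int k * Phi i)"
    by (rule eisenstein_relation[of ?p, OF _ _ _ _ sums]) (simp; algebra?)+
  then show ?thesis
    by (simp add: eval_nat_numeral algebra_simps)
qed

text \<open>Ramanujan's equation for E4; here s(a, c) = 4 a c^3 + 4 a^3 c.\<close>

lemma XD_Phi_3: "240 * Phi 1 * Phi 3 + 30 * fps_XD (Phi 3) = 21 * Phi 5 + 10 * Phi 3 - Phi 1"
proof -
  let ?p = "\<lambda>a b. a ^ 4 + b ^ 4 + 2 * a ^ 3 * b + 2 * a * b ^ 3 + 3 * a ^ 2 * b ^ 2 :: int"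
  let ?T = "[(1, -1), (3, 10), (4, -30), (5, 21)]"
  have sums: "30 * ((\<Sum>a<n. ?p (int a) (int n - int a)) - ?p 0 (int n)) = (\<Sum>(i, k)\<leftarrow>?T. k * int n ^ i)" for n
  proof -
    have "?p a (x - a) = x ^ 4 * a ^ 0 - 2 * x ^ 3 * a ^ 1 + 3 * x ^ 2 * a ^ 2 - 2 * x * a ^ 3 + a ^ 4" for a x
      by algebra
    then have "(\<Sum>a<n. ?p (int a) (int n - int a)) = int n ^ 4 * (\<Sum>a<n. int a ^ 0) - 2 * int n ^ 3 * (\<Sum>a<n. int a ^ 1) + 3 * int n ^ 2 * (\<Sum>a<n. int a ^ 2) - 2 * int n * (\<Sum>a<n. int a ^ 3) + (\<Sum>a<n. int a ^ 4)"
      by (simp only: sum.distrib sum_subtractf sum_distrib_left sum_negf)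
    then have "30 * ((\<Sum>a<n. ?p (int a) (int n - int a)) - ?p 0 (int n)) = 30 * (int n ^ 4 * (\<Sum>a<n. int a ^ 0) - 2 * int n ^ 3 * (\<Sum>a<n. int a ^ 1) + 3 * int n ^ 2 * (\<Sum>a<n. int a ^ 2) - 2 * int n * (\<Sum>a<n. int a ^ 3) + (\<Sum>a<n. int a ^ 4) - int n ^ 4)"
      by simp
    also have "\<dots> = 21 * int n ^ 5 - 30 * int n ^ 4 + 10 * int n ^ 3 - int n"
      unfolding power_sum_0 using power_sum_1[of n] power_sum_2[of n] power_sum_3[of n] power_sum_4[of n] by algebra
    finally show ?thesis
      by (simp; algebra?)
  qed
  have "of_int 30 * ((\<Sum>(i, j, k)\<leftarrow>[(1, 3, 4), (3, 1, 4)]. of_int k * (Phi i * Phi j)) + of_int 1 * (fps_XD (Phi 3) - Phi (Suc 3)))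
    = (\<Sum>(i, k)\<leftarrow>?T. of_int k * Phi i)"
    by (rule eisenstein_relation[of ?p, OF _ _ _ _ sums]) (simp; algebra?)+
  then show ?thesis
    by (simp add: eval_nat_numeral algebra_simps)
qed

text \<open>The identity E4^2 = E8. There is no derivative, since p(a, 0) = 0.\<close>

lemma Phi_3_squared: "120 * Phi 3 ^ 2 = Phi 7 - Phi 3"
proof -
  let ?p = "\<lambda>a b. a ^ 4 * b ^ 2 + a ^ 2 * b ^ 4 + 2 * a ^ 3 * b ^ 3 :: int"
  let ?T = "[(3, -1), (7, 1)]"
  have sums: "30 * ((\<Sum>a<n. ?p (int a) (int n - int a)) - ?p 0 (int n)) = (\<Sum>(i, k)\<leftarrow>?T. k * int n ^ i)" for n
  proof -
    have "?p a (x - a) = x ^ 4 * a ^ 2 - 2 * x ^ 3 * a ^ 3 + x ^ 2 * a ^ 4" for a x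
      by algebra
    then have "(\<Sum>a<n. ?p (int a) (int n - int a)) = int n ^ 4 * (\<Sum>a<n. int a ^ 2) - 2 * int n ^ 3 * (\<Sum>a<n. int a ^ 3) + int n ^ 2 * (\<Sum>a<n. int a ^ 4)"
      by (simp only: sum.distrib sum_subtractf sum_distrib_left sum_negf)
    then have "30 * ((\<Sum>a<n. ?p (int a) (int n - int a)) - ?p 0 (int n)) = 30 * (int n ^ 4 * (\<Sum>a<n. int a ^ 2) - 2 * int n ^ 3 * (\<Sum>a<n. int a ^ 3) + int n ^ 2 * (\<Sum>a<n. int a ^ 4))"
      by simp
    also have "\<dots> = int n ^ 7 - int n ^ 3"
      using power_sum_2[of n] power_sum_3[of n] power_sum_4[of n] by algebra
    finally show ?thesis
      by (simp; algebra?)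
  qed
  have "of_int 30 * ((\<Sum>(i, j, k)\<leftarrow>[(3, 3, 4)]. of_int k * (Phi i * Phi j)) + of_int 0 * (fps_XD (Phi 0) - Phi (Suc 0)))
    = (\<Sum>(i, k)\<leftarrow>?T. of_int k * Phi i)"
    by (rule eisenstein_relation[of ?p, OF _ _ _ _ sums]) (simp; algebra?)+
  then show ?thesis
    by (simp add: eval_nat_numeral algebra_simps)
qed

text \<open>Ramanujan's equation for E6, with \<open>Phi 7\<close> in place of E4^2.\<close>

lemma XD_Phi_5: "504 * Phi 1 * Phi 5 + 42 * fps_XD (Phi 5) = 20 * Phi 7 + 21 * Phi 5 + Phi 1"
proof -
  let ?p = "\<lambda>a b. 2 * a ^ 6 + 2 * b ^ 6 + 6 * a ^ 5 * b + 6 * a * b ^ 5 + 5 * a ^ 4 * b ^ 2 + 5 * a ^ 2 * b ^ 4 :: int"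
  let ?T = "[(1, 1), (5, 21), (6, -42), (7, 20)]"
  have sums: "21 * ((\<Sum>a<n. ?p (int a) (int n - int a)) - ?p 0 (int n)) = (\<Sum>(i, k)\<leftarrow>?T. k * int n ^ i)" for n
  proof -
    have "?p a (x - a) = 2 * x ^ 6 * a ^ 0 - 6 * x ^ 5 * a ^ 1 + 5 * x ^ 4 * a ^ 2 + 5 * x ^ 2 * a ^ 4 - 6 * x * a ^ 5 + 2 * a ^ 6" for a x
      by algebra
    then have "(\<Sum>a<n. ?p (int a) (int n - int a)) = 2 * int n ^ 6 * (\<Sum>a<n. int a ^ 0) - 6 * int n ^ 5 * (\<Sum>a<n. int a ^ 1) + 5 * int n ^ 4 * (\<Sum>a<n. int a ^ 2) + 5 * int n ^ 2 * (\<Sum>a<n. int a ^ 4) - 6 * int n * (\<Sum>a<n. int a ^ 5) + 2 * (\<Sum>a<n. int a ^ 6)"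
      by (simp only: sum.distrib sum_subtractf sum_distrib_left sum_negf)
    then have "21 * ((\<Sum>a<n. ?p (int a) (int n - int a)) - ?p 0 (int n)) = 21 * (2 * int n ^ 6 * (\<Sum>a<n. int a ^ 0) - 6 * int n ^ 5 * (\<Sum>a<n. int a ^ 1) + 5 * int n ^ 4 * (\<Sum>a<n. int a ^ 2) + 5 * int n ^ 2 * (\<Sum>a<n. int a ^ 4) - 6 * int n * (\<Sum>a<n. int a ^ 5) + 2 * (\<Sum>a<n. int a ^ 6) - 2 * int n ^ 6)"
      by simp
    also have "\<dots> = 20 * int n ^ 7 - 42 * int n ^ 6 + 21 * int n ^ 5 + int n"
      unfolding power_sum_0 using power_sum_1[of n] power_sum_2[of n] power_sum_4[of n] power_sum_5[of n] power_sum_6[of n] by algebra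
    finally show ?thesis
      by (simp; algebra?)
  qed
  have "of_int 21 * ((\<Sum>(i, j, k)\<leftarrow>[(1, 5, 12), (5, 1, 12)]. of_int k * (Phi i * Phi j)) + of_int 2 * (fps_XD (Phi 5) - Phi (Suc 5)))
    = (\<Sum>(i, k)\<leftarrow>?T. of_int k * Phi i)"
    by (rule eisenstein_relation[of ?p, OF _ _ _ _ sums]) (simp; algebra?)+
  then show ?thesis
    by (simp add: eval_nat_numeral algebra_simps)
qed

text \<open>The identity E4 E6 = E10.\<close>

lemma Phi_3_Phi_5: "5040 * Phi 3 * Phi 5 = 11 * Phi 9 - 21 * Phi 5 + 10 * Phi 3"
proof -
  let ?p = "\<lambda>a b. a ^ 6 * b ^ 2 + a ^ 2 * b ^ 6 + 3 * a ^ 5 * b ^ 3 + 3 * a ^ 3 * b ^ 5 + 4 * a ^ 4 * b ^ 4 :: int"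
  let ?T = "[(3, 10), (5, -21), (9, 11)]"
  have sums: "420 * ((\<Sum>a<n. ?p (int a) (int n - int a)) - ?p 0 (int n)) = (\<Sum>(i, k)\<leftarrow>?T. k * int n ^ i)" for n
  proof -
    have "?p a (x - a) = x ^ 6 * a ^ 2 - 3 * x ^ 5 * a ^ 3 + 4 * x ^ 4 * a ^ 4 - 3 * x ^ 3 * a ^ 5 + x ^ 2 * a ^ 6" for a x
      by algebra
    then have "(\<Sum>a<n. ?p (int a) (int n - int a)) = int n ^ 6 * (\<Sum>a<n. int a ^ 2) - 3 * int n ^ 5 * (\<Sum>a<n. int a ^ 3) + 4 * int n ^ 4 * (\<Sum>a<n. int a ^ 4) - 3 * int n ^ 3 * (\<Sum>a<n. int a ^ 5) + int n ^ 2 * (\<Sum>a<n. int a ^ 6)"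
      by (simp only: sum.distrib sum_subtractf sum_distrib_left sum_negf)
    then have "420 * ((\<Sum>a<n. ?p (int a) (int n - int a)) - ?p 0 (int n)) = 420 * (int n ^ 6 * (\<Sum>a<n. int a ^ 2) - 3 * int n ^ 5 * (\<Sum>a<n. int a ^ 3) + 4 * int n ^ 4 * (\<Sum>a<n. int a ^ 4) - 3 * int n ^ 3 * (\<Sum>a<n. int a ^ 5) + int n ^ 2 * (\<Sum>a<n. int a ^ 6))"
      by simp
    also have "\<dots> = 11 * int n ^ 9 - 21 * int n ^ 5 + 10 * int n ^ 3"
      using power_sum_2[of n] power_sum_3[of n] power_sum_4[of n] power_sum_5[of n] power_sum_6[of n] by algebra
    finally show ?thesis
      by (simp; algebra?)
  qed
  have "of_int 420 * ((\<Sum>(i, j, k)\<leftarrow>[(3, 5, 6), (5, 3, 6)]. of_int k * (Phi i * Phi j)) + of_int 0 * (fps_XD (Phi 0) - Phi (Suc 0)))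
    = (\<Sum>(i, k)\<leftarrow>?T. of_int k * Phi i)"
    by (rule eisenstein_relation[of ?p, OF _ _ _ _ sums]) (simp; algebra?)+
  then show ?thesis
    by (simp add: eval_nat_numeral algebra_simps)
qed

text \<open>The relation of weight 12 between E4 E8, E6^2 and E12; it becomes 691 E12 = 441 E4^3 +
  250 E6^2 through E8 = E4^2.\<close>

lemma Phi_3_Phi_7: "10080 * Phi 3 * Phi 7 + 12600 * Phi 5 ^ 2 = 13 * Phi 11 - 42 * Phi 7 + 50 * Phi 5 - 21 * Phi 3"
proof -
  let ?p = "\<lambda>a b. a ^ 8 * b ^ 2 + a ^ 2 * b ^ 8 + 4 * a ^ 7 * b ^ 3 + 4 * a ^ 3 * b ^ 7 + 8 * a ^ 6 * b ^ 4 + 8 * a ^ 4 * b ^ 6 + 10 * a ^ 5 * b ^ 5 :: int"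
  let ?T = "[(3, -21), (5, 50), (7, -42), (11, 13)]"
  have sums: "630 * ((\<Sum>a<n. ?p (int a) (int n - int a)) - ?p 0 (int n)) = (\<Sum>(i, k)\<leftarrow>?T. k * int n ^ i)" for n
  proof -
    have "?p a (x - a) = x ^ 8 * a ^ 2 - 4 * x ^ 7 * a ^ 3 + 8 * x ^ 6 * a ^ 4 - 10 * x ^ 5 * a ^ 5 + 8 * x ^ 4 * a ^ 6 - 4 * x ^ 3 * a ^ 7 + x ^ 2 * a ^ 8" for a x
      by algebra
    then have "(\<Sum>a<n. ?p (int a) (int n - int a)) = int n ^ 8 * (\<Sum>a<n. int a ^ 2) - 4 * int n ^ 7 * (\<Sum>a<n. int a ^ 3) + 8 * int n ^ 6 * (\<Sum>a<n. int a ^ 4) - 10 * int n ^ 5 * (\<Sum>a<n. int a ^ 5) + 8 * int n ^ 4 * (\<Sum>a<n. int a ^ 6) - 4 * int n ^ 3 * (\<Sum>a<n. int a ^ 7) + int n ^ 2 * (\<Sum>a<n. int a ^ 8)"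
      by (simp only: sum.distrib sum_subtractf sum_distrib_left sum_negf)
    then have "630 * ((\<Sum>a<n. ?p (int a) (int n - int a)) - ?p 0 (int n)) = 630 * (int n ^ 8 * (\<Sum>a<n. int a ^ 2) - 4 * int n ^ 7 * (\<Sum>a<n. int a ^ 3) + 8 * int n ^ 6 * (\<Sum>a<n. int a ^ 4) - 10 * int n ^ 5 * (\<Sum>a<n. int a ^ 5) + 8 * int n ^ 4 * (\<Sum>a<n. int a ^ 6) - 4 * int n ^ 3 * (\<Sum>a<n. int a ^ 7) + int n ^ 2 * (\<Sum>a<n. int a ^ 8))"
      by simp
    also have "\<dots> = 13 * int n ^ 11 - 42 * int n ^ 7 + 50 * int n ^ 5 - 21 * int n ^ 3"
      using power_sum_2[of n] power_sum_3[of n] power_sum_4[of n] power_sum_5[of n] power_sum_6[of n] power_sum_7[of n] power_sum_8[of n] by algebra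
    finally show ?thesis
      by (simp; algebra?)
  qed
  have "of_int 630 * ((\<Sum>(i, j, k)\<leftarrow>[(3, 7, 8), (7, 3, 8), (5, 5, 20)]. of_int k * (Phi i * Phi j)) + of_int 0 * (fps_XD (Phi 0) - Phi (Suc 0)))
    = (\<Sum>(i, k)\<leftarrow>?T. of_int k * Phi i)"
    by (rule eisenstein_relation[of ?p, OF _ _ _ _ sums]) (simp; algebra?)+
  then show ?thesis
    by (simp add: eval_nat_numeral algebra_simps)
qed

text \<open>The identity E4 E10 = E14.\<close>

lemma Phi_3_Phi_9: "2640 * Phi 3 * Phi 9 = Phi 13 - 11 * Phi 9 + 10 * Phi 3"
proof -
  let ?p = "\<lambda>a b. 2 * a ^ 10 * b ^ 2 + 2 * a ^ 2 * b ^ 10 + 10 * a ^ 9 * b ^ 3 + 10 * a ^ 3 * b ^ 9 + 15 * a ^ 8 * b ^ 4 + 15 * a ^ 4 * b ^ 8 - 14 * a ^ 6 * b ^ 6 :: int"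
  let ?T = "[(3, 10), (9, -11), (13, 1)]"
  have sums: "66 * ((\<Sum>a<n. ?p (int a) (int n - int a)) - ?p 0 (int n)) = (\<Sum>(i, k)\<leftarrow>?T. k * int n ^ i)" for n
  proof -
    have "?p a (x - a) = 2 * x ^ 10 * a ^ 2 - 10 * x ^ 9 * a ^ 3 + 15 * x ^ 8 * a ^ 4 - 14 * x ^ 6 * a ^ 6 + 15 * x ^ 4 * a ^ 8 - 10 * x ^ 3 * a ^ 9 + 2 * x ^ 2 * a ^ 10" for a x
      by algebra
    then have "(\<Sum>a<n. ?p (int a) (int n - int a)) = 2 * int n ^ 10 * (\<Sum>a<n. int a ^ 2) - 10 * int n ^ 9 * (\<Sum>a<n. int a ^ 3) + 15 * int n ^ 8 * (\<Sum>a<n. int a ^ 4) - 14 * int n ^ 6 * (\<Sum>a<n. int a ^ 6) + 15 * int n ^ 4 * (\<Sum>a<n. int a ^ 8) - 10 * int n ^ 3 * (\<Sum>a<n. int a ^ 9) + 2 * int n ^ 2 * (\<Sum>a<n. int a ^ 10)"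
      by (simp only: sum.distrib sum_subtractf sum_distrib_left sum_negf)
    then have "66 * ((\<Sum>a<n. ?p (int a) (int n - int a)) - ?p 0 (int n)) = 66 * (2 * int n ^ 10 * (\<Sum>a<n. int a ^ 2) - 10 * int n ^ 9 * (\<Sum>a<n. int a ^ 3) + 15 * int n ^ 8 * (\<Sum>a<n. int a ^ 4) - 14 * int n ^ 6 * (\<Sum>a<n. int a ^ 6) + 15 * int n ^ 4 * (\<Sum>a<n. int a ^ 8) - 10 * int n ^ 3 * (\<Sum>a<n. int a ^ 9) + 2 * int n ^ 2 * (\<Sum>a<n. int a ^ 10))"
      by simp
    also have "\<dots> = int n ^ 13 - 11 * int n ^ 9 + 10 * int n ^ 3"
      using power_sum_2[of n] power_sum_3[of n] power_sum_4[of n] power_sum_6[of n] power_sum_8[of n] power_sum_9[of n] power_sum_10[of n] by algebra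
    finally show ?thesis
      by (simp; algebra?)
  qed
  have "of_int 66 * ((\<Sum>(i, j, k)\<leftarrow>[(3, 9, 20), (9, 3, 20)]. of_int k * (Phi i * Phi j)) + of_int 0 * (fps_XD (Phi 0) - Phi (Suc 0)))
    = (\<Sum>(i, k)\<leftarrow>?T. of_int k * Phi i)"
    by (rule eisenstein_relation[of ?p, OF _ _ _ _ sums]) (simp; algebra?)+
  then show ?thesis
    by (simp add: eval_nat_numeral algebra_simps)
qed

section \<open>Ramanujan's differential equations, and moments as polynomials in divisor sum
  series\<close>

definition E2 :: "int fps" where "E2 = 1 - 24 * Phi 1"
definition E4 :: "int fps" where "E4 = 1 + 240 * Phi 3"
definition E6 :: "int fps" where "E6 = 1 - 504 * Phi 5"

lemma E4_squared: "480 * Phi 7 = E4 ^ 2 - 1"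
  using Phi_3_squared unfolding E4_def by algebra

lemma E4_E6: "264 * Phi 9 = 1 - E4 * E6"
  using Phi_3_Phi_5 unfolding E4_def E6_def by algebra

lemma E4_cubed_E6_squared: "65520 * Phi 11 = 441 * E4 ^ 3 + 250 * E6 ^ 2 - 691"
  using Phi_3_Phi_7 E4_squared unfolding E4_def E6_def by algebra

lemma E4_squared_E6: "24 * Phi 13 = 1 - E4 ^ 2 * E6"
  using Phi_3_Phi_9 E4_E6 unfolding E4_def E6_def by algebra

lemma XD_numeral_mult: "fps_XD (numeral k * f) = numeral k * fps_XD (f :: int fps)"
  using XD_of_int_mult[of "numeral k" f] by simp

lemma XD_E2: "12 * fps_XD E2 = E2 ^ 2 - E4"
proof -
  have "fps_XD E2 = - (24 * fps_XD (Phi 1))"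
    by (simp only: E2_def XD_diff XD_numeral_mult XD_1) simp
  then show ?thesis
    using XD_Phi_1 unfolding E2_def E4_def by algebra
qed

lemma XD_E4: "3 * fps_XD E4 = E2 * E4 - E6"
proof -
  have "fps_XD E4 = 240 * fps_XD (Phi 3)"
    by (simp only: E4_def fps_XD_add XD_numeral_mult XD_1) simp
  then show ?thesis
    using XD_Phi_3 unfolding E2_def E4_def E6_def by algebra
qed

lemma XD_E6: "2 * fps_XD E6 = E2 * E6 - E4 ^ 2"
proof -
  have "fps_XD E6 = - (504 * fps_XD (Phi 5))"
    by (simp only: E6_def XD_diff XD_numeral_mult XD_1) simp
  then show ?thesis
    using XD_Phi_5 Phi_3_squared unfolding E2_def E4_def E6_def by algebra
qed

text \<open>The quotient of \<open>bmoment r a\<close> by \<open>pgf ^ (2 * r)\<close>, defined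
  through the recursion of \<open>bmoment_Suc\<close>.\<close>

fun mpoly :: "nat \<Rightarrow> nat \<Rightarrow> int fps" where
  "mpoly r 0 = 1"
| "mpoly r (Suc a) = (if even a then 0 else 2 * of_nat r * (\<Sum>l\<le>a. of_nat (a choose l) * Phi l * mpoly r (a - l)))"

declare mpoly.simps(2) [simp del]

lemma mpoly_odd: "odd a \<Longrightarrow> mpoly r a = 0"
  by (cases a) (simp_all add: mpoly.simps(2))

lemma bmoment_mpoly: "bmoment r a = pgf ^ (2 * r) * mpoly r a"
proof (induction a rule: less_induct)
  case (less a)
  show ?case
  proof (cases "odd a")
    case True
    then show ?thesis by (simp add: bmoment_odd mpoly_odd)
  next
    case even: False
    show ?thesis
    proof (cases a)
      case (Suc k)
      then have "odd k" using even by simp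
      have "bmoment r a = 2 * of_nat r * (\<Sum>l\<le>k. of_nat (k choose l) * Phi l * (pgf ^ (2 * r) * mpoly r (k - l)))"
        unfolding Suc bmoment_Suc[OF \<open>odd k\<close>] using less Suc by simp
      also have "\<dots> = pgf ^ (2 * r) * mpoly r a"
        using \<open>odd k\<close> by (simp add: Suc mpoly.simps(2) sum_distrib_left mult_ac)
      finally show ?thesis .
    qed (simp add: bmoment_0)
  qed
qed

lemma sum_even_odd: "(\<Sum>l\<le>Suc (2 * k). f l) = (\<Sum>j\<le>k. f (2 * j) + f (2 * j + 1))" for f :: "nat \<Rightarrow> int fps"
  by (induction k) (simp_all add: add.assoc)

text \<open>Terms with even l carry a moment of odd order and vanish, so only \<open>Phi\<close> of
  odd index remain, which are the Eisenstein series of even weight.\<close>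

lemma mpoly_rec:
  "mpoly r (2 * Suc k) = (\<Sum>j\<le>k. of_int (2 * int r * int ((2 * k + 1) choose (2 * j + 1))) * Phi (2 * j + 1) * mpoly r (2 * (k - j)))"
proof -
  have "mpoly r (Suc (Suc (2 * k))) =
      2 * of_nat r * (\<Sum>l\<le>Suc (2 * k). of_nat (Suc (2 * k) choose l) * Phi l * mpoly r (Suc (2 * k) - l))"
    by (subst mpoly.simps(2)) simp
  also have "\<dots> = 2 * of_nat r * (\<Sum>j\<le>k. of_nat ((2 * k + 1) choose (2 * j + 1)) * Phi (2 * j + 1) * mpoly r (2 * (k - j)))"
    unfolding sum_even_odd
    by (rule arg_cong2[where f = "(*)"], simp, rule sum.cong) (simp_all add: mpoly_odd diff_mult_distrib2)
  finally show ?thesis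
    by (simp add: sum_distrib_left mult.assoc)
qed

lemma pgf_nonzero: "pgf \<noteq> 0"
proof
  assume 0: "pgf = 0"
  have "fps_nth (pgf - upart 0) 0 = 0"
    using vanish_pgf_upart[of 0] by (simp add: vanish_def)
  then show False using 0 by simp
qed

lemma crank_moment_eq: "crank_moment a n = fps_nth (pgf * mpoly 1 a) n"
proof -
  have "pgf * crank_fps a = pgf * (pgf * mpoly 1 a)"
    unfolding pgf_crank_fps bmoment_mpoly by (simp add: power2_eq_square mult_ac)
  then have "crank_fps a = pgf * mpoly 1 a" using pgf_nonzero by simp
  then show ?thesis by (simp only: crank_fps_def fps_nth_Abs_fps flip: \<open>crank_fps a = pgf * mpoly 1 a\<close>)
qed

section \<open>Computing with polynomials in the Eisenstein series modulo a prime\<close>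

type_synonym qpoly = "((nat \<times> nat \<times> nat) \<times> int) list"

definition emono :: "nat \<times> nat \<times> nat \<Rightarrow> int fps" where
  "emono = (\<lambda>(a, b, c). E2 ^ a * E4 ^ b * E6 ^ c)"

definition qval :: "qpoly \<Rightarrow> int fps" where
  "qval f = (\<Sum>(m, k)\<leftarrow>f. of_int k * emono m)"

definition fcong :: "int \<Rightarrow> int fps \<Rightarrow> int fps \<Rightarrow> bool" where
  "fcong p f g \<longleftrightarrow> of_int p dvd f - g"

lemma fcong_refl [simp]: "fcong p f f"
  by (simp add: fcong_def)

lemma fcong_sym: "fcong p f g \<Longrightarrow> fcong p g f"
  unfolding fcong_def by (metis dvd_minus_iff minus_diff_eq)

lemma fcong_trans [trans]: "fcong p f g \<Longrightarrow> fcong p g h \<Longrightarrow> fcong p f h"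
  using dvd_add[of "of_int p" "f - g" "g - h"] by (simp add: fcong_def)

lemma fcong_add: "fcong p f g \<Longrightarrow> fcong p f' g' \<Longrightarrow> fcong p (f + f') (g + g')"
  unfolding fcong_def by (simp only: add_diff_add dvd_add)

lemma fcong_mult: "fcong p f g \<Longrightarrow> fcong p f' g' \<Longrightarrow> fcong p (f * f') (g * g')"
  unfolding fcong_def mult_diff_mult by (intro dvd_add) (simp_all add: dvd_mult dvd_mult2)

lemma fcong_power: "fcong p f g \<Longrightarrow> fcong p (f ^ k) (g ^ k)"
  by (induction k) (simp_all add: fcong_mult)

lemma fcong_of_int: "[c = d] (mod p) \<Longrightarrow> fcong p (of_int c) (of_int d)"
  unfolding fcong_def cong_iff_dvd_diff by (metis dvd_def of_int_diff of_int_mult)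

lemma fcong_XD: "fcong p f g \<Longrightarrow> fcong p (fps_XD f) (fps_XD g)"
  unfolding fcong_def XD_diff[symmetric] by (metis XD_of_int_mult dvd_def)

lemma fcong_nth: "fcong p f 0 \<Longrightarrow> p dvd fps_nth f n"
  unfolding fcong_def by (auto simp: dvd_def fps_mult_of_int_nth)

lemma qval_Nil [simp]: "qval [] = 0"
  by (simp add: qval_def)

lemma qval_Cons [simp]: "qval ((m, k) # f) = of_int k * emono m + qval f"
  by (simp add: qval_def)

lemma qval_append [simp]: "qval (f @ g) = qval f + qval g"
  by (simp add: qval_def)

section \<open>Arithmetic and derivation on lists of monomials\<close>

fun add_term :: "int \<Rightarrow> nat \<times> nat \<times> nat \<Rightarrow> int \<Rightarrow> qpoly \<Rightarrow> qpoly" where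
  "add_term p m k [] = [(m, k mod p)]"
| "add_term p m k ((m', k') # f) = (if m = m' then (m, (k + k') mod p) # f else (m', k') # add_term p m k f)"

primrec normalize :: "int \<Rightarrow> qpoly \<Rightarrow> qpoly" where
  "normalize p [] = []"
| "normalize p (t # f) = add_term p (fst t) (snd t) (normalize p f)"

definition qscale :: "int \<Rightarrow> qpoly \<Rightarrow> qpoly" where
  "qscale c = map (\<lambda>(m, k). (m, c * k))"

definition qmult :: "qpoly \<Rightarrow> qpoly \<Rightarrow> qpoly" where
  "qmult f g = concat (map (\<lambda>((a, b, c), k). map (\<lambda>((a', b', c'), k'). ((a + a', b + b', c + c'), k * k')) g) f)"

text \<open>The operator f -> 24 q d/dq (\<open>pgf\<close> f) / \<open>pgf\<close> on monomials; 24
  clears the denominators in Ramanujan's equations, and the summand -1 + E2 with opposite sign comes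
  from 24 q d/dq \<open>pgf\<close> = (1 - E2) \<open>pgf\<close>. Where an exponent is truncated at
  0, its coefficient is 0.\<close>

definition qderiv :: "qpoly \<Rightarrow> qpoly" where
  "qderiv f = concat (map (\<lambda>((a, b, c), k).
    [((a, b, c), k), ((a + 1, b, c), k * (2 * int a + 8 * int b + 12 * int c - 1)),
     ((a - 1, b + 1, c), k * (- 2 * int a)), ((a, b - 1, c + 1), k * (- 8 * int b)),
     ((a, b + 2, c - 1), k * (- 12 * int c))]) f)"

lemma qval_add_term: "fcong p (qval (add_term p m k f)) (of_int k * emono m + qval f)"
proof (induction f)
  case Nil
  have "fcong p (of_int (k mod p) * emono m) (of_int k * emono m)"
    by (intro fcong_mult fcong_of_int fcong_refl) (simp add: cong_def)
  then show ?case by simp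
next
  case (Cons t f)
  obtain m' k' where t: "t = (m', k')" by (cases t)
  show ?case
  proof (cases "m = m'")
    case True
    have "fcong p (of_int ((k + k') mod p) * emono m + qval f) (of_int (k + k') * emono m + qval f)"
      by (intro fcong_add fcong_mult fcong_of_int fcong_refl) (simp add: cong_def)
    then show ?thesis by (simp add: t True algebra_simps)
  next
    case False
    have "fcong p (of_int k' * emono m' + qval (add_term p m k f)) (of_int k' * emono m' + (of_int k * emono m + qval f))"
      by (intro fcong_add fcong_refl Cons)
    then show ?thesis using False by (simp add: t add_ac)
  qed
qed

lemma qval_normalize: "fcong p (qval (normalize p f)) (qval f)"
proof (induction f)
  case (Cons t f)
  have "fcong p (qval (normalize p (t # f))) (of_int (snd t) * emono (fst t) + qval (normalize p f))"
    by (simp add: qval_add_term)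
  also have "fcong p \<dots> (of_int (snd t) * emono (fst t) + qval f)"
    by (intro fcong_add fcong_refl Cons)
  finally show ?case by (cases t) simp
qed simp

lemma qval_scale: "qval (qscale c f) = of_int c * qval f"
  by (induction f) (auto simp: qscale_def algebra_simps)

lemma qval_mult: "qval (qmult f g) = qval f * qval g"
proof (induction f)
  case (Cons t f)
  obtain a b c k where t: "t = ((a, b, c), k)" by (cases t) auto
  have "qval (map (\<lambda>((a', b', c'), k'). ((a + a', b + b', c + c'), k * k')) g) = of_int k * emono (a, b, c) * qval g"
    by (induction g) (auto simp: emono_def power_add algebra_simps)
  then show ?case
    using Cons by (simp add: qmult_def t algebra_simps)
qed (simp add: qmult_def)

lemma XD_pgf_emono:
  "24 * fps_XD (pgf * emono (a, b, c)) = pgf * (emono (a, b, c)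
    + of_int (2 * int a + 8 * int b + 12 * int c - 1) * emono (a + 1, b, c)
    + of_int (- 2 * int a) * emono (a - 1, b + 1, c) + of_int (- 8 * int b) * emono (a, b - 1, c + 1)
    + of_int (- 12 * int c) * emono (a, b + 2, c - 1))"
proof -
  have p: "24 * fps_XD pgf = (1 - E2) * pgf"
    by (simp add: XD_pgf E2_def)
  have 2: "24 * fps_XD (E2 ^ a) = of_nat (2 * a) * E2 ^ (a - 1) * (E2 ^ 2 - E4)"
    unfolding XD_power XD_E2[symmetric] by simp
  have 4: "24 * fps_XD (E4 ^ b) = of_nat (8 * b) * E4 ^ (b - 1) * (E2 * E4 - E6)"
    unfolding XD_power XD_E4[symmetric] by simp
  have 6: "24 * fps_XD (E6 ^ c) = of_nat (12 * c) * E6 ^ (c - 1) * (E2 * E6 - E4 ^ 2)"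
    unfolding XD_power XD_E6[symmetric] by simp
  have "24 * fps_XD (pgf * emono (a, b, c)) = (24 * fps_XD pgf) * E2 ^ a * E4 ^ b * E6 ^ c
      + pgf * (24 * fps_XD (E2 ^ a)) * E4 ^ b * E6 ^ c + pgf * E2 ^ a * (24 * fps_XD (E4 ^ b)) * E6 ^ c
      + pgf * E2 ^ a * E4 ^ b * (24 * fps_XD (E6 ^ c))"
    by (simp add: emono_def XD_mult algebra_simps)
  then show ?thesis
    unfolding p 2 4 6 emono_def
    by (cases a; cases b; cases c) (simp_all add: algebra_simps power2_eq_square)
qed

lemma qval_deriv: "24 * fps_XD (pgf * qval f) = pgf * qval (qderiv f)"
proof (induction f)
  case Nil
  show ?case by (simp add: qderiv_def fps_XD_def)
next
  case (Cons t f)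
  obtain a b c k where t: "t = ((a, b, c), k)" by (cases t) auto
  have "24 * fps_XD (pgf * qval (t # f)) = of_int k * (24 * fps_XD (pgf * emono (a, b, c))) + 24 * fps_XD (pgf * qval f)"
    by (simp add: t distrib_left XD_of_int_mult mult.left_commute[of pgf] mult.left_commute[of 24])
  also have "\<dots> = pgf * qval (qderiv (t # f))"
    unfolding XD_pgf_emono Cons by (simp add: qderiv_def t algebra_simps)
  finally show ?case .
qed

text \<open>Entry \<open>j\<close> contains \<open>s\<close> and a representation of \<open>s * Phi (2 * j + 1)\<close>.\<close>

definition phi_table :: "(int \<times> qpoly) list" where
  "phi_table =
    [(24, [((0, 0, 0), 1), ((1, 0, 0), - 1)]),
     (240, [((0, 1, 0), 1), ((0, 0, 0), - 1)]),
     (504, [((0, 0, 0), 1), ((0, 0, 1), - 1)]),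
     (480, [((0, 2, 0), 1), ((0, 0, 0), - 1)]),
     (264, [((0, 0, 0), 1), ((0, 1, 1), - 1)]),
     (65520, [((0, 3, 0), 441), ((0, 0, 2), 250), ((0, 0, 0), - 691)]),
     (24, [((0, 0, 0), 1), ((0, 2, 1), - 1)])]"

section \<open>The moments modulo p by recursion\<close>

definition binomial_table :: "int list list" where
  "binomial_table = [[1], [3, 1], [5, 10, 1], [7, 35, 21, 1], [9, 84, 126, 36, 1],
    [11, 165, 462, 330, 55, 1], [13, 286, 1287, 1716, 715, 78, 1]]"

lemma less_7_cases: "j < 7 \<Longrightarrow> j \<in> {0, 1, 2, 3, 4, 5, 6 :: nat}"
  by auto

lemma phi_table: "j < 7 \<Longrightarrow> of_int (fst (phi_table ! j)) * Phi (2 * j + 1) = qval (snd (phi_table ! j))"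
  using less_7_cases[of j] E4_squared E4_E6 E4_cubed_E6_squared E4_squared_E6
  by (auto simp: phi_table_def emono_def E2_def E4_def E6_def)

lemma binomial_table: "k < 7 \<Longrightarrow> j \<le> k \<Longrightarrow> binomial_table ! k ! j = int ((2 * k + 1) choose (2 * j + 1))"
  using less_7_cases[of k] less_7_cases[of j]
  by (auto simp: binomial_table_def binomial_fact' fact_numeral)

text \<open>The table is kept with the highest moment first, so that entry j is the moment of order
  2 (k - j) which \<open>mpoly_rec\<close> pairs with \<open>Phi (2 * j + 1)\<close>. The scale of
  \<open>phi_table\<close> is divided out by its inverse modulo p.\<close>

definition moment_step :: "int \<Rightarrow> int \<Rightarrow> int list \<Rightarrow> nat \<Rightarrow> qpoly list \<Rightarrow> qpoly list" where
  "moment_step p r invs k Ms = normalize p (concat (map (\<lambda>j.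
     qmult (qscale (2 * r * (binomial_table ! k ! j) * (invs ! j) mod p) (snd (phi_table ! j))) (Ms ! j)) [0..<Suc k])) # Ms"

primrec moment_table :: "int \<Rightarrow> int \<Rightarrow> int list \<Rightarrow> nat \<Rightarrow> qpoly list" where
  "moment_table p r invs 0 = [[((0, 0, 0), 1)]]"
| "moment_table p r invs (Suc k) = moment_step p r invs k (moment_table p r invs k)"

text \<open>The list may be shorter than \<open>phi_table\<close>, because some scales are not
  invertible: 504 modulo 7 and 264 modulo 11. The moments used for these moduli stop before
  them.\<close>

definition valid_inverses :: "int \<Rightarrow> int list \<Rightarrow> bool" where
  "valid_inverses p invs \<longleftrightarrow> length invs \<le> 7 \<and> invs \<noteq> [] \<and> list_all (\<lambda>(t, i). (fst t * i - 1) mod p = 0) (zip phi_table invs)"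

lemma valid_inversesD:
  assumes "valid_inverses p invs" "j < length invs"
  shows "[fst (phi_table ! j) * invs ! j = 1] (mod p)"
proof -
  have "j < length (zip phi_table invs)" and "length invs \<le> 7"
    using assms by (auto simp: valid_inverses_def phi_table_def)
  then show ?thesis
    using assms by (auto simp: valid_inverses_def list_all_length cong_iff_dvd_diff split_def dvd_eq_mod_eq_0)
qed

lemma fcong_sum_list:
  "(\<And>x. x \<in> set xs \<Longrightarrow> fcong p (f x) (g x)) \<Longrightarrow> fcong p (\<Sum>x\<leftarrow>xs. f x) (\<Sum>x\<leftarrow>xs. g x)"
  by (induction xs) (simp_all add: fcong_add)

lemma qval_concat: "qval (concat fs) = (\<Sum>f\<leftarrow>fs. qval f)"
  by (induction fs) simp_all

lemma moment_table:
  assumes inv: "valid_inverses p invs" and "k \<le> length invs"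
  shows "length (moment_table p (int r) invs k) = Suc k \<and>
    (\<forall>j\<le>k. fcong p (qval (moment_table p (int r) invs k ! j)) (mpoly r (2 * (k - j))))"
  using assms(2)
proof (induction k)
  case 0
  show ?case by (simp add: emono_def)
next
  case (Suc k)
  let ?M = "moment_table p (int r) invs k"
  let ?t = "\<lambda>j. 2 * int r * (binomial_table ! k ! j) * (invs ! j)"
  have len: "length ?M = Suc k" and IH: "j \<le> k \<Longrightarrow> fcong p (qval (?M ! j)) (mpoly r (2 * (k - j)))" for j
    using Suc by auto
  have k7: "k < 7" using Suc inv by (simp add: valid_inverses_def)
  let ?new = "concat (map (\<lambda>j. qmult (qscale (?t j mod p) (snd (phi_table ! j))) (?M ! j)) [0..<Suc k])"
  have "qval ?new = (\<Sum>j\<leftarrow>[0..<Suc k]. of_int (?t j mod p) * qval (snd (phi_table ! j)) * qval (?M ! j))"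
    unfolding qval_concat map_map comp_def qval_scale qval_mult ..
  moreover have "fcong p \<dots> (\<Sum>j\<leftarrow>[0..<Suc k]. of_int (2 * int r * int ((2 * k + 1) choose (2 * j + 1))) * Phi (2 * j + 1) * mpoly r (2 * (k - j)))"
  proof (rule fcong_sum_list)
    fix j assume "j \<in> set [0..<Suc k]"
    then have j: "j \<le> k" by auto
    define B where "B = 2 * int r * int ((2 * k + 1) choose (2 * j + 1))"
    have "fcong p (of_int (?t j mod p) * qval (snd (phi_table ! j)) * qval (?M ! j))
        (of_int (?t j) * qval (snd (phi_table ! j)) * qval (?M ! j))"
      by (intro fcong_mult fcong_of_int fcong_refl) (simp add: cong_def)
    also have "of_int (?t j) * qval (snd (phi_table ! j)) * qval (?M ! j) =
        of_int (fst (phi_table ! j) * invs ! j) * (of_int B * Phi (2 * j + 1) * qval (?M ! j))"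
      using j k7 by (simp add: binomial_table phi_table[symmetric] B_def)
    also have "fcong p \<dots> (of_int 1 * (of_int B * Phi (2 * j + 1) * mpoly r (2 * (k - j))))"
      using j Suc.prems by (intro fcong_mult fcong_of_int fcong_refl IH valid_inversesD[OF inv]) auto
    finally show "fcong p (of_int (?t j mod p) * qval (snd (phi_table ! j)) * qval (?M ! j))
        (of_int (2 * int r * int ((2 * k + 1) choose (2 * j + 1))) * Phi (2 * j + 1) * mpoly r (2 * (k - j)))"
      by (simp add: B_def)
  qed
  moreover have "(\<Sum>j\<leftarrow>[0..<Suc k]. of_int (2 * int r * int ((2 * k + 1) choose (2 * j + 1))) * Phi (2 * j + 1) * mpoly r (2 * (k - j)))
      = mpoly r (2 * Suc k)"
    unfolding mpoly_rec by (subst interv_sum_list_conv_sum_set_nat) (simp only: set_upt atLeast0LessThan lessThan_Suc_atMost)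
  ultimately have "fcong p (qval ?new) (mpoly r (2 * Suc k))"
    by (simp only:)
  then have first: "fcong p (qval (moment_table p (int r) invs (Suc k) ! 0)) (mpoly r (2 * Suc k))"
    by (simp only: moment_table.simps moment_step_def nth_Cons_0 fcong_trans[OF qval_normalize])
  have rest: "fcong p (qval (moment_table p (int r) invs (Suc k) ! j)) (mpoly r (2 * (Suc k - j)))"
    if "0 < j" "j \<le> Suc k" for j
    using IH[of "j - 1"] that by (cases j) (auto simp: moment_step_def)
  show ?case
  proof (intro conjI allI impI)
    show "length (moment_table p (int r) invs (Suc k)) = Suc (Suc k)"
      using len by (simp add: moment_step_def)
    fix j assume "j \<le> Suc k"
    then show "fcong p (qval (moment_table p (int r) invs (Suc k) ! j)) (mpoly r (2 * (Suc k - j)))"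
      using first rest[of j] by (cases "j = 0") (simp_all del: moment_table.simps)
  qed
qed

text \<open>The rows encode the polynomial in \<open>n\<close>, with row \<open>i\<close> listing the coefficients of \<open>n\<^sup>i\<close>:
  the triple \<open>(r, k, c)\<close> stands for \<open>c\<close> times the normalised moment \<open>mpoly r (2 * k)\<close>.\<close>

definition row_val :: "nat \<Rightarrow> (nat \<times> nat \<times> int) list \<Rightarrow> int" where
  "row_val n row = (\<Sum>(r, k, c)\<leftarrow>row. c * fps_nth (pgf * mpoly r (2 * k)) n)"

primrec rows_val :: "nat \<Rightarrow> (nat \<times> nat \<times> int) list list \<Rightarrow> int" where
  "rows_val n [] = 0"
| "rows_val n (row # rows) = row_val n row + int n * rows_val n rows"

definition row_poly :: "qpoly list \<Rightarrow> qpoly list \<Rightarrow> (nat \<times> nat \<times> int) list \<Rightarrow> qpoly" where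
  "row_poly M1 M3 row = concat (map (\<lambda>(r, k, c).
     qscale c (if r = 1 then rev M1 ! k else rev M3 ! k)) row)"

text \<open>Horner's scheme in n, where multiplication by n is q d/dq; i is an inverse of 24 modulo
  p and undoes the scaling of \<open>qderiv\<close>.\<close>

primrec horner :: "int \<Rightarrow> int \<Rightarrow> qpoly list \<Rightarrow> qpoly" where
  "horner p i [] = []"
| "horner p i (f # fs) = normalize p (f @ qscale i (qderiv (horner p i fs)))"

definition row_ok :: "nat \<Rightarrow> nat \<Rightarrow> (nat \<times> nat \<times> int) list \<Rightarrow> bool" where
  "row_ok k1 k3 = list_all (\<lambda>(r, k, c). r = 1 \<and> k \<le> k1 \<or> r = 3 \<and> k \<le> k3)"

definition vanishes_mod :: "int \<Rightarrow> (nat \<times> nat \<times> nat \<Rightarrow> nat \<times> nat \<times> nat) \<Rightarrow> qpoly \<Rightarrow> bool" where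
  "vanishes_mod p red f \<longleftrightarrow> list_all (\<lambda>t. snd t mod p = 0) (normalize p (map (\<lambda>(m, k). (red m, k)) f))"

definition rows_check :: "int \<Rightarrow> int list \<Rightarrow> (nat \<times> nat \<times> nat \<Rightarrow> nat \<times> nat \<times> nat) \<Rightarrow> nat \<Rightarrow> nat
    \<Rightarrow> (nat \<times> nat \<times> int) list list \<Rightarrow> bool" where
  "rows_check p invs red k1 k3 rows \<longleftrightarrow> valid_inverses p invs \<and> k1 \<le> length invs \<and> k3 \<le> length invs
     \<and> list_all (row_ok k1 k3) rows
     \<and> vanishes_mod p red (horner p (hd invs)
         (map (row_poly (moment_table p 1 invs k1) (moment_table p 3 invs k3)) rows))"

lemma vanishes_modD:
  assumes "vanishes_mod p red f" and red: "\<And>m. fcong p (emono (red m)) (emono m)"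
  shows "fcong p (qval f) 0"
proof -
  have z: "fcong p (qval g) 0" if "list_all (\<lambda>t. snd t mod p = 0) g" for g
    using that
  proof (induction g)
    case (Cons t g)
    obtain m k where t: "t = (m, k)" by (cases t)
    have "fcong p (of_int k * emono m + qval g) (of_int 0 * emono m + 0)"
      using Cons by (intro fcong_add fcong_mult fcong_of_int fcong_refl) (auto simp: t cong_def)
    then show ?case by (simp add: t)
  qed simp
  have r: "fcong p (qval f) (qval (map (\<lambda>(m, k). (red m, k)) f))"
  proof (induction f)
    case (Cons t f)
    obtain m k where t: "t = (m, k)" by (cases t)
    have "fcong p (of_int k * emono m + qval f) (of_int k * emono (red m) + qval (map (\<lambda>(m, k). (red m, k)) f))"
      by (intro fcong_add fcong_mult fcong_refl Cons fcong_sym[OF red])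
    then show ?case by (simp add: t)
  qed simp
  show ?thesis
    using fcong_trans[OF r fcong_trans[OF fcong_sym[OF qval_normalize] z]] assms(1)
    by (simp add: vanishes_mod_def)
qed

text \<open>F runs the same Horner scheme on power series. By induction it is congruent to
  \<open>pgf\<close> times the computed polynomial, so a polynomial that vanishes modulo p makes
  every coefficient divisible by p.\<close>

lemma rows_check_sound:
  assumes check: "rows_check p invs red k1 k3 rows" and red: "\<And>m. fcong p (emono (red m)) (emono m)"
  shows "p dvd rows_val n rows"
proof -
  define row_fps :: "(nat \<times> nat \<times> int) list \<Rightarrow> int fps"
    where "row_fps row = (\<Sum>(r, k, c)\<leftarrow>row. of_int c * (pgf * mpoly r (2 * k)))" for row
  define F where "F = (\<lambda>rows. foldr (\<lambda>row f. row_fps row + fps_XD f) rows 0)"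
  define M1 where "M1 = moment_table p 1 invs k1"
  define M3 where "M3 = moment_table p 3 invs k3"
  have inv: "valid_inverses p invs" and k: "k1 \<le> length invs" "k3 \<le> length invs"
    and ok: "list_all (row_ok k1 k3) rows"
    and van: "vanishes_mod p red (horner p (hd invs) (map (row_poly M1 M3) rows))"
    using check by (auto simp: rows_check_def M1_def M3_def)
  have M: "fcong p (qval (rev M1 ! j)) (mpoly 1 (2 * j))" if "j \<le> k1" for j
    using moment_table[OF inv k(1), of 1, THEN conjunct1] that
      moment_table[OF inv k(1), of 1, THEN conjunct2, rule_format, of "k1 - j"] by (simp add: M1_def rev_nth)
  have M': "fcong p (qval (rev M3 ! j)) (mpoly 3 (2 * j))" if "j \<le> k3" for j
    using moment_table[OF inv k(2), of 3, THEN conjunct1] that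
      moment_table[OF inv k(2), of 3, THEN conjunct2, rule_format, of "k3 - j"] by (simp add: M3_def rev_nth)
  have row: "fcong p (row_fps row) (pgf * qval (row_poly M1 M3 row))" if "row_ok k1 k3 row" for row
    using that
  proof (induction row)
    case (Cons t row)
    obtain r j c where t: "t = (r, j, c)" by (cases t)
    have "fcong p (mpoly r (2 * j)) (qval (if r = 1 then rev M1 ! j else rev M3 ! j))"
      using Cons.prems M[of j] M'[of j] by (auto simp: row_ok_def t intro: fcong_sym)
    then have "fcong p (of_int c * (pgf * mpoly r (2 * j)) + row_fps row)
        (of_int c * (pgf * qval (if r = 1 then rev M1 ! j else rev M3 ! j)) + pgf * qval (row_poly M1 M3 row))"
      using Cons by (intro fcong_add fcong_mult fcong_refl) (auto simp: row_ok_def)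
    then show ?case
      by (simp add: t row_fps_def row_poly_def qval_scale algebra_simps)
  qed (simp add: row_fps_def row_poly_def)
  have i24: "[24 * hd invs = 1] (mod p)"
    using valid_inversesD[OF inv, of 0] inv by (cases invs) (auto simp: valid_inverses_def phi_table_def)
  have "fcong p (F rows) (pgf * qval (horner p (hd invs) (map (row_poly M1 M3) rows)))"
    using ok
  proof (induction rows)
    case (Cons row rows)
    define h where "h = horner p (hd invs) (map (row_poly M1 M3) rows)"
    have "fcong p (fps_XD (F rows)) (of_int (24 * hd invs) * fps_XD (pgf * qval h))"
      using fcong_mult[OF fcong_sym[OF fcong_of_int[OF i24]] fcong_XD[of p "F rows" "pgf * qval h"]] Cons
      by (simp add: h_def)
    also have "\<dots> = pgf * qval (qscale (hd invs) (qderiv h))"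
      unfolding qval_scale by (simp add: mult.left_commute mult.commute[of 24] mult.assoc flip: qval_deriv)
    finally have "fcong p (F (row # rows)) (pgf * qval (row_poly M1 M3 row @ qscale (hd invs) (qderiv h)))"
      using row[of row] Cons.prems by (simp add: F_def distrib_left fcong_add)
    also have "fcong p \<dots> (pgf * qval (normalize p (row_poly M1 M3 row @ qscale (hd invs) (qderiv h))))"
      by (intro fcong_mult fcong_refl fcong_sym[OF qval_normalize])
    finally show ?case by (simp add: h_def)
  qed (simp add: F_def)
  also have "fcong p \<dots> (pgf * 0)"
    by (intro fcong_mult fcong_refl vanishes_modD[OF van red])
  finally have "fcong p (F rows) 0" by simp
  moreover have "fps_nth (row_fps row) n = row_val n row" for row
    by (induction row) (auto simp: row_fps_def row_val_def fps_mult_of_int_nth)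
  then have "fps_nth (F rows) n = rows_val n rows"
    by (induction rows) (simp_all add: F_def)
  ultimately show ?thesis
    using fcong_nth by metis
qed

lemma emono_mod_7: "fcong 7 (emono ((\<lambda>(a, b, c). (a, b, 0)) m)) (emono m)"
proof -
  have "E6 - 1 = of_int 7 * (- 72 * Phi 5)"
    by (simp add: E6_def)
  then have "fcong 7 1 (E6 ^ c)" for c
    using fcong_power[of 7 1 E6 c] by (metis dvd_triv_left fcong_def fcong_sym power_one)
  then have "fcong 7 (E2 ^ a * E4 ^ b * 1) (E2 ^ a * E4 ^ b * E6 ^ c)" for a b c
    by (intro fcong_mult fcong_refl)
  then show ?thesis
    by (cases m) (simp add: emono_def)
qed

text \<open>E4 E6 = E10 is 1 modulo 11 because 264 = 11 * 24; the map cancels as many pairs E4 E6 as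
  possible.\<close>

lemma emono_mod_11:
  "fcong 11 (emono ((\<lambda>(a, b, c). (a, b - min b c, c - min b c)) m)) (emono m)"
proof -
  obtain a b c where m: "m = (a, b, c)" by (cases m)
  define d where "d = min b c"
  obtain b' c' where bc: "b = b' + d" "c = c' + d"
    by (metis d_def le_add_diff_inverse2 min.cobounded1 min.cobounded2)
  have "E4 * E6 - 1 = of_int 11 * (- 24 * Phi 9)"
    using E4_E6 by simp
  then have 1: "fcong 11 1 ((E4 * E6) ^ d)"
    using fcong_power[of 11 1 "E4 * E6" d] by (metis dvd_triv_left fcong_def fcong_sym power_one)
  have "fcong 11 (1 * emono (a, b', c')) ((E4 * E6) ^ d * emono (a, b', c'))"
    by (intro fcong_mult fcong_refl 1)
  moreover have "(E4 * E6) ^ d * emono (a, b', c') = emono m"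
    by (simp add: m bc emono_def power_add power_mult_distrib mult_ac)
  moreover have "b - min b c = b'" "c - min b c = c'"
    unfolding d_def[symmetric] using bc by simp_all
  ultimately show ?thesis by (simp add: m)
qed

section \<open>Rank moments\<close>

definition rank_pow :: "nat \<Rightarrow> int \<Rightarrow> int fps" where
  "rank_pow i m = of_int (m ^ i) * rank_row m"

lemma locfin_rank_pow: "locfin (rank_pow i)"
  unfolding rank_pow_def by (rule locfin_cmult[OF locfin_rank_row])

lemma fsum_rank_pow: "fsum (rank_pow i) = rank_fps i"
  by (simp only: rank_fps_eq rank_pow_def[abs_def])

text \<open>The zeroth moment counts all partitions. As \<open>mpoly r 0\<close> is 1, it can be
  entered in the rows below as a crank moment of order 0.\<close>

lemma rank_moment_0: "rank_moment 0 n = fps_nth (pgf * mpoly r 0) n"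
proof -
  have "pgf = gf (\<Union>m. {p \<in> positive_parts. rk p = m})"
    unfolding gf_positive_parts[symmetric] by (rule arg_cong[where f = gf]) auto
  also have "\<dots> = fsum (\<lambda>m. gf {p \<in> positive_parts. rk p = m})"
    by (rule gf_UN) auto
  finally have "rank_fps 0 = pgf"
    by (simp add: rank_fps_eq rank_count_gf)
  then show ?thesis
    by (simp add: rank_fps_def flip: \<open>rank_fps 0 = pgf\<close>)
qed

lemma fsum_rank_list:
  assumes "\<And>m. f m = (\<Sum>(i, c)\<leftarrow>cs. c * m ^ i)"
  shows "fps_nth (fsum (\<lambda>m. of_int (f m) * rank_row m)) n = (\<Sum>(i, c)\<leftarrow>cs. c * rank_moment i n)"
proof -
  have "of_int (f m) * rank_row m = (\<Sum>(i, c)\<leftarrow>cs. of_int c * rank_pow i m)" for m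
    unfolding assms by (induction cs) (auto simp: rank_pow_def algebra_simps)
  then have "fsum (\<lambda>m. of_int (f m) * rank_row m) = (\<Sum>(i, c)\<leftarrow>cs. of_int c * rank_fps i)"
    using fsum_sum_list[of cs "\<lambda>(i, c) m. of_int c * rank_pow i m"]
    by (simp add: split_def locfin_cmult locfin_rank_pow fsum_cmult fsum_rank_pow)
  also have "fps_nth \<dots> n = (\<Sum>(i, c)\<leftarrow>cs. c * rank_moment i n)"
    by (induction cs) (auto simp: rank_fps_def fps_mult_of_int_nth)
  finally show ?thesis .
qed

text \<open>The weight in W is m (m^2 - 1) times the second central difference of m^(a-1), so its
  leading term is (a - 1)(a - 2) m^a. For a = 4, 6, ... the relation thus ties the moment of order a
  to lower ones, whereas for a = 2 the weight is 0.\<close>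

lemma rank_moment_relation:
  assumes D: "\<And>m :: int. 6 * ((m - 1) ^ a - 2 * m ^ a + (m + 1) ^ a) = (\<Sum>(i, c)\<leftarrow>ds. c * m ^ i)"
    and W: "\<And>m :: int. (m - 1) ^ a * (m * (m + 1)) + m ^ a * ((m + 1) * (2 - 2 * m)) + (m + 1) ^ a * (m * (m - 1))
      = (\<Sum>(i, c)\<leftarrow>ws. c * m ^ i)"
  shows "int n * (\<Sum>(i, c)\<leftarrow>ds. c * rank_moment i n) + (\<Sum>(i, c)\<leftarrow>ws. c * rank_moment i n) =
    2 * fps_nth (pgf * mpoly 3 a) n"
proof -
  define f where "f m = 6 * ((m - 1) ^ a - 2 * m ^ a + (m + 1) ^ a)" for m :: int
  define g where "g m = (m - 1) ^ a * (m * (m + 1)) + m ^ a * ((m + 1) * (2 - 2 * m)) + (m + 1) ^ a * (m * (m - 1))" for m :: int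
  let ?l = "fps_XD (fsum (\<lambda>m. of_int (f m) * rank_row m)) + fsum (\<lambda>m. of_int (g m) * rank_row m)"
  have "pgf ^ 5 * ?l = 2 * (pgf ^ 6 * mpoly 3 a)"
    using rank_moment_relation_raw[of a] by (simp add: bmoment_mpoly f_def g_def)
  also have "pgf ^ 6 = pgf ^ 5 * pgf"
    by (simp add: eval_nat_numeral)
  finally have "pgf ^ 5 * ?l = pgf ^ 5 * (of_int 2 * (pgf * mpoly 3 a))"
    by (simp add: mult_ac)
  then have l: "?l = of_int 2 * (pgf * mpoly 3 a)"
    using pgf_nonzero by simp
  have "fps_nth ?l n = int n * (\<Sum>(i, c)\<leftarrow>ds. c * rank_moment i n) + (\<Sum>(i, c)\<leftarrow>ws. c * rank_moment i n)"
    using fsum_rank_list[of f ds n] fsum_rank_list[of g ws n] D W by (simp add: f_def g_def)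
  then show ?thesis
    unfolding l fps_mult_of_int_nth by simp
qed

lemma rank_relation_4:
  "int n * (72 * rank_moment 2 n + 12 * rank_moment 0 n) + (6 * rank_moment 4 n - 6 * rank_moment 2 n) = 2 * fps_nth (pgf * mpoly 3 4) n"
proof -
  have "int n * (\<Sum>(i, c)\<leftarrow>[(2, 72), (0, 12)]. c * rank_moment i n)
      + (\<Sum>(i, c)\<leftarrow>[(4, 6), (2, -6)]. c * rank_moment i n) = 2 * fps_nth (pgf * mpoly 3 4) n"
    by (rule rank_moment_relation) (simp, algebra)+
  then show ?thesis by (simp add: algebra_simps)
qed

lemma rank_relation_6:
  "int n * (180 * rank_moment 4 n + 180 * rank_moment 2 n + 12 * rank_moment 0 n) + (20 * rank_moment 6 n - 10 * rank_moment 4 n - 10 * rank_moment 2 n) = 2 * fps_nth (pgf * mpoly 3 6) n"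
proof -
  have "int n * (\<Sum>(i, c)\<leftarrow>[(4, 180), (2, 180), (0, 12)]. c * rank_moment i n)
      + (\<Sum>(i, c)\<leftarrow>[(6, 20), (4, -10), (2, -10)]. c * rank_moment i n) = 2 * fps_nth (pgf * mpoly 3 6) n"
    by (rule rank_moment_relation) (simp, algebra)+
  then show ?thesis by (simp add: algebra_simps)
qed

lemma rank_relation_8:
  "int n * (336 * rank_moment 6 n + 840 * rank_moment 4 n + 336 * rank_moment 2 n + 12 * rank_moment 0 n) + (42 * rank_moment 8 n + 28 * rank_moment 6 n - 56 * rank_moment 4 n - 14 * rank_moment 2 n) = 2 * fps_nth (pgf * mpoly 3 8) n"
proof -
  have "int n * (\<Sum>(i, c)\<leftarrow>[(6, 336), (4, 840), (2, 336), (0, 12)]. c * rank_moment i n)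
      + (\<Sum>(i, c)\<leftarrow>[(8, 42), (6, 28), (4, -56), (2, -14)]. c * rank_moment i n) = 2 * fps_nth (pgf * mpoly 3 8) n"
    by (rule rank_moment_relation) (simp, algebra)+
  then show ?thesis by (simp add: algebra_simps)
qed

lemma rank_relation_10:
  "int n * (540 * rank_moment 8 n + 2520 * rank_moment 6 n + 2520 * rank_moment 4 n + 540 * rank_moment 2 n + 12 * rank_moment 0 n) + (72 * rank_moment 10 n + 180 * rank_moment 8 n - 84 * rank_moment 6 n - 150 * rank_moment 4 n - 18 * rank_moment 2 n) = 2 * fps_nth (pgf * mpoly 3 10) n"
proof -
  have "int n * (\<Sum>(i, c)\<leftarrow>[(8, 540), (6, 2520), (4, 2520), (2, 540), (0, 12)]. c * rank_moment i n)
      + (\<Sum>(i, c)\<leftarrow>[(10, 72), (8, 180), (6, -84), (4, -150), (2, -18)]. c * rank_moment i n) = 2 * fps_nth (pgf * mpoly 3 10) n"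
    by (rule rank_moment_relation) (simp, algebra)+
  then show ?thesis by (simp add: algebra_simps)
qed

lemma rank_relation_12:
  "int n * (792 * rank_moment 10 n + 5940 * rank_moment 8 n + 11088 * rank_moment 6 n + 5940 * rank_moment 4 n + 792 * rank_moment 2 n + 12 * rank_moment 0 n) + (110 * rank_moment 12 n + 550 * rank_moment 10 n + 264 * rank_moment 8 n - 594 * rank_moment 6 n - 308 * rank_moment 4 n - 22 * rank_moment 2 n) = 2 * fps_nth (pgf * mpoly 3 12) n"
proof -
  have "int n * (\<Sum>(i, c)\<leftarrow>[(10, 792), (8, 5940), (6, 11088), (4, 5940), (2, 792), (0, 12)]. c * rank_moment i n)
      + (\<Sum>(i, c)\<leftarrow>[(12, 110), (10, 550), (8, 264), (6, -594), (4, -308), (2, -22)]. c * rank_moment i n) = 2 * fps_nth (pgf * mpoly 3 12) n"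
    by (rule rank_moment_relation) (simp, algebra)+
  then show ?thesis by (simp add: algebra_simps)
qed

section \<open>The congruences\<close>

text \<open>The multiple p h takes up rank moments whose coefficients become divisible by p; it is 0
  for congruences between crank moments.\<close>

lemma cong_by_rows:
  assumes "rows_check p invs red k1 k3 rows" "\<And>m. fcong p (emono (red m)) (emono m)"
    and "x - y = rows_val n rows + p * h"
  shows "[x = y] (mod p)"
  unfolding cong_iff_dvd_diff using rows_check_sound[OF assms(1,2)] assms(3) by simp

lemma moment_congruence_1:
  "[(int n + 2) * crank_moment 4 n + (6 * int n ^ 2 + 4 * int n + 1) * crank_moment 2 n = 0] (mod 7)"
  (is "[?x = ?y] (mod _)")
proof (rule cong_by_rows)
  let ?rows = "[[(1, 1, 1), (1, 2, 2)],
    [(1, 1, 4), (1, 2, 1)],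
    [(1, 1, 6)]]"
  \<comment> \<open>5 and 4 are the inverses of 24 and 240 modulo 7; the lists below likewise invert
    the scales of \<open>phi_table\<close>.\<close>
  show "rows_check 7 [5, 4] (\<lambda>(a, b, c). (a, b, 0)) 2 0 ?rows"
    by code_simp
  show "fcong 7 (emono ((\<lambda>(a, b, c). (a, b, 0)) m)) (emono m)" for m
    by (rule emono_mod_7)
  show "?x - ?y = rows_val n ?rows + 7 * 0"
    by (simp add: row_val_def crank_moment_eq; algebra?)
qed

lemma moment_congruence_2:
  "[(int n + 5) ^ 3 * crank_moment 4 n = (5 * int n ^ 4 + 10 * int n ^ 3 + 8 * int n ^ 2 + 8 * int n + 9) * crank_moment 2 n] (mod 11)"
  (is "[?x = ?y] (mod _)")
proof (rule cong_by_rows)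
  let ?rows = "[[(1, 1, -9), (1, 2, 125)],
    [(1, 1, -8), (1, 2, 75)],
    [(1, 1, -8), (1, 2, 15)],
    [(1, 1, -10), (1, 2, 1)],
    [(1, 1, -5)]]"
  show "rows_check 11 [6, 5] (\<lambda>(a, b, c). (a, b - min b c, c - min b c)) 2 0 ?rows"
    by code_simp
  show "fcong 11 (emono ((\<lambda>(a, b, c). (a, b - min b c, c - min b c)) m)) (emono m)" for m
    by (rule emono_mod_11)
  show "?x - ?y = rows_val n ?rows + 11 * 0"
    by (simp add: row_val_def crank_moment_eq; algebra?)
qed

lemma moment_congruence_3:
  "[crank_moment 6 n = 2 * (int n + 7) * crank_moment 4 n - (int n + 8) ^ 2 * crank_moment 2 n] (mod 11)"
  (is "[?x = ?y] (mod _)")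
proof (rule cong_by_rows)
  let ?rows = "[[(1, 1, 64), (1, 2, -14), (1, 3, 1)],
    [(1, 1, 16), (1, 2, -2)],
    [(1, 1, 1)]]"
  \<comment> \<open>Here the polynomial vanishes modulo 11 without appeal to E4 E6 = 1, so monomials
    are left unchanged.\<close>
  show "rows_check 11 [6, 5, 5] (\<lambda>m. m) 3 0 ?rows"
    by code_simp
  show "fcong 11 (emono ((\<lambda>m. m) m)) (emono m)" for m
    by (rule fcong_refl)
  show "?x - ?y = rows_val n ?rows + 11 * 0"
    by (simp add: row_val_def crank_moment_eq; algebra?)
qed

lemma moment_congruence_4:
  "[crank_moment 8 n = 2 * (int n + 5) * (int n ^ 2 + 5 * int n + 10) * crank_moment 2 n
    + 6 * (int n ^ 2 + int n + 1) * crank_moment 4 n] (mod 11)"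
  (is "[?x = ?y] (mod _)")
proof (rule cong_by_rows)
  let ?rows = "[[(1, 1, -100), (1, 2, -6), (1, 4, 1)],
    [(1, 1, -70), (1, 2, -6)],
    [(1, 1, -20), (1, 2, -6)],
    [(1, 1, -2)]]"
  show "rows_check 11 [6, 5, 5, 8] (\<lambda>m. m) 4 0 ?rows"
    by code_simp
  show "fcong 11 (emono ((\<lambda>m. m) m)) (emono m)" for m
    by (rule fcong_refl)
  show "?x - ?y = rows_val n ?rows + 11 * 0"
    by (simp add: row_val_def crank_moment_eq; algebra?)
qed

lemma moment_congruence_5:
  "[crank_moment 10 n = 4 * (int n + 7) * (int n ^ 3 + 5 * int n ^ 2 + 29 * int n + 32) * crank_moment 2 n
    + 39 * (int n + 7) * (int n + 14) * (int n + 39) * crank_moment 4 n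
    + (6 * int n ^ 2 + 34 * int n + 39) * crank_moment 6 n
    + 35 * (int n + 13) * crank_moment 8 n] (mod 41)"
  (is "[?x = ?y] (mod _)")
proof (rule cong_by_rows)
  let ?rows = "[[(1, 1, -896), (1, 2, -149058), (1, 3, -39), (1, 4, -455), (1, 5, 1)],
    [(1, 1, -940), (1, 2, -35763), (1, 3, -34), (1, 4, -35)],
    [(1, 1, -256), (1, 2, -2340), (1, 3, -6)],
    [(1, 1, -48), (1, 2, -39)],
    [(1, 1, -4)]]"
  show "rows_check 41 [12, 34, 24, 17, 16] (\<lambda>m. m) 5 0 ?rows"
    by code_simp
  show "fcong 41 (emono ((\<lambda>m. m) m)) (emono m)" for m
    by (rule fcong_refl)
  show "?x - ?y = rows_val n ?rows + 41 * 0"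
    by (simp add: row_val_def crank_moment_eq; algebra?)
qed

lemma moment_congruence_6:
  "[(int n + 7) * (int n + 25) * (int n + 31) * (int n ^ 2 + 28 * int n + 6) * rank_moment 2 n
    + rank_moment 12 n = (4 * int n ^ 5 + 10 * int n ^ 4 + 6 * int n ^ 3 + 30 * int n ^ 2 + 31 * int n + 33) * crank_moment 2 n
    + (int n ^ 4 + 4 * int n ^ 3 + 42 * int n ^ 2 + 24 * int n + 30) * crank_moment 4 n
    + 40 * (int n + 10) * (int n ^ 2 + 32 * int n + 7) * crank_moment 6 n
    + 31 * (int n + 13) * (int n + 41) * crank_moment 8 n
    + (int n + 11) * crank_moment 10 n + 22 * crank_moment 12 n] (mod 43)"
  (is "[?x = ?y] (mod _)")
proof (rule cong_by_rows)
  let ?rows = "[[(1, 1, -33), (1, 2, -30), (1, 3, -2800), (1, 4, -16523), (1, 5, -11), (1, 6, -22), (3, 2, -26), (3, 4, 40), (3, 5, -30), (3, 6, 18)],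
    [(1, 0, -12), (1, 1, -31), (1, 2, -24), (1, 3, -13080), (1, 4, -1674), (1, 5, -1), (3, 2, -34), (3, 3, -36), (3, 4, 40), (3, 5, -26)],
    [(1, 0, -8), (1, 1, -30), (1, 2, -42), (1, 3, -1680), (1, 4, -31), (3, 2, 8), (3, 3, -14), (3, 4, -22)],
    [(1, 0, -4), (1, 1, -6), (1, 2, -4), (1, 3, -40), (3, 2, -12), (3, 3, -26)],
    [(1, 0, 13), (1, 1, -10), (1, 2, -1), (3, 2, 6)],
    [(1, 0, 7), (1, 1, -4)]]"
  show "rows_check 43 [9, 31, 25, 37, 36, 25] (\<lambda>m. m) 6 6 ?rows"
    by code_simp
  show "fcong 43 (emono ((\<lambda>m. m) m)) (emono m)" for m
    by (rule fcong_refl)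
  \<comment> \<open>The rank relations are combined with multipliers that cancel the moments of
    order 12, 10, 8, 6 and 4 modulo 43: 9 is the inverse of 110, the coefficient of N_12, and the
    others follow in descending order. \<open>?h\<close> collects the multiples of 43. The values of
    \<open>mpoly 3\<close> left over form the entries (3, k, c) of the rows, and N_0 the entries (1,
    0, c).\<close>
  let ?h = "(- 23) * rank_moment 12 n + (- 144 * int n - 90) * rank_moment 10 n + (174 * int n ^ 2 - 1020 * int n - 12) * rank_moment 8 n + (92 * int n ^ 3 + 616 * int n ^ 2 - 1628 * int n + 82) * rank_moment 6 n + (54 * int n ^ 4 + 242 * int n ^ 3 + 430 * int n ^ 2 - 776 * int n + 40) * rank_moment 4 n + (- 5 * int n ^ 5 + 67 * int n ^ 4 + 173 * int n ^ 3 + 1001 * int n ^ 2 + 3578 * int n + 760) * rank_moment 2 n + (- 1 * int n ^ 5 + 5 * int n ^ 4 + 4 * int n ^ 3 + 8 * int n ^ 2) * rank_moment 0 n"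
  have "?x - ?y - (rows_val n ?rows + 43 * ?h) =
    (9) * (int n * (792 * rank_moment 10 n + 5940 * rank_moment 8 n + 11088 * rank_moment 6 n + 5940 * rank_moment 4 n + 792 * rank_moment 2 n + 12 * rank_moment 0 n) + (110 * rank_moment 12 n + 550 * rank_moment 10 n + 264 * rank_moment 8 n - 594 * rank_moment 6 n - 308 * rank_moment 4 n - 22 * rank_moment 2 n) - 2 * fps_nth (pgf * mpoly 3 12) n)
    + (- 13 * int n - 15) * (int n * (540 * rank_moment 8 n + 2520 * rank_moment 6 n + 2520 * rank_moment 4 n + 540 * rank_moment 2 n + 12 * rank_moment 0 n) + (72 * rank_moment 10 n + 180 * rank_moment 8 n - 84 * rank_moment 6 n - 150 * rank_moment 4 n - 18 * rank_moment 2 n) - 2 * fps_nth (pgf * mpoly 3 10) n)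
    + (- 11 * int n ^ 2 + 20 * int n + 20) * (int n * (336 * rank_moment 6 n + 840 * rank_moment 4 n + 336 * rank_moment 2 n + 12 * rank_moment 0 n) + (42 * rank_moment 8 n + 28 * rank_moment 6 n - 56 * rank_moment 4 n - 14 * rank_moment 2 n) - 2 * fps_nth (pgf * mpoly 3 8) n)
    + (- 13 * int n ^ 3 - 7 * int n ^ 2 - 18 * int n) * (int n * (180 * rank_moment 4 n + 180 * rank_moment 2 n + 12 * rank_moment 0 n) + (20 * rank_moment 6 n - 10 * rank_moment 4 n - 10 * rank_moment 2 n) - 2 * fps_nth (pgf * mpoly 3 6) n)
    + (3 * int n ^ 4 - 6 * int n ^ 3 + 4 * int n ^ 2 - 17 * int n - 13) * (int n * (72 * rank_moment 2 n + 12 * rank_moment 0 n) + (6 * rank_moment 4 n - 6 * rank_moment 2 n) - 2 * fps_nth (pgf * mpoly 3 4) n)"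
    by (simp add: row_val_def crank_moment_eq rank_moment_0[of _ 1] del: mpoly.simps; algebra)
  also have "\<dots> = 0"
    by (simp only: rank_relation_12 rank_relation_10 rank_relation_8 rank_relation_6 rank_relation_4 diff_self mult_zero_right add_0)
  finally show "?x - ?y = rows_val n ?rows + 43 * ?h"
    by (rule iffD2[OF eq_iff_diff_eq_0])
qed

lemma moment_congruence_7:
  "[crank_moment 10 n = 36 * (int n + 19) * (int n ^ 3 + 50 * int n ^ 2 + 20 * int n + 36) * crank_moment 2 n
    + (52 * int n ^ 3 + 28 * int n ^ 2 + 26 * int n + 52) * crank_moment 4 n
    + (36 * int n ^ 2 + 11 * int n + 32) * crank_moment 6 n
    + 47 * (int n + 17) * crank_moment 8 n] (mod 53)"
  (is "[?x = ?y] (mod _)")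
proof (rule cong_by_rows)
  let ?rows = "[[(1, 1, -24624), (1, 2, -52), (1, 3, -32), (1, 4, -799), (1, 5, 1)],
    [(1, 1, -14976), (1, 2, -26), (1, 3, -11), (1, 4, -47)],
    [(1, 1, -34920), (1, 2, -28), (1, 3, -36)],
    [(1, 1, -2484), (1, 2, -52)],
    [(1, 1, -36)]]"
  show "rows_check 53 [42, 36, 2, 18, 52] (\<lambda>m. m) 5 0 ?rows"
    by code_simp
  show "fcong 53 (emono ((\<lambda>m. m) m)) (emono m)" for m
    by (rule fcong_refl)
  show "?x - ?y = rows_val n ?rows + 53 * 0"
    by (simp add: row_val_def crank_moment_eq; algebra?)
qed

lemma moment_congruence_8:
  "[crank_moment 8 n = (10 * int n ^ 3 + 73 * int n ^ 2 + 40 * int n + 82) * crank_moment 2 n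
    + (72 * int n ^ 2 + 23 * int n + 28) * crank_moment 4 n
    + 10 * (int n + 41) * crank_moment 6 n] (mod 83)"
  (is "[?x = ?y] (mod _)")
proof (rule cong_by_rows)
  let ?rows = "[[(1, 1, -82), (1, 2, -28), (1, 3, -410), (1, 4, 1)],
    [(1, 1, -40), (1, 2, -23), (1, 3, -10)],
    [(1, 1, -73), (1, 2, -72)],
    [(1, 1, -10)]]"
  show "rows_check 83 [45, 46, 14, 23] (\<lambda>m. m) 4 0 ?rows"
    by code_simp
  show "fcong 83 (emono ((\<lambda>m. m) m)) (emono m)" for m
    by (rule fcong_refl)
  show "?x - ?y = rows_val n ?rows + 83 * 0"
    by (simp add: row_val_def crank_moment_eq; algebra?)
qed

lemma moment_congruence_9:
  "[rank_moment 12 n - 367 * (int n + 332) * (int n + 487) * (int n + 664) * (int n ^ 2 + 265 * int n + 155) * rank_moment 2 n = 352 * (int n + 247) * (int n + 734) * (int n ^ 3 + 147 * int n ^ 2 + 597 * int n + 363) * crank_moment 2 n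
    + 88 * (int n + 530) * (int n + 701) * (int n + 709) * (int n + 740) * crank_moment 4 n
    + 577 * (int n + 114) * (int n + 427) * (int n + 682) * crank_moment 6 n
    + (295 * int n ^ 2 + 177 * int n + 674) * crank_moment 8 n
    + 271 * (int n + 336) * crank_moment 10 n + 654 * crank_moment 12 n] (mod 797)"
  (is "[?x = ?y] (mod _)")
proof (rule cong_by_rows)
  let ?rows = "[[(1, 1, -23165533248), (1, 2, -17153569822400), (1, 3, -19155474492), (1, 4, -674), (1, 5, -91056), (1, 6, -654), (3, 2, -566), (3, 3, -14), (3, 4, -732), (3, 5, 22), (3, 6, -768)],
    [(1, 0, 393), (1, 1, -38224035168), (1, 2, -104209901840), (1, 3, -240978280), (1, 4, -177), (1, 5, -271), (3, 2, 386), (3, 3, 636), (3, 4, -740), (3, 5, 478)],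
    [(1, 0, 222), (1, 1, -9587362752), (1, 2, -235831992), (1, 3, -705671), (1, 4, -295), (3, 2, 180), (3, 3, 658), (3, 4, 458)],
    [(1, 0, 194), (1, 1, -114787904), (1, 2, -235840), (1, 3, -577), (3, 2, 550), (3, 3, -362)],
    [(1, 0, -331), (1, 1, -397056), (1, 2, -88), (3, 2, -298)],
    [(1, 0, 194), (1, 1, -352)]]"
  show "rows_check 797 [631, 621, 68, 709, 637, 773] (\<lambda>m. m) 6 6 ?rows"
    by code_simp
  show "fcong 797 (emono ((\<lambda>m. m) m)) (emono m)" for m
    by (rule fcong_refl)
  \<comment> \<open>The same elimination modulo 797, starting from -384, the inverse of 110.\<close>
  let ?h = "(53) * rank_moment 12 n + (360 * int n + 264) * rank_moment 10 n + (- 174 * int n ^ 2 + 2820 * int n + 144) * rank_moment 8 n + (- 92 * int n ^ 3 - 616 * int n ^ 2 + 5492 * int n - 272) * rank_moment 6 n + (42 * int n ^ 4 - 320 * int n ^ 3 - 418 * int n ^ 2 + 3236 * int n - 170) * rank_moment 4 n + (13 * int n ^ 5 - 790 * int n ^ 4 - 506082 * int n ^ 3 - 135631471 * int n ^ 2 - 13150879960 * int n - 7662571966) * rank_moment 2 n + (2 * int n ^ 5 - int n ^ 4 - 10 * int n ^ 3 - 6 * int n ^ 2 + 15 * int n) * rank_moment 0 n"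
  have "?x - ?y - (rows_val n ?rows + 797 * ?h) =
    (- 384) * (int n * (792 * rank_moment 10 n + 5940 * rank_moment 8 n + 11088 * rank_moment 6 n + 5940 * rank_moment 4 n + 792 * rank_moment 2 n + 12 * rank_moment 0 n) + (110 * rank_moment 12 n + 550 * rank_moment 10 n + 264 * rank_moment 8 n - 594 * rank_moment 6 n - 308 * rank_moment 4 n - 22 * rank_moment 2 n) - 2 * fps_nth (pgf * mpoly 3 12) n)
    + (239 * int n + 11) * (int n * (540 * rank_moment 8 n + 2520 * rank_moment 6 n + 2520 * rank_moment 4 n + 540 * rank_moment 2 n + 12 * rank_moment 0 n) + (72 * rank_moment 10 n + 180 * rank_moment 8 n - 84 * rank_moment 6 n - 150 * rank_moment 4 n - 18 * rank_moment 2 n) - 2 * fps_nth (pgf * mpoly 3 10) n)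
    + (229 * int n ^ 2 - 370 * int n - 366) * (int n * (336 * rank_moment 6 n + 840 * rank_moment 4 n + 336 * rank_moment 2 n + 12 * rank_moment 0 n) + (42 * rank_moment 8 n + 28 * rank_moment 6 n - 56 * rank_moment 4 n - 14 * rank_moment 2 n) - 2 * fps_nth (pgf * mpoly 3 8) n)
    + (- 181 * int n ^ 3 + 329 * int n ^ 2 + 318 * int n - 7) * (int n * (180 * rank_moment 4 n + 180 * rank_moment 2 n + 12 * rank_moment 0 n) + (20 * rank_moment 6 n - 10 * rank_moment 4 n - 10 * rank_moment 2 n) - 2 * fps_nth (pgf * mpoly 3 6) n)
    + (- 149 * int n ^ 4 + 275 * int n ^ 3 + 90 * int n ^ 2 + 193 * int n - 283) * (int n * (72 * rank_moment 2 n + 12 * rank_moment 0 n) + (6 * rank_moment 4 n - 6 * rank_moment 2 n) - 2 * fps_nth (pgf * mpoly 3 4) n)"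
    by (simp add: row_val_def crank_moment_eq rank_moment_0[of _ 1] del: mpoly.simps; algebra)
  also have "\<dots> = 0"
    by (simp only: rank_relation_12 rank_relation_10 rank_relation_8 rank_relation_6 rank_relation_4 diff_self mult_zero_right add_0)
  finally show "?x - ?y = rows_val n ?rows + 797 * ?h"
    by (rule iffD2[OF eq_iff_diff_eq_0])
qed

lemma moment_congruence_10:
  "[crank_moment 14 n = (44976165 * int n ^ 6 + 23584476 * int n ^ 5 + 19728425 * int n ^ 4 + 8711555 * int n ^ 3 + 36781660 * int n ^ 2 + 70780973 * int n + 108798274) * crank_moment 2 n
    + 77429163 * (int n + 4141548) * (int n + 113894720) * (int n ^ 3 + 42853554 * int n ^ 2 + 28914352 * int n + 100598975) * crank_moment 4 n
    + (12571854 * int n ^ 4 + 82951807 * int n ^ 3 + 9501843 * int n ^ 2 + 38248242 * int n + 118847240) * crank_moment 6 n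
    + 84218605 * (int n + 53645347) * (int n ^ 2 + 6688335 * int n + 93582728) * crank_moment 8 n
    + 73449678 * (int n + 40889782) * (int n + 59666357) * crank_moment 10 n
    + 89188917 * (int n + 120667368) * crank_moment 12 n] (mod 120667369)"
  (is "[?x = ?y] (mod _)")
proof (rule cong_by_rows)
  \<comment> \<open>The huge entries are unreduced products of the linear and polynomial factors in
    the statement; reduction happens during the check.\<close>
  let ?rows = "[[(1, 1, -108798274), (1, 2, -3674213687834187804622699488000), (1, 3, -118847240), (1, 4, -422800802862390510090680), (1, 5, -179198435474919170835972), (1, 6, -10762191869160456), (1, 7, 1)],
    [(1, 1, -70780973), (1, 2, -1056050525225425881144277730460), (1, 3, -38248242), (1, 4, -30217479291436939647665), (1, 5, -7385816030473242), (1, 6, -89188917)],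
    [(1, 1, -36781660), (1, 2, -1565156516391483963009833961813), (1, 3, -9501843), (1, 4, -5081218532553610), (1, 5, -73449678)],
    [(1, 1, -8711555), (1, 2, -428181263143665546029592), (1, 3, -82951807), (1, 4, -84218605)],
    [(1, 1, -19728425), (1, 2, -12457564252678986), (1, 3, -12571854)],
    [(1, 1, -23584476), (1, 2, -77429163)],
    [(1, 1, -44976165)]]"
  \<comment> \<open>The first and last inverses coincide because E2 and E14 both carry the scale
    24.\<close>
  show "rows_check 120667369 [115639562, 35697430, 11252711, 17848715, 98270774, 65989507, 115639562] (\<lambda>m. m) 7 0 ?rows"
    by code_simp
  show "fcong 120667369 (emono ((\<lambda>m. m) m)) (emono m)" for m
    by (rule fcong_refl)
  show "?x - ?y = rows_val n ?rows + 120667369 * 0"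
    by (simp add: row_val_def crank_moment_eq; algebra?)
qed

theorem theorem6p1:
  fixes n :: nat
  shows
    "[(int n + 2) * crank_moment 4 n
          + (6 * int n ^ 2 + 4 * int n + 1) * crank_moment 2 n
        = 0] (mod 7)
    \<and> [(int n + 5) ^ 3 * crank_moment 4 n
        = (5 * int n ^ 4 + 10 * int n ^ 3 + 8 * int n ^ 2 + 8 * int n + 9) * crank_moment 2 n] (mod 11)
    \<and> [crank_moment 6 n
        = 2 * (int n + 7) * crank_moment 4 n
          - (int n + 8) ^ 2 * crank_moment 2 n] (mod 11)
    \<and> [crank_moment 8 n
        = 2 * (int n + 5) * (int n ^ 2 + 5 * int n + 10) * crank_moment 2 n
          + 6 * (int n ^ 2 + int n + 1) * crank_moment 4 n] (mod 11)
    \<and> [crank_moment 10 n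
        = 4 * (int n + 7) * (int n ^ 3 + 5 * int n ^ 2 + 29 * int n + 32) * crank_moment 2 n
          + 39 * (int n + 7) * (int n + 14) * (int n + 39) * crank_moment 4 n
          + (6 * int n ^ 2 + 34 * int n + 39) * crank_moment 6 n
          + 35 * (int n + 13) * crank_moment 8 n] (mod 41)
    \<and> [(int n + 7) * (int n + 25) * (int n + 31) * (int n ^ 2 + 28 * int n + 6) * rank_moment 2 n
          + rank_moment 12 n
        = (4 * int n ^ 5 + 10 * int n ^ 4 + 6 * int n ^ 3 + 30 * int n ^ 2 + 31 * int n + 33) * crank_moment 2 n
          + (int n ^ 4 + 4 * int n ^ 3 + 42 * int n ^ 2 + 24 * int n + 30) * crank_moment 4 n
          + 40 * (int n + 10) * (int n ^ 2 + 32 * int n + 7) * crank_moment 6 n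
          + 31 * (int n + 13) * (int n + 41) * crank_moment 8 n
          + (int n + 11) * crank_moment 10 n
          + 22 * crank_moment 12 n] (mod 43)
    \<and> [crank_moment 10 n
        = 36 * (int n + 19) * (int n ^ 3 + 50 * int n ^ 2 + 20 * int n + 36) * crank_moment 2 n
          + (52 * int n ^ 3 + 28 * int n ^ 2 + 26 * int n + 52) * crank_moment 4 n
          + (36 * int n ^ 2 + 11 * int n + 32) * crank_moment 6 n
          + 47 * (int n + 17) * crank_moment 8 n] (mod 53)
    \<and> [crank_moment 8 n
        = (10 * int n ^ 3 + 73 * int n ^ 2 + 40 * int n + 82) * crank_moment 2 n
          + (72 * int n ^ 2 + 23 * int n + 28) * crank_moment 4 n
          + 10 * (int n + 41) * crank_moment 6 n] (mod 83)
    \<and> [rank_moment 12 n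
          - 367 * (int n + 332) * (int n + 487) * (int n + 664) * (int n ^ 2 + 265 * int n + 155) * rank_moment 2 n
        = 352 * (int n + 247) * (int n + 734) * (int n ^ 3 + 147 * int n ^ 2 + 597 * int n + 363) * crank_moment 2 n
          + 88 * (int n + 530) * (int n + 701) * (int n + 709) * (int n + 740) * crank_moment 4 n
          + 577 * (int n + 114) * (int n + 427) * (int n + 682) * crank_moment 6 n
          + (295 * int n ^ 2 + 177 * int n + 674) * crank_moment 8 n
          + 271 * (int n + 336) * crank_moment 10 n
          + 654 * crank_moment 12 n] (mod 797)
    \<and> [crank_moment 14 n
        = (44976165 * int n ^ 6 + 23584476 * int n ^ 5 + 19728425 * int n ^ 4 + 8711555 * int n ^ 3 + 36781660 * int n ^ 2 + 70780973 * int n + 108798274) * crank_moment 2 n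
          + 77429163 * (int n + 4141548) * (int n + 113894720) * (int n ^ 3 + 42853554 * int n ^ 2 + 28914352 * int n + 100598975) * crank_moment 4 n
          + (12571854 * int n ^ 4 + 82951807 * int n ^ 3 + 9501843 * int n ^ 2 + 38248242 * int n + 118847240) * crank_moment 6 n
          + 84218605 * (int n + 53645347) * (int n ^ 2 + 6688335 * int n + 93582728) * crank_moment 8 n
          + 73449678 * (int n + 40889782) * (int n + 59666357) * crank_moment 10 n
          + 89188917 * (int n + 120667368) * crank_moment 12 n] (mod 120667369)"
  by (intro conjI moment_congruence_1 moment_congruence_2 moment_congruence_3 moment_congruence_4 moment_congruence_5 moment_congruence_6 moment_congruence_7 moment_congruence_8 moment_congruence_9 moment_congruence_10)

end
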